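(* Let $G$ be a compact Hausdorff group and $X$ a complete operator space. Let $\nu\in M_{ac}(G,X)$ be a semivariation translation invariant vector measure with $\nu(G)\neq0$. If $f,g\in L^1(\nu)$, then for $[\pi]\in\widehat{G}$ and $x'\in X'$, $$\widehat{f*_\nu g(x')}(\pi)=d_\pi\langle\langle\widehat{g}^\nu(\pi)\widehat{f}(\pi),x'\rangle\rangle.$$ Further, for $1\leq i,j\leq d_\pi$, the $(i,j)$-entry of $\widehat{g}^\nu(\pi)\widehat{f}(\pi)$ is given by $$(\widehat{g}^\nu(\pi)\widehat{f}(\pi))_{ij}=\frac1{d_\pi^2}\int_G(\tilde f*\overline{\pi_{ji}})(t)\,g(t)\,d\nu(t),$$ where $\pi_{ji}$ denotes the function $t\mapsto\pi(t)_{ji}$.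
   Context: $m_G$ is normalized Haar measure; $X'$ is the dual of $X$ with closed unit ball $B_{X'}$. $M_{ac}(G,X)$: $\sigma$-additive $X$-valued vector measures $\nu$ on the Borel sets of $G$ with $\lim_{m_G(A)\to0}\nu(A)=0$. $\langle\nu,x'\rangle(A)=\langle\nu(A),x'\rangle$, with total variation $|\langle\nu,x'\rangle|$, and $d\langle\nu,x'\rangle=h_{x'}\,dm_G$ with $h_{x'}\in L^1(G)$. $L^1(\nu)$: functions $f:G\to\mathbb{C}$ with $f\in L^1(|\langle\nu,x'\rangle|)$ for all $x'$ and such that for each Borel $A$ there is a unique $\int_Af\,d\nu\in X$ with $\langle\int_Af\,d\nu,x'\rangle=\int_Af\,d\langle\nu,x'\rangle$ for all $x'$. For $t\in G$ let $\tau_t(s)=st$, $\nu_{\tau_t}(A)=\nu(\tau_t(A))$; for a simple function $\phi$, $\nu_\phi(A)=\int_A\phi\,d\nu$; for a vector measure $\mu$, $\|\mu\|=\sup_{x'\in B_{X'}}|\langle\mu,x'\rangle|(G)$. $\nu$ is semivariation translation invariant if $\|(\nu_{\tau_t})_\phi\|=\|\nu_\phi\|$ for all $t\in G$ and all complex simple $\phi$. For such $\nu$ with $\nu(G)\ne0$, $L^1(\nu)\subset L^1(G)$. Scalar convolution: $f*k(t)=\int_Gf(ts^{-1})k(s)\,dm_G(s)$; $\tilde f(t)=f(t^{-1})$. $f*_\nu g(x')=f*(gh_{x'})$. $\widehat G$: classes of irreducible unitary representations $\pi$ of $G$, $d_\pi=\dim\mathcal{H}_\pi$, $\pi(t)_{ij}=\langle\pi(t)e_j^\pi,e_i^\pi\rangle$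 for a fixed ordered orthonormal basis. For $k\in L^1(G)$, $\widehat k(\pi)_{ij}=\frac1{d_\pi}\int_Gk(t)\overline{\pi(t)_{ji}}\,dm_G(t)$. For $g\in L^1(\nu)$, $\widehat g^\nu(\pi)\in M_{d_\pi}(X)$ has entries $\frac1{d_\pi}\int_Gg(t)\overline{\pi(t)_{ji}}\,d\nu(t)$. The product $\widehat g^\nu(\pi)\widehat f(\pi)$ is the matrix product, and $\langle\langle[x_{ij}],x'\rangle\rangle:=[\langle x_{ij},x'\rangle]$. *)

theory Defs
  imports "HOL-Analysis.Analysis" "Jordan_Normal_Form.Matrix"
begin

section \<open>Complex normed spaces, duals, Hilbert spaces\<close>

class complex_normed_space = real_normed_vector +
  fixes scaleC :: "complex \<Rightarrow> 'a \<Rightarrow> 'a"  (infixr \<open>*\<^sub>C\<close> 75)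
  assumes scaleC_add_right: "c *\<^sub>C (x + y) = c *\<^sub>C x + c *\<^sub>C y"
    and scaleC_add_left: "(b + c) *\<^sub>C x = b *\<^sub>C x + c *\<^sub>C x"
    and scaleC_scaleC: "b *\<^sub>C c *\<^sub>C x = (b * c) *\<^sub>C x"
    and scaleC_one: "1 *\<^sub>C x = x"
    and scaleR_scaleC: "r *\<^sub>R x = complex_of_real r *\<^sub>C x"
    and norm_scaleC: "norm (c *\<^sub>C x) = cmod c * norm x"

global_interpretation complex_vector:
  vector_space "scaleC :: complex \<Rightarrow> 'a \<Rightarrow> 'a::complex_normed_space"
  by unfold_locales (simp_all add: scaleC_add_right scaleC_add_left scaleC_scaleC scaleC_one)

definition dual :: "('x::complex_normed_space \<Rightarrow> complex) set" where
  "dual = {x'. bounded_linear x' \<and> (\<forall>c x. x' (c *\<^sub>C x) = c * x' x)}"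

definition dual_ball :: "('x::complex_normed_space \<Rightarrow> complex) set" where
  "dual_ball = {x' \<in> dual. onorm x' \<le> 1}"

text \<open>The inner product is linear in its first argument.\<close>

class complex_inner = complex_normed_space +
  fixes cinner :: "'a \<Rightarrow> 'a \<Rightarrow> complex"
  assumes cinner_commute: "cinner x y = cnj (cinner y x)"
    and cinner_add_left: "cinner (x + y) z = cinner x z + cinner y z"
    and cinner_scaleC_left: "cinner (c *\<^sub>C x) y = c * cinner x y"
    and cinner_self: "cinner x x = complex_of_real ((norm x)\<^sup>2)"


section \<open>Matrices over a vector space; operator spaces\<close>

definition left_mat_mult :: "complex mat \<Rightarrow> 'x::complex_normed_space mat \<Rightarrow> 'x mat" where
  "left_mat_mult a x = Matrix.mat (dim_row a) (dim_col x)
     (\<lambda>(i, j). \<Sum>k<dim_row x. (a $$ (i, k)) *\<^sub>C (x $$ (k, j)))"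

definition right_mat_mult :: "'x::complex_normed_space mat \<Rightarrow> complex mat \<Rightarrow> 'x mat" where
  "right_mat_mult x a = Matrix.mat (dim_row x) (dim_col a)
     (\<lambda>(i, j). \<Sum>k<dim_col x. (a $$ (k, j)) *\<^sub>C (x $$ (i, k)))"

definition l2_norm_vec :: "complex Matrix.vec \<Rightarrow> real" where
  "l2_norm_vec v = L2_set (\<lambda>i. cmod (vec_index v i)) {..<dim_vec v}"

definition mat_op_norm :: "complex mat \<Rightarrow> real" where
  "mat_op_norm a = (SUP v \<in> {v \<in> carrier_vec (dim_col a). l2_norm_vec v \<le> 1}.
     l2_norm_vec (a *\<^sub>v v))"

text \<open>Abstract operator spaces, by Ruan's axioms: \<open>matrix_norm\<close> restricted to n-by-n matrices is
  the norm of \<open>M\<^sub>n(X)\<close>. The space is complete iff the type is of class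
  \<^class>\<open>complete_space\<close>.\<close>

locale operator_space =
  fixes matrix_norm :: "'x::complex_normed_space mat \<Rightarrow> real"
  assumes matrix_norm_eq_0:
      "A \<in> carrier_mat n n \<Longrightarrow> matrix_norm A = 0 \<longleftrightarrow> A = 0\<^sub>m n n"
    and matrix_norm_triangle:
      "A \<in> carrier_mat n n \<Longrightarrow> B \<in> carrier_mat n n \<Longrightarrow>
         matrix_norm (A + B) \<le> matrix_norm A + matrix_norm B"
    and matrix_norm_scaleC:
      "A \<in> carrier_mat n n \<Longrightarrow> matrix_norm (map_mat (scaleC c) A) = cmod c * matrix_norm A"
    and matrix_norm_1: "matrix_norm (Matrix.mat 1 1 (\<lambda>_. x)) = norm x"
    and matrix_norm_direct_sum:
      "A \<in> carrier_mat p p \<Longrightarrow> B \<in> carrier_mat n n \<Longrightarrow>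
         matrix_norm (four_block_mat A (0\<^sub>m p n) (0\<^sub>m n p) B)
           = max (matrix_norm A) (matrix_norm B)"
    and matrix_norm_mult:
      "a \<in> carrier_mat n p \<Longrightarrow> A \<in> carrier_mat p p \<Longrightarrow> b \<in> carrier_mat p n \<Longrightarrow>
         matrix_norm (right_mat_mult (left_mat_mult a A) b)
           \<le> mat_op_norm a * matrix_norm A * mat_op_norm b"


section \<open>Complex measures\<close>

text \<open>Set functions \<open>\<mu>\<close> are only ever evaluated at Borel sets.\<close>

definition variation :: "('g::topological_space set \<Rightarrow> complex) \<Rightarrow> 'g set \<Rightarrow> ennreal" where
  "variation \<mu> A =
     (SUP P \<in> {P. finite P \<and> P \<subseteq> sets borel \<and> disjoint P \<and> \<Union>P = A}.
        \<Sum>E\<in>P. ennreal (cmod (\<mu> E)))"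

definition variation_measure :: "('g::topological_space set \<Rightarrow> complex) \<Rightarrow> 'g measure" where
  "variation_measure \<mu> = measure_of UNIV (sets borel) (variation \<mu>)"

text \<open>The positive part in the Jordan decomposition of a real measure \<open>\<rho>\<close>; the negative part is
  the positive part of \<open>- \<rho>\<close>. (\<^const>\<open>ennreal\<close> sends negative reals to 0.)\<close>

definition positive_part :: "('g::topological_space set \<Rightarrow> real) \<Rightarrow> 'g measure" where
  "positive_part \<rho> =
     measure_of UNIV (sets borel) (\<lambda>A. SUP B \<in> {B \<in> sets borel. B \<subseteq> A}. ennreal (\<rho> B))"

definition signed_integral ::
    "('g::topological_space set \<Rightarrow> real) \<Rightarrow> 'g set \<Rightarrow> ('g \<Rightarrow> complex) \<Rightarrow> complex" where
  "signed_integral \<rho> A f =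
     (LINT t:A|positive_part \<rho>. f t) - (LINT t:A|positive_part (\<lambda>B. - \<rho> B). f t)"

definition complex_measure_integral ::
    "('g::topological_space set \<Rightarrow> complex) \<Rightarrow> 'g set \<Rightarrow> ('g \<Rightarrow> complex) \<Rightarrow> complex" where
  "complex_measure_integral \<mu> A f =
     signed_integral (\<lambda>B. Re (\<mu> B)) A f + \<i> * signed_integral (\<lambda>B. Im (\<mu> B)) A f"


section \<open>Vector measures\<close>

definition vector_measure :: "('g::topological_space set \<Rightarrow> 'x::real_normed_vector) \<Rightarrow> bool" where
  "vector_measure \<nu> \<longleftrightarrow>
     (\<forall>A :: nat \<Rightarrow> 'g set. range A \<subseteq> sets borel \<longrightarrow> disjoint_family A \<longrightarrow>
        (\<lambda>n. \<nu> (A n)) sums \<nu> (\<Union>n. A n))"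

definition M_ac ::
    "'g::topological_space measure \<Rightarrow> ('g set \<Rightarrow> 'x::real_normed_vector) set" where
  "M_ac m = {\<nu>. vector_measure \<nu> \<and>
     (\<forall>\<epsilon>>0. \<exists>\<delta>>0. \<forall>A\<in>sets borel. measure m A < \<delta> \<longrightarrow> norm (\<nu> A) < \<epsilon>)}"

definition scalar_measure ::
    "('g set \<Rightarrow> 'x) \<Rightarrow> ('x \<Rightarrow> complex) \<Rightarrow> 'g set \<Rightarrow> complex" where
  "scalar_measure \<nu> x' A = x' (\<nu> A)"

definition is_vector_integral ::
    "('g::topological_space set \<Rightarrow> 'x::complex_normed_space) \<Rightarrow> 'g set \<Rightarrow> ('g \<Rightarrow> complex) \<Rightarrow> 'x \<Rightarrow> bool"
  where
  "is_vector_integral \<nu> A f x \<longleftrightarrow>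
     (\<forall>x'\<in>dual. x' x = complex_measure_integral (scalar_measure \<nu> x') A f)"

definition vector_integral ::
    "('g::topological_space set \<Rightarrow> 'x::complex_normed_space) \<Rightarrow> 'g set \<Rightarrow> ('g \<Rightarrow> complex) \<Rightarrow> 'x"
  where
  "vector_integral \<nu> A f = (THE x. is_vector_integral \<nu> A f x)"

definition L1_vm ::
    "('g::topological_space set \<Rightarrow> 'x::complex_normed_space) \<Rightarrow> ('g \<Rightarrow> complex) set" where
  "L1_vm \<nu> = {f. (\<forall>x'\<in>dual. integrable (variation_measure (scalar_measure \<nu> x')) f) \<and>
                 (\<forall>A\<in>sets borel. \<exists>!x. is_vector_integral \<nu> A f x)}"

definition semivariation ::
    "('g::topological_space set \<Rightarrow> 'x::complex_normed_space) \<Rightarrow> ennreal" where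
  "semivariation \<nu> = (SUP x'\<in>dual_ball. variation (scalar_measure \<nu> x') UNIV)"


section \<open>Compact groups\<close>

text \<open>Groups are not assumed commutative: \<^class>\<open>topological_group_add\<close> is the class of arbitrary
  topological groups, written additively. Thus \<open>s + t\<close>, \<open>- t\<close>, \<open>t - s\<close> and \<open>0\<close> stand for the
  product \<open>s t\<close>, the inverse of \<open>t\<close>, the product of \<open>t\<close> with the inverse of \<open>s\<close>, and the identity.\<close>

definition normalized_haar :: "'g::topological_group_add measure \<Rightarrow> bool" where
  "normalized_haar m \<longleftrightarrow> sets m = sets borel \<and> emeasure m UNIV = 1 \<and>
     (\<forall>t. \<forall>A\<in>sets borel. emeasure m ((\<lambda>s. t + s) ` A) = emeasure m A) \<and>
     (\<forall>A\<in>sets borel. emeasure m A = (INF U \<in> {U. open U \<and> A \<subseteq> U}. emeasure m U)) \<and>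
     (\<forall>U. open U \<longrightarrow> emeasure m U = (SUP K \<in> {K. compact K \<and> K \<subseteq> U}. emeasure m K))"

definition right_translate ::
    "'g::topological_group_add \<Rightarrow> ('g set \<Rightarrow> 'x) \<Rightarrow> 'g set \<Rightarrow> 'x" where
  "right_translate t \<nu> A = \<nu> ((\<lambda>s. s + t) ` A)"

definition semivariation_translation_invariant ::
    "('g::topological_group_add set \<Rightarrow> 'x::complex_normed_space) \<Rightarrow> bool" where
  "semivariation_translation_invariant \<nu> \<longleftrightarrow>
     (\<forall>t. \<forall>\<phi> :: 'g \<Rightarrow> complex. simple_function borel \<phi> \<longrightarrow>
        semivariation (\<lambda>A. vector_integral (right_translate t \<nu>) A \<phi>)
          = semivariation (\<lambda>A. vector_integral \<nu> A \<phi>))"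

definition convolution ::
    "'g::topological_group_add measure \<Rightarrow> ('g \<Rightarrow> complex) \<Rightarrow> ('g \<Rightarrow> complex) \<Rightarrow> 'g \<Rightarrow> complex" where
  "convolution m f k t = (LINT s|m. f (t - s) * k s)"

definition reflect :: "('g::topological_group_add \<Rightarrow> complex) \<Rightarrow> 'g \<Rightarrow> complex" where
  "reflect f t = f (- t)"

text \<open>A version of the Radon-Nikodym derivative of \<open>\<mu>\<close> with respect to \<open>m\<close>; it is determined up
  to \<open>m\<close>-null sets.\<close>

definition rn_density ::
    "'g::topological_space measure \<Rightarrow> ('g set \<Rightarrow> complex) \<Rightarrow> 'g \<Rightarrow> complex" where
  "rn_density m \<mu> =
     (SOME h. integrable m h \<and> (\<forall>A\<in>sets borel. \<mu> A = (LINT t:A|m. h t)))"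

definition vm_convolution ::
    "'g::topological_group_add measure \<Rightarrow> ('g set \<Rightarrow> 'x) \<Rightarrow> ('g \<Rightarrow> complex) \<Rightarrow> ('g \<Rightarrow> complex)
       \<Rightarrow> ('x \<Rightarrow> complex) \<Rightarrow> 'g \<Rightarrow> complex" where
  "vm_convolution m \<nu> f g x' =
     convolution m f (\<lambda>s. g s * rn_density m (scalar_measure \<nu> x') s)"


section \<open>Representations and Fourier transforms\<close>

definition unitary_operator :: "('h::complex_inner \<Rightarrow> 'h) \<Rightarrow> bool" where
  "unitary_operator U \<longleftrightarrow>
     (\<forall>v w. U (v + w) = U v + U w) \<and> (\<forall>c v. U (c *\<^sub>C v) = c *\<^sub>C U v) \<and>
     (\<forall>v w. cinner (U v) (U w) = cinner v w) \<and> surj U"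

definition unitary_rep ::
    "('g::topological_group_add \<Rightarrow> 'h::complex_inner \<Rightarrow> 'h) \<Rightarrow> bool" where
  "unitary_rep \<pi> \<longleftrightarrow>
     (\<forall>t. unitary_operator (\<pi> t)) \<and> (\<forall>s t. \<pi> (s + t) = \<pi> s \<circ> \<pi> t) \<and>
     (\<forall>v. continuous_on UNIV (\<lambda>t. \<pi> t v))"

definition irreducible_unitary_rep ::
    "('g::topological_group_add \<Rightarrow> 'h::complex_inner \<Rightarrow> 'h) \<Rightarrow> bool" where
  "irreducible_unitary_rep \<pi> \<longleftrightarrow> unitary_rep \<pi> \<and> (UNIV :: 'h set) \<noteq> {0} \<and>
     (\<forall>V. complex_vector.subspace V \<and> closed V \<and> (\<forall>t. \<pi> t ` V \<subseteq> V) \<longrightarrow> V = {0} \<or> V = UNIV)"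

definition rep_dim :: "('g \<Rightarrow> 'h::complex_normed_space \<Rightarrow> 'h) \<Rightarrow> nat" where
  "rep_dim \<pi> = complex_vector.dim (UNIV :: 'h set)"

text \<open>Bases and matrices are indexed from 0. Over an infinite-dimensional space
  \<^term>\<open>rep_dim \<pi>\<close> is 0 and the predicate below is false; irreducible unitary representations of
  compact groups are finite-dimensional.\<close>

definition rep_basis :: "('g \<Rightarrow> 'h::complex_inner \<Rightarrow> 'h) \<Rightarrow> (nat \<Rightarrow> 'h) \<Rightarrow> bool" where
  "rep_basis \<pi> e \<longleftrightarrow>
     (\<forall>i<rep_dim \<pi>. \<forall>j<rep_dim \<pi>. cinner (e i) (e j) = (if i = j then 1 else 0)) \<and>
     complex_vector.span (e ` {..<rep_dim \<pi>}) = UNIV"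

definition rep_coeff ::
    "('g \<Rightarrow> 'h::complex_inner \<Rightarrow> 'h) \<Rightarrow> (nat \<Rightarrow> 'h) \<Rightarrow> nat \<Rightarrow> nat \<Rightarrow> 'g \<Rightarrow> complex" where
  "rep_coeff \<pi> e i j t = cinner (\<pi> t (e j)) (e i)"

definition fourier ::
    "'g measure \<Rightarrow> ('g \<Rightarrow> complex) \<Rightarrow> ('g \<Rightarrow> 'h::complex_inner \<Rightarrow> 'h) \<Rightarrow> (nat \<Rightarrow> 'h) \<Rightarrow> complex mat"
  where
  "fourier m k \<pi> e = Matrix.mat (rep_dim \<pi>) (rep_dim \<pi>)
     (\<lambda>(i, j). 1 / of_nat (rep_dim \<pi>) * (LINT t|m. k t * cnj (rep_coeff \<pi> e j i t)))"

definition vm_fourier ::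
    "('g::topological_space set \<Rightarrow> 'x::complex_normed_space) \<Rightarrow> ('g \<Rightarrow> complex)
       \<Rightarrow> ('g \<Rightarrow> 'h::complex_inner \<Rightarrow> 'h) \<Rightarrow> (nat \<Rightarrow> 'h) \<Rightarrow> 'x mat" where
  "vm_fourier \<nu> g \<pi> e = Matrix.mat (rep_dim \<pi>) (rep_dim \<pi>)
     (\<lambda>(i, j). (1 / of_nat (rep_dim \<pi>)) *\<^sub>C
        vector_integral \<nu> UNIV (\<lambda>t. g t * cnj (rep_coeff \<pi> e j i t)))"

end

theory Submission
  imports Defs
begin

text \<open>Write \<open>h\<close> for the density of \<open>\<langle>\<nu>, x'\<rangle>\<close> and \<open>\<pi>\<^sub>j\<^sub>i\<close> for the matrix coefficients. Fubini's theorem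
  and invariance of Haar measure turn the Fourier integral of the convolution into
  \<open>\<integral> (f * gh)(t) cnj \<pi>\<^sub>j\<^sub>i(t) dt = \<integral> g(s) h(s) (\<integral> f(u) cnj \<pi>\<^sub>j\<^sub>i(us) du) ds\<close>,
  and since \<open>\<pi>\<^sub>j\<^sub>i(us) = \<Sum>\<^sub>k \<pi>\<^sub>j\<^sub>k(u) \<pi>\<^sub>k\<^sub>i(s)\<close>, the inner integral is the finite sum
  \<open>\<Sum>\<^sub>k (\<integral> f cnj \<pi>\<^sub>j\<^sub>k) cnj \<pi>\<^sub>k\<^sub>i(s)\<close>. This gives the entry of a matrix product tested against \<open>x'\<close>. The same
  inner integral is the convolution of the reflected \<open>f\<close> with \<open>cnj \<pi>\<^sub>j\<^sub>i\<close>, evaluated at \<open>s\<close>, which gives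
  the second formula, as functionals separate the points of \<open>X\<close>
  (\<open>integral_times_rep_coeff_plus\<close>, \<open>convolution_reflect_rep_coeff\<close>, \<open>integral_vm_convolution\<close>).
  
  Three facts carry this computation. The first is that \<open>f\<close> is integrable for Haar measure
  (\<open>L1_vm_imp_integrable\<close>). For simple \<open>\<phi>\<close>, the average over \<open>t\<close> of the values at \<open>x'\<close> of the integrals of
  \<open>\<phi>\<close> against the translates of \<open>\<nu>\<close> equals \<open>(\<integral> \<phi>) \<langle>\<nu>(G), x'\<rangle>\<close>, while for \<open>x'\<close> in the dual unit ball the modulus of each of these values is at most
  the semivariation of \<open>\<phi> d\<nu>\<close>. Thus \<open>\<bar>\<integral> \<phi>\<bar>\<close> is controlled by that semivariation; for
  \<open>0 \<le> \<phi> \<le> \<bar>f\<bar>\<close> the semivariation stays bounded by the uniform boundedness principle.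
  
  The second is that \<open>g cnj \<pi>\<^sub>k\<^sub>i\<close> has integrals in \<open>X\<close> itself, not just in the bidual
  (\<open>L1_vm_times_bounded\<close>): a bounded function is a uniform limit of simple functions, and the
  corresponding integrals form a Cauchy sequence, again because the weak integrals
  \<open>\<integral> \<bar>g h\<bar>\<close> are bounded over the dual unit ball. The Hahn-Banach theorem supplies norming functionals
  and with them the passage from weak to norm bounds.
  
  The third is Fubini's theorem for convolutions (\<open>integral_convolution\<close>). As \<open>G\<close> may fail to be second
  countable, \<open>(s, t) \<mapsto> f(t - s)\<close> need not be measurable for the product of the Borel
  \<open>\<sigma>\<close>-algebras. It is measurable if \<open>f\<close> is a Baire function, and by regularity every Borel
  function agrees almost everywhere with a Baire function. Replacing \<open>f\<close> by that function changes no value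
  of the convolution, because null sets remain null under \<open>s \<mapsto> t - s\<close>.\<close>

section \<open>Norming functionals and weakly bounded sets\<close>

definition sublinear :: "('a::real_vector \<Rightarrow> real) \<Rightarrow> bool" where
  "sublinear q \<longleftrightarrow> q 0 = 0 \<and> (\<forall>x y. q (x + y) \<le> q x + q y) \<and> (\<forall>r>0. \<forall>x. q (r *\<^sub>R x) \<le> r * q x)"

lemma sublinear_zero: "sublinear q \<Longrightarrow> q 0 = 0"
  and sublinear_add: "sublinear q \<Longrightarrow> q (x + y) \<le> q x + q y"
  by (auto simp: sublinear_def)

lemma sublinear_scale:
  assumes "sublinear q" "0 \<le> r"
  shows "q (r *\<^sub>R x) = r * q x"
proof (cases "r = 0")
  case False
  then have r: "0 < r" using assms by simp
  have "q ((1/r) *\<^sub>R (r *\<^sub>R x)) \<le> (1/r) * q (r *\<^sub>R x)"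
    using assms r unfolding sublinear_def by (meson zero_less_divide_1_iff)
  then have "r * q x \<le> q (r *\<^sub>R x)" using r by (simp add: field_simps)
  then show ?thesis using assms r unfolding sublinear_def by (meson antisym)
qed (use assms in \<open>simp add: sublinear_zero\<close>)

lemma sublinear_lower: "sublinear q \<Longrightarrow> - q (- x) \<le> q x"
  using sublinear_add[of q x "- x"] sublinear_zero[of q] by simp

text \<open>The largest sublinear functional below \<open>q\<close> whose value at \<open>- y\<close> is at most \<open>- q y\<close>. If \<open>q\<close> is minimal
  among sublinear functionals, it must coincide with \<open>push_down q y\<close> for every \<open>y\<close>, which makes \<open>q\<close> odd.\<close>

definition push_down :: "('a::real_vector \<Rightarrow> real) \<Rightarrow> 'a \<Rightarrow> 'a \<Rightarrow> real" where
  "push_down q y x = (INF t\<in>{0..}. q (x + t *\<^sub>R y) - t * q y)"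

lemma push_down_le:
  assumes q: "sublinear q" and t: "0 \<le> t"
  shows "push_down q y x \<le> q (x + t *\<^sub>R y) - t * q y"
  unfolding push_down_def
proof (rule cINF_lower)
  have "- q (- x) \<le> q (x + t *\<^sub>R y) - t * q y" if "0 \<le> t" for t
    using sublinear_add[OF q, of "x + t *\<^sub>R y" "- x"] sublinear_scale[OF q that, of y] by simp
  then show "bdd_below ((\<lambda>t. q (x + t *\<^sub>R y) - t * q y) ` {0..})"
    by (intro bdd_belowI2) auto
qed (use t in simp)

lemma push_down_greatest:
  "(\<And>t. 0 \<le> t \<Longrightarrow> a \<le> q (x + t *\<^sub>R y) - t * q y) \<Longrightarrow> a \<le> push_down q y x"
  unfolding push_down_def by (rule cINF_greatest) auto

lemma sublinear_push_down:
  assumes q: "sublinear q"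
  shows "sublinear (push_down q y)"
  unfolding sublinear_def
proof (intro conjI allI impI)
  show "push_down q y 0 = 0"
    using push_down_le[OF q, of 0 y 0] sublinear_zero[OF q]
    by (intro antisym push_down_greatest) (simp_all add: sublinear_scale[OF q])
next
  fix x z
  have "push_down q y (x + z) - (q (z + s *\<^sub>R y) - s * q y) \<le> push_down q y x" if s: "0 \<le> s" for s
  proof (rule push_down_greatest)
    fix t :: real assume t: "0 \<le> t"
    have "push_down q y (x + z) \<le> q ((x + t *\<^sub>R y) + (z + s *\<^sub>R y)) - (t + s) * q y"
      using push_down_le[OF q, of "t + s" y "x + z"] s t by (simp add: algebra_simps)
    also have "\<dots> \<le> q (x + t *\<^sub>R y) + q (z + s *\<^sub>R y) - (t + s) * q y"
      using sublinear_add[OF q] by simp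
    finally show "push_down q y (x + z) - (q (z + s *\<^sub>R y) - s * q y) \<le> q (x + t *\<^sub>R y) - t * q y"
      by (simp add: algebra_simps)
  qed
  then have "push_down q y (x + z) - push_down q y x \<le> push_down q y z"
    by (intro push_down_greatest) (simp add: algebra_simps)
  then show "push_down q y (x + z) \<le> push_down q y x + push_down q y z" by simp
next
  fix r :: real and x assume r: "0 < r"
  have "push_down q y (r *\<^sub>R x) / r \<le> push_down q y x"
  proof (rule push_down_greatest)
    fix t :: real assume t: "0 \<le> t"
    have "push_down q y (r *\<^sub>R x) \<le> q (r *\<^sub>R (x + t *\<^sub>R y)) - (r * t) * q y"
      using push_down_le[OF q, of "r * t" y "r *\<^sub>R x"] r t by (simp add: algebra_simps)
    also have "\<dots> = r * (q (x + t *\<^sub>R y) - t * q y)"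
      using sublinear_scale[OF q, of r "x + t *\<^sub>R y"] r by (simp add: algebra_simps)
    finally show "push_down q y (r *\<^sub>R x) / r \<le> q (x + t *\<^sub>R y) - t * q y"
      using r by (simp add: field_simps)
  qed
  then show "push_down q y (r *\<^sub>R x) \<le> r * push_down q y x" using r by (simp add: field_simps)
qed

lemma push_down_below: "sublinear q \<Longrightarrow> push_down q y x \<le> q x"
  using push_down_le[of q 0 y x] by simp

lemma push_down_uminus: "sublinear q \<Longrightarrow> push_down q y (- y) \<le> - q y"
  using push_down_le[of q 1 y "- y"] sublinear_zero[of q] by simp

text \<open>The Hahn-Banach theorem in its sublinear form. Chains of sublinear functionals below \<open>p\<close> have a
  pointwise infimum, finite because \<open>- p (- x)\<close> is a lower bound; so Zorn's lemma gives a
  minimal one, and \<open>push_down\<close> shows that a minimal one is linear.\<close>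

lemma linear_below_sublinear:
  assumes p: "sublinear p"
  obtains u where "linear u" "\<And>x. u x \<le> p x"
proof -
  define A where "A = {q. sublinear q \<and> q \<le> p}"
  define R where "R = relation_of (\<lambda>a b. b \<le> a) A"
  have "\<exists>u\<in>A. \<forall>a\<in>A. a \<le> u \<longrightarrow> a = u"
  proof (rule predicate_Zorn)
    show "partial_order_on A (relation_of (\<lambda>a b. b \<le> a) A)"
      by (rule partial_order_on_relation_ofI) auto
  next
    fix C assume "C \<in> Chains (relation_of (\<lambda>a b. b \<le> a) A)"
    then have total: "\<And>a b. a \<in> C \<Longrightarrow> b \<in> C \<Longrightarrow> a \<le> b \<or> b \<le> a"
      and CA: "C \<subseteq> A"
      unfolding Chains_def relation_of_def by blast+
    show "\<exists>u\<in>A. \<forall>a\<in>C. u \<le> a"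
    proof (cases "C = {}")
      case True then show ?thesis using p by (auto simp: A_def)
    next
      case False
      define u where "u x = (INF q\<in>C. q x)" for x
      have sub: "sublinear q" if "q \<in> C" for q using that CA by (auto simp: A_def)
      have le_p: "q x \<le> p x" if "q \<in> C" for q x using that CA by (auto simp: A_def le_fun_def)
      have "- p (- x) \<le> q x" if "q \<in> C" for q x
        using sublinear_lower[OF sub[OF that], of x] le_p[OF that, of "- x"] by simp
      then have bdd: "bdd_below ((\<lambda>q. q x) ` C)" for x by (intro bdd_belowI2) auto
      have lower: "u x \<le> q x" if "q \<in> C" for q x
        unfolding u_def using bdd that by (rule cINF_lower)
      have greatest: "(\<And>q. q \<in> C \<Longrightarrow> a \<le> q x) \<Longrightarrow> a \<le> u x" for a x
        unfolding u_def using False by (intro cINF_greatest) auto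
      have "sublinear u"
        unfolding sublinear_def
      proof (intro conjI allI impI)
        obtain q where "q \<in> C" using False by blast
        then show "u 0 = 0"
          using lower[of q 0] sublinear_zero[OF sub] greatest[of 0 0] by (metis antisym order_refl)
      next
        fix x y
        have "u (x + y) - q2 y \<le> u x" if q2: "q2 \<in> C" for q2
        proof (rule greatest)
          fix q1 assume q1: "q1 \<in> C"
          obtain q where q: "q \<in> C" "q \<le> q1" "q \<le> q2" using total[OF q1 q2] q1 q2 by blast
          have "u (x + y) \<le> q (x + y)" using lower q by blast
          also have "\<dots> \<le> q x + q y" using sublinear_add sub q by blast
          also have "\<dots> \<le> q1 x + q2 y" using q by (intro add_mono) (auto simp: le_fun_def)
          finally show "u (x + y) - q2 y \<le> q1 x" by simp
        qed
        then have "u (x + y) - u x \<le> u y" by (intro greatest) (simp add: algebra_simps)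
        then show "u (x + y) \<le> u x + u y" by simp
      next
        fix r :: real and x assume r: "0 < r"
        have "u (r *\<^sub>R x) / r \<le> u x"
        proof (rule greatest)
          fix q assume q: "q \<in> C"
          show "u (r *\<^sub>R x) / r \<le> q x"
            using lower[OF q, of "r *\<^sub>R x"] sublinear_scale[OF sub[OF q], of r x] r
            by (simp add: field_simps)
        qed
        then show "u (r *\<^sub>R x) \<le> r * u x" using r by (simp add: field_simps)
      qed
      moreover obtain q where "q \<in> C" using False by blast
      then have "u \<le> p" using lower le_p order_trans unfolding le_fun_def by meson
      ultimately show ?thesis using lower by (auto simp: A_def le_fun_def)
    qed
  qed
  then obtain u where u: "u \<in> A" and min: "\<And>a. a \<in> A \<Longrightarrow> a \<le> u \<Longrightarrow> a = u" by blast
  have sub: "sublinear u" and up: "u \<le> p" using u by (auto simp: A_def)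
  \<comment> \<open>Minimality of \<open>u\<close> makes it odd; an odd sublinear functional is linear.\<close>
  have "push_down u y = u" for y
  proof (rule min)
    show "push_down u y \<le> u" using push_down_below[OF sub] by (auto simp: le_fun_def)
    then show "push_down u y \<in> A" using sublinear_push_down[OF sub] up by (auto simp: A_def)
  qed
  then have neg: "u (- y) = - u y" for y
    using push_down_uminus[OF sub, of y] sublinear_lower[OF sub, of y] by simp
  have "linear u"
  proof (rule linearI)
    fix x y show "u (x + y) = u x + u y"
      using sublinear_add[OF sub, of x y] sublinear_add[OF sub, of "- x" "- y"]
        neg[of x] neg[of y] neg[of "x + y"] by simp
  next
    fix r x show "u (r *\<^sub>R x) = r *\<^sub>R u x"
      using sublinear_scale[OF sub, of r x] sublinear_scale[OF sub, of "- r" x] neg[of "r *\<^sub>R x"]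
      by (cases "0 \<le> r") auto
  qed
  then show thesis using that up by (auto simp: le_fun_def)
qed

text \<open>A linear functional below \<open>push_down norm x0\<close> is at most \<open>- norm x0\<close> at \<open>- x0\<close>, hence attains the norm
  at \<open>x0\<close>.\<close>

lemma norming_functional:
  fixes x0 :: "'a::real_normed_vector"
  obtains u where "linear u" "\<And>x. \<bar>u x\<bar> \<le> norm x" "u x0 = norm x0"
proof -
  have n: "sublinear (norm :: 'a \<Rightarrow> real)"
    by (auto simp: sublinear_def norm_triangle_ineq)
  obtain u where lin: "linear u" and u: "\<And>x. u x \<le> push_down norm x0 x"
    using linear_below_sublinear[OF sublinear_push_down[OF n]] by blast
  have le: "u x \<le> norm x" for x using u push_down_below[OF n] order_trans by blast
  have "\<bar>u x\<bar> \<le> norm x" for x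
    using le[of x] le[of "- x"] linear_neg[OF lin, of x] by simp
  moreover have "u x0 = norm x0"
    using u[of "- x0"] push_down_uminus[OF n, of x0] le[of x0] linear_neg[OF lin, of x0] by simp
  ultimately show thesis using lin that by blast
qed

text \<open>Bohnenblust and Sobczyk: the complex functional with real part \<open>u\<close> has no larger norm, because
  a rotation of the argument makes its value real without changing the norm of the argument.\<close>

lemma complexify_functional:
  fixes u :: "'x::complex_normed_space \<Rightarrow> real"
  assumes "linear u" and "0 \<le> B" and bound: "\<And>x. \<bar>u x\<bar> \<le> B * norm x" 
  defines "z \<equiv> \<lambda>x. Complex (u x) (- u (\<i> *\<^sub>C x))"
  shows "z \<in> dual" and "onorm z \<le> B"
proof -
  interpret u: linear u by fact
  have scale: "z (c *\<^sub>C x) = c * z x" for c x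
  proof -
    have split: "c *\<^sub>C x = Re c *\<^sub>R x + Im c *\<^sub>R (\<i> *\<^sub>C x)"
      unfolding scaleR_scaleC scaleC_scaleC scaleC_add_left[symmetric]
      by (metis complex_eq mult.commute)
    have split2: "\<i> *\<^sub>C c *\<^sub>C x = Re c *\<^sub>R (\<i> *\<^sub>C x) - Im c *\<^sub>R x"
      unfolding split scaleR_scaleC scaleC_add_right scaleC_scaleC
      by (simp add: mult.commute[of \<i>]) 
         (metis (no_types, lifting) complex_vector.scale_minus_left i_squared mult.assoc mult.commute mult_minus1_right of_real_minus uminus_add_conv_diff add.commute)
    show ?thesis
      unfolding z_def split2 unfolding split 
      by (simp add: u.add u.scaleR u.diff complex_eq_iff)
  qed
  have add: "z (x + y) = z x + z y" for x y
    unfolding z_def by (simp add: scaleC_add_right u.add complex_eq_iff)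
  have norm: "cmod (z x) \<le> B * norm x" for x
  proof (cases "z x = 0")
    case True then show ?thesis using \<open>0 \<le> B\<close> by simp
  next
    case False
    define c where "c = cnj (sgn (z x))"
    have "z (c *\<^sub>C x) = cmod (z x)"
      unfolding scale c_def using False
      by (simp add: sgn_eq mult.commute[of "cnj (z x)"] flip: complex_norm_square)
         (simp add: power2_eq_square)
    then have "cmod (z x) = u (c *\<^sub>C x)" unfolding z_def by (metis Re_complex_of_real complex.sel(1))
    also have "\<dots> \<le> B * norm (c *\<^sub>C x)" using bound[of "c *\<^sub>C x"] by simp
    also have "norm (c *\<^sub>C x) = norm x" using False by (simp add: norm_scaleC c_def norm_sgn)
    finally show ?thesis .
  qed
  have "bounded_linear z"
  proof (rule bounded_linear_intro)
    show "z (r *\<^sub>R x) = r *\<^sub>R z x" for r x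
      by (simp add: scaleR_scaleC scale scaleR_conv_of_real)
  qed (use add norm in \<open>auto simp: mult.commute\<close>)
  then show "z \<in> dual" using scale by (auto simp: dual_def)
  show "onorm z \<le> B" using \<open>0 \<le> B\<close> norm by (intro onorm_bound) auto
qed

lemma dual_diff: "x' \<in> dual \<Longrightarrow> x' (x - y) = x' x - x' y"
  and dual_zero: "x' \<in> dual \<Longrightarrow> x' 0 = 0"
  and dual_scaleC: "x' \<in> dual \<Longrightarrow> x' (c *\<^sub>C x) = c * x' x"
  and dual_sum: "x' \<in> dual \<Longrightarrow> x' (\<Sum>i\<in>I. F i) = (\<Sum>i\<in>I. x' (F i))"
  by (auto simp: dual_def linear_simps linear_sum bounded_linear.linear)

lemma dual_bounded_linear: "x' \<in> dual \<Longrightarrow> bounded_linear x'"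
  and dual_ball_dual: "x' \<in> dual_ball \<Longrightarrow> x' \<in> dual"
  by (auto simp: dual_def dual_ball_def)

lemma dual_ball_bound: "x' \<in> dual_ball \<Longrightarrow> cmod (x' x) \<le> norm x"
  using onorm[of x' x] mult_right_mono[of "onorm x'" 1 "norm x"]
  by (fastforce simp: dual_ball_def dual_def)

lemma dual_ball_norming:
  fixes x0 :: "'x::complex_normed_space"
  obtains x' where "x' \<in> dual_ball" "norm x0 \<le> cmod (x' x0)"
proof -
  obtain u :: "'x \<Rightarrow> real" where u: "linear u" "\<And>x. \<bar>u x\<bar> \<le> norm x" "u x0 = norm x0"
    using norming_functional by blast
  let ?z = "\<lambda>x. Complex (u x) (- u (\<i> *\<^sub>C x))"
  have "?z \<in> dual_ball"
    using complexify_functional[OF u(1), of 1] u(2) by (simp add: dual_ball_def)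
  moreover have "norm x0 \<le> cmod (?z x0)"
    using complex_Re_le_cmod[of "?z x0"] u(3) by simp
  ultimately show thesis by (rule that)
qed

lemma dual_separates:
  assumes "\<And>x'. x' \<in> dual \<Longrightarrow> x' x = x' y"
  shows "x = y"
proof -
  obtain x' where "x' \<in> dual_ball" "norm (x - y) \<le> cmod (x' (x - y))" by (rule dual_ball_norming)
  then show ?thesis using assms[of x'] by (simp add: dual_diff dual_ball_dual)
qed

text \<open>Banach-Steinhaus for the points of \<open>S\<close> acting on the dual space. The dual is complete and is covered by the
  closed sets on which all of \<open>S\<close> is bounded by a given integer, so one of these sets contains a ball
  by Baire's theorem; norming functionals, scaled to the radius of that ball, bound the norms.\<close>

lemma real_weakly_bounded_imp_bounded:
  fixes S :: "'a::real_normed_vector set"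
  assumes weak: "\<And>u :: 'a \<Rightarrow> real. bounded_linear u \<Longrightarrow> bounded (u ` S)"
  shows "bounded S"
proof -
  define E where "E n = {u :: 'a \<Rightarrow>\<^sub>L real. \<forall>x\<in>S. \<bar>blinfun_apply u x\<bar> \<le> real n}" for n :: nat
  have closed: "closed (E n)" for n
  proof -
    have "closed {u :: 'a \<Rightarrow>\<^sub>L real. \<bar>blinfun_apply u x\<bar> \<le> real n}" for x
      by (intro closed_Collect_le continuous_intros)
    moreover have "E n = (\<Inter>x\<in>S. {u. \<bar>blinfun_apply u x\<bar> \<le> real n})"
      by (auto simp: E_def)
    ultimately show ?thesis by auto
  qed
  have "(\<Union>n. E n) = UNIV"
  proof (intro equalityI subsetI UNIV_I)
    fix u :: "'a \<Rightarrow>\<^sub>L real"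
    obtain b where b: "\<And>x. x \<in> S \<Longrightarrow> \<bar>blinfun_apply u x\<bar> \<le> b"
      using weak[OF blinfun.bounded_linear_right, of u] by (auto simp: bounded_iff)
    obtain n :: nat where "b \<le> real n" using real_arch_simple by blast
    then have "u \<in> E n" using b by (fastforce simp: E_def)
    then show "u \<in> (\<Union>n. E n)" by blast
  qed
  moreover have "interior (\<Union>n. E n) = {}" if "\<And>n. interior (E n) = {}"
  proof -
    have "euclidean interior_of (\<Union>(range E)) = {}"
      using that closed
      by (intro Baire_category_alt) (auto simp: completely_metrizable_space_euclidean)
    then show ?thesis by simp
  qed
  ultimately obtain n u0 where "u0 \<in> interior (E n)" by (metis UNIV_not_empty equals0I interior_UNIV)
  then obtain r where r: "0 < r" "cball u0 r \<subseteq> E n"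
    by (meson mem_interior_cball)
  have "norm x \<le> 2 * real n / r" if x: "x \<in> S" for x
  proof -
    obtain u :: "'a \<Rightarrow> real" where u: "linear u" "\<And>x. \<bar>u x\<bar> \<le> norm x" "u x = norm x"
      using norming_functional by blast
    then have bl: "bounded_linear u"
      by (intro bounded_linear_intro[where K=1]) (auto simp: linear_add linear_scale)
    define v where "v = r *\<^sub>R Blinfun u"
    have v: "blinfun_apply v y = r * u y" for y
      unfolding v_def by (simp add: blinfun.scaleR_left bounded_linear_Blinfun_apply[OF bl])
    have "norm v \<le> r"
      using r u(2) by (intro norm_blinfun_bound) (auto simp: v abs_mult)
    then have "u0 \<in> E n" "u0 + v \<in> E n" using r by (auto intro!: subsetD[OF r(2)] simp: dist_norm)
    then have "\<bar>blinfun_apply u0 x\<bar> \<le> real n" "\<bar>blinfun_apply u0 x + r * norm x\<bar> \<le> real n"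
      using x u(3) by (auto simp: E_def blinfun.add_left v)
    then have "r * norm x \<le> 2 * real n" by linarith
    then show ?thesis using r by (simp add: field_simps)
  qed
  then show ?thesis by (auto simp: bounded_iff)
qed

lemma weakly_bounded_imp_bounded:
  fixes S :: "'x::complex_normed_space set"
  assumes "\<And>x'. x' \<in> dual \<Longrightarrow> bounded (x' ` S)"
  shows "bounded S"
proof (rule real_weakly_bounded_imp_bounded)
  fix u :: "'x \<Rightarrow> real" assume u: "bounded_linear u"
  let ?z = "\<lambda>x. Complex (u x) (- u (\<i> *\<^sub>C x))"
  have "\<bar>u x\<bar> \<le> onorm u * norm x" for x using onorm[OF u, of x] by simp
  then have "?z \<in> dual"
    using u by (intro complexify_functional[of u "onorm u"]) (auto simp: onorm_pos_le bounded_linear.linear)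
  then obtain b where b: "\<And>x. x \<in> S \<Longrightarrow> cmod (?z x) \<le> b"
    using assms[of ?z] by (auto simp: bounded_iff)
  have "\<bar>u x\<bar> \<le> b" if "x \<in> S" for x
    using abs_Re_le_cmod[of "?z x"] b[OF that] by simp
  then show "bounded (u ` S)" by (auto simp: bounded_iff)
qed

section \<open>Vector measures on Borel sets\<close>

lemma vector_measureD:
  "vector_measure \<nu> \<Longrightarrow> (\<And>n. A n \<in> sets borel) \<Longrightarrow> disjoint_family A \<Longrightarrow>
     (\<lambda>n. \<nu> (A n)) sums \<nu> (\<Union>n::nat. A n)"
  unfolding vector_measure_def by blast

lemma vector_measure_empty:
  assumes "vector_measure \<nu>"
  shows "\<nu> {} = 0"
proof -
  have "(\<lambda>n::nat. \<nu> {}) sums \<nu> (\<Union>n::nat. {})"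
    using vector_measureD[OF assms, of "\<lambda>n. {}"] by (simp add: disjoint_family_on_def)
  then have "(\<lambda>n::nat. \<nu> {}) \<longlonglongrightarrow> 0" by (intro summable_LIMSEQ_zero sums_summable)
  then show ?thesis by (simp add: LIMSEQ_const_iff)
qed

lemma vector_measure_Un:
  assumes \<nu>: "vector_measure \<nu>" and "A \<in> sets borel" "B \<in> sets borel" "A \<inter> B = {}"
  shows "\<nu> (A \<union> B) = \<nu> A + \<nu> B"
proof -
  have "disjoint_family (binaryset A B)"
    using assms(4) by (auto simp: disjoint_family_on_def binaryset_def fun_upd_apply split: if_splits)
  then have "(\<lambda>n. \<nu> (binaryset A B n)) sums \<nu> (\<Union>n. binaryset A B n)"
    using assms(2,3) by (intro vector_measureD[OF \<nu>]) (simp add: binaryset_def)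
  then show ?thesis
    using binaryset_sums[of \<nu> A B, OF vector_measure_empty[OF \<nu>]]
    by (simp add: UN_binaryset_eq sums_unique2)
qed

lemma vector_measure_Diff:
  assumes \<nu>: "vector_measure \<nu>" and "A \<in> sets borel" "B \<in> sets borel" "B \<subseteq> A"
  shows "\<nu> (A - B) = \<nu> A - \<nu> B"
  using vector_measure_Un[OF \<nu>, of "A - B" B] assms by (simp add: Un_absorb2 Diff_disjoint Int_commute)

text \<open>If the range of \<open>\<nu>\<close> is unbounded on \<open>A\<close>, then \<open>A\<close> splits into two pieces of measure of norm at least 1,
  and the range is unbounded on one of them. Iterating yields disjoint sets
  whose measures have norm at least 1, against countable additivity.\<close>

lemma vector_measure_bounded:
  fixes \<nu> :: "'g::topological_space set \<Rightarrow> 'x::real_normed_vector"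
  assumes \<nu>: "vector_measure \<nu>"
  obtains C where "0 \<le> C" "\<And>A. A \<in> sets borel \<Longrightarrow> norm (\<nu> A) \<le> C"
proof -
  define big where "big A \<longleftrightarrow> (\<forall>C. \<exists>B\<in>sets borel. B \<subseteq> A \<and> C < norm (\<nu> B))" for A
  have step: "\<exists>A'. (A' \<in> sets borel \<and> big A') \<and> A' \<subseteq> A \<and> 1 \<le> norm (\<nu> (A - A'))"
    if A: "A \<in> sets borel \<and> big A" for A
  proof -
    obtain E where E: "E \<in> sets borel" "E \<subseteq> A" "norm (\<nu> A) + 1 < norm (\<nu> E)"
      using A unfolding big_def by blast
    have diff: "\<nu> (A - E) = \<nu> A - \<nu> E" using vector_measure_Diff[OF \<nu>] A E by blast
    have "big E \<or> big (A - E)"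
    proof (rule ccontr)
      assume "\<not> (big E \<or> big (A - E))"
      then obtain C1 C2 where
        C1: "\<And>B. B \<in> sets borel \<Longrightarrow> B \<subseteq> E \<Longrightarrow> norm (\<nu> B) \<le> C1" and
        C2: "\<And>B. B \<in> sets borel \<Longrightarrow> B \<subseteq> A - E \<Longrightarrow> norm (\<nu> B) \<le> C2"
        unfolding big_def by (meson linorder_not_le)
      obtain B where B: "B \<in> sets borel" "B \<subseteq> A" "C1 + C2 < norm (\<nu> B)"
        using A unfolding big_def by blast
      have "\<nu> B = \<nu> (B \<inter> E) + \<nu> (B - E)"
        using vector_measure_Un[OF \<nu>, of "B \<inter> E" "B - E"] B E by (simp add: Int_Diff_Un Int_Diff_disjoint)
      then have "norm (\<nu> B) \<le> norm (\<nu> (B \<inter> E)) + norm (\<nu> (B - E))"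
        by (simp add: norm_triangle_ineq)
      moreover have "norm (\<nu> (B \<inter> E)) \<le> C1" "norm (\<nu> (B - E)) \<le> C2"
        using B E by (auto intro!: C1 C2)
      ultimately show False
        using B(3) by linarith
    qed
    then show ?thesis
    proof
      assume "big E"
      moreover have "1 \<le> norm (\<nu> (A - E))"
        using diff E(3) norm_triangle_ineq2[of "\<nu> E" "\<nu> A"] by (simp add: norm_minus_commute)
      ultimately show ?thesis using E by blast
    next
      assume "big (A - E)"
      moreover have "A - (A - E) = E" using E by blast
      moreover have "1 \<le> norm (\<nu> E)" using E(3) norm_ge_zero[of "\<nu> A"] by linarith
      ultimately show ?thesis using E A by (intro exI[of _ "A - E"]) auto
    qed
  qed
  have "\<not> big UNIV"
  proof
    assume "big UNIV"
    then have "\<exists>A. (A \<in> sets borel \<and> big A)" by (intro exI[of _ UNIV]) auto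
    then obtain A where A: "\<And>n::nat. A n \<in> sets borel" "\<And>n. A (Suc n) \<subseteq> A n"
        "\<And>n. 1 \<le> norm (\<nu> (A n - A (Suc n)))"
      using dependent_nat_choice[of "\<lambda>_ A. A \<in> sets borel \<and> big A"
          "\<lambda>_ A A'. A' \<subseteq> A \<and> 1 \<le> norm (\<nu> (A - A'))", OF _ step] by blast
    define D where "D n = A n - A (Suc n)" for n
    have "disjoint_family D"
    proof -
      have "D k \<inter> D n = {}" if "k < n" for k n
        using lift_Suc_antimono_le[of A "Suc k" n, OF A(2)] that by (auto simp: D_def)
      then show ?thesis unfolding disjoint_family_on_def by (metis Int_commute linorder_neqE_nat)
    qed
    then have "(\<lambda>n. \<nu> (D n)) sums \<nu> (\<Union>n. D n)"
      using A(1) by (intro vector_measureD[OF \<nu>]) (simp_all add: D_def[symmetric], simp add: D_def)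
    then have "(\<lambda>n. \<nu> (D n)) \<longlonglongrightarrow> 0" by (intro summable_LIMSEQ_zero sums_summable)
    then have "(\<lambda>n. norm (\<nu> (D n))) \<longlonglongrightarrow> 0" by (rule tendsto_norm_zero)
    then have "1 \<le> (0::real)"
      by (rule LIMSEQ_le_const) (use A(3) in \<open>auto simp: D_def\<close>)
    then show False by simp
  qed
  then obtain C where C: "\<And>B. B \<in> sets borel \<Longrightarrow> norm (\<nu> B) \<le> C"
    unfolding big_def by (auto simp: not_less)
  then show thesis using that[of C] norm_ge_zero order_trans by (metis sets.empty_sets)
qed

lemma vector_measure_compose:
  assumes "bounded_linear T" "vector_measure \<nu>"
  shows "vector_measure (\<lambda>A. T (\<nu> A))"
  using assms unfolding vector_measure_def by (auto intro: bounded_linear.sums)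

lemma sets_positive_part [simp, measurable_cong]: "sets (positive_part \<rho>) = sets borel"
  and space_positive_part [simp]: "space (positive_part \<rho>) = UNIV"
  unfolding positive_part_def
  using sets.sets_measure_of_eq[of borel] sets.space_measure_of_eq[of borel] by simp_all

lemma ennreal_add_le: "ennreal (a + b) \<le> ennreal a + ennreal b"
  by (cases "0 \<le> a"; cases "0 \<le> b")
     (auto simp: ennreal_neg ennreal_plus[symmetric] simp del: ennreal_plus intro!: ennreal_leI)

lemma ennreal_sums_le:
  assumes "f sums s"
  shows "ennreal s \<le> (\<Sum>i. ennreal (f i))"
proof -
  have *: "ennreal (sum f {..<n}) \<le> (\<Sum>i<n. ennreal (f i))" for n
    by (induction n) (auto intro: order_trans[OF ennreal_add_le] add_mono)
  have "(\<lambda>n. ennreal (sum f {..<n})) \<longlonglongrightarrow> ennreal s"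
    using assms by (auto simp: sums_def intro: tendsto_ennrealI)
  moreover have "ennreal (sum f {..<n}) \<le> (\<Sum>i. ennreal (f i))" for n
    using * sum_le_suminf[of "\<lambda>i. ennreal (f i)" "{..<n}"] by (meson finite_lessThan order_trans summableI zero_le)
  ultimately show ?thesis by (intro LIMSEQ_le_const2) auto
qed

text \<open>The supremum over subsets is a measure: it is superadditive on disjoint sets because nearly optimal subsets
  can be united, and countably subadditive because \<open>\<rho> B\<close> is the sum of the values of \<open>\<rho>\<close> at the pieces of \<open>B\<close>.\<close>

lemma emeasure_positive_part:
  fixes \<rho> :: "'g::topological_space set \<Rightarrow> real"
  assumes \<rho>: "vector_measure \<rho>" and A: "A \<in> sets borel"
  shows "emeasure (positive_part \<rho>) A = (SUP B \<in> {B \<in> sets borel. B \<subseteq> A}. ennreal (\<rho> B))"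
proof -
  define p where "p = (\<lambda>A. SUP B \<in> {B \<in> sets borel. B \<subseteq> A}. ennreal (\<rho> B))"
  have le_p: "ennreal (\<rho> B) \<le> p A" if "B \<in> sets borel" "B \<subseteq> A" for A B
    unfolding p_def using that by (intro SUP_upper) auto
  have p_le: "p A \<le> c" if "\<And>B. B \<in> sets borel \<Longrightarrow> B \<subseteq> A \<Longrightarrow> ennreal (\<rho> B) \<le> c" for A c
    unfolding p_def using that by (intro SUP_least) auto
  have mono: "p A \<le> p B" if "A \<subseteq> B" for A B
    using that by (intro p_le le_p) auto
  have p_empty: "p {} = 0"
    using vector_measure_empty[OF \<rho>] by (intro antisym p_le) auto
  have super: "p A + p B \<le> p (A \<union> B)" if "A \<inter> B = {}" for A B
  proof -
    have ne: "{B \<in> sets borel. B \<subseteq> A} \<noteq> {}" for A :: "'g set" by blast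
    have pair: "ennreal (\<rho> A') + ennreal (\<rho> B') \<le> p (A \<union> B)"
      if A': "A' \<in> sets borel" "A' \<subseteq> A" and B': "B' \<in> sets borel" "B' \<subseteq> B" for A' B'
    proof (cases "0 \<le> \<rho> A' \<and> 0 \<le> \<rho> B'")
      case True
      have "\<rho> (A' \<union> B') = \<rho> A' + \<rho> B'"
        using vector_measure_Un[OF \<rho>, of A' B'] A' B' \<open>A \<inter> B = {}\<close> by blast
      then have "ennreal (\<rho> A') + ennreal (\<rho> B') = ennreal (\<rho> (A' \<union> B'))"
        using True by simp
      also have "\<dots> \<le> p (A \<union> B)" using A' B' by (intro le_p) auto
      finally show ?thesis .
    next
      case False
      have "A' \<subseteq> A \<union> B" "B' \<subseteq> A \<union> B" using A' B' by auto
      then show ?thesis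
        using False le_p[of A' "A \<union> B"] le_p[of B' "A \<union> B"] A' B' by (auto simp: ennreal_neg)
    qed
    have "p A + p B = (SUP A'\<in>{A' \<in> sets borel. A' \<subseteq> A}. ennreal (\<rho> A') + p B)"
      unfolding p_def[of ] by (subst ennreal_SUP_add_left[OF ne]) simp
    also have "\<dots> \<le> p (A \<union> B)"
    proof (rule SUP_least)
      fix A' assume A': "A' \<in> {A' \<in> sets borel. A' \<subseteq> A}"
      have "ennreal (\<rho> A') + p B = (SUP B'\<in>{B' \<in> sets borel. B' \<subseteq> B}. ennreal (\<rho> A') + ennreal (\<rho> B'))"
        unfolding p_def by (subst ennreal_SUP_add_right[OF ne]) simp
      also have "\<dots> \<le> p (A \<union> B)"
        using A' by (intro SUP_least pair) auto
      finally show "ennreal (\<rho> A') + p B \<le> p (A \<union> B)" .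
    qed
    finally show ?thesis .
  qed
  have "countably_additive (sets borel) p"
  proof (rule countably_additiveI)
    fix F :: "nat \<Rightarrow> 'g set"
    assume F: "range F \<subseteq> sets borel" "disjoint_family F" "(\<Union>i. F i) \<in> sets borel"
    show "(\<Sum>i. p (F i)) = p (\<Union>i. F i)"
    proof (rule antisym)
      have "(\<Sum>i<n. p (F i)) \<le> p (\<Union>i<n. F i)" for n
      proof (induction n)
        case (Suc n)
        have "(\<Sum>i<Suc n. p (F i)) \<le> p (\<Union>i<n. F i) + p (F n)"
          using Suc by (simp add: add_right_mono)
        also have "\<dots> \<le> p ((\<Union>i<n. F i) \<union> F n)"
          using disjoint_family_onD[OF F(2), of _ n] by (intro super) fastforce
        also have "(\<Union>i<n. F i) \<union> F n = (\<Union>i<Suc n. F i)" by (auto simp: less_Suc_eq)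
        finally show ?case .
      qed simp
      then have "(\<Sum>i<n. p (F i)) \<le> p (\<Union>i. F i)" for n
        by (rule order_trans) (auto intro: mono)
      then show "(\<Sum>i. p (F i)) \<le> p (\<Union>i. F i)"
        by (intro suminf_le_const) auto
    next
      show "p (\<Union>i. F i) \<le> (\<Sum>i. p (F i))"
      proof (rule p_le)
        fix B assume B: "B \<in> sets borel" "B \<subseteq> (\<Union>i. F i)"
        have "(\<lambda>i. \<rho> (B \<inter> F i)) sums \<rho> (\<Union>i. B \<inter> F i)"
          using F B by (intro vector_measureD[OF \<rho>]) (auto simp: disjoint_family_on_def)
        also have "(\<Union>i. B \<inter> F i) = B" using B by blast
        finally have "ennreal (\<rho> B) \<le> (\<Sum>i. ennreal (\<rho> (B \<inter> F i)))" by (rule ennreal_sums_le)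
        also have "\<dots> \<le> (\<Sum>i. p (F i))"
          using F B by (intro suminf_le le_p) auto
        finally show "ennreal (\<rho> B) \<le> (\<Sum>i. p (F i))" .
      qed
    qed
  qed
  moreover have "positive (sets borel) p" using p_empty by (simp add: positive_def)
  moreover have "sigma_algebra UNIV (sets (borel :: 'g measure))"
    using sets.sigma_algebra_axioms[of borel] by simp
  ultimately have "emeasure (measure_of UNIV (sets borel) p) A = p A"
    using A by (intro emeasure_measure_of_sigma)
  then show ?thesis by (simp only: positive_part_def p_def)
qed

section \<open>Densities of complex measures\<close>

definition has_density ::
    "'g::topological_space measure \<Rightarrow> ('g set \<Rightarrow> 'b) \<Rightarrow> ('g \<Rightarrow> 'b::{banach, second_countable_topology}) \<Rightarrow> bool"
  where
  "has_density m \<mu> h \<longleftrightarrow> integrable m h \<and> (\<forall>A\<in>sets borel. \<mu> A = (LINT t:A|m. h t))"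

lemma ennreal_integral_le:
  fixes f :: "'a \<Rightarrow> real"
  assumes "integrable M f"
  shows "ennreal (integral\<^sup>L M f) \<le> (\<integral>\<^sup>+x. ennreal (f x) \<partial>M)"
proof -
  have "integral\<^sup>L M f \<le> (\<integral>x. max 0 (f x) \<partial>M)"
    using assms by (intro integral_mono) auto
  then have "ennreal (integral\<^sup>L M f) \<le> ennreal (\<integral>x. max 0 (f x) \<partial>M)" by (rule ennreal_leI)
  also have "\<dots> = (\<integral>\<^sup>+x. ennreal (max 0 (f x)) \<partial>M)"
    using assms by (intro nn_integral_eq_integral[symmetric]) auto
  also have "\<dots> = (\<integral>\<^sup>+x. ennreal (f x) \<partial>M)" by (intro nn_integral_cong) (simp add: max_def ennreal_neg)
  finally show ?thesis .
qed

lemma norm_integral_le_integral: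
  fixes f :: "'a \<Rightarrow> 'b::{banach, second_countable_topology}"
  assumes "integrable M f" "integrable M g" "\<And>x. norm (f x) \<le> g x"
  shows "norm (integral\<^sup>L M f) \<le> integral\<^sup>L M g"
  using assms by (intro order_trans[OF integral_norm_bound integral_mono]) auto

text \<open>Rounding the real and imaginary parts down to multiples of \<open>1/n\<close> leaves finitely many values because
  \<open>w\<close> is bounded.\<close>

lemma uniform_simple_approx:
  fixes w :: "'a \<Rightarrow> complex"
  assumes [measurable]: "w \<in> borel_measurable M" and bound: "\<And>x. cmod (w x) \<le> b" and "0 < \<epsilon>"
  obtains \<phi> where "simple_function M \<phi>" "\<And>x. cmod (w x - \<phi> x) \<le> \<epsilon>"
proof -
  \<comment> \<open>The real and the imaginary part each contribute an error of at most \<open>1/n\<close>.\<close>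
  obtain n :: nat where n: "2 / \<epsilon> < real n" using reals_Archimedean2 by blast
  then have n0: "0 < real n" using \<open>0 < \<epsilon>\<close> by (meson divide_pos_pos less_trans zero_less_numeral)
  define \<phi> where "\<phi> x = Complex (\<lfloor>n * Re (w x)\<rfloor> / n) (\<lfloor>n * Im (w x)\<rfloor> / n)" for x
  define c where "c = \<lceil>n * b\<rceil> + 1"
  have in_c: "\<lfloor>n * r\<rfloor> \<in> {-c..c}" if "\<bar>r\<bar> \<le> b" for r :: real
  proof -
    have "\<bar>n * r\<bar> \<le> n * b" using that n0 by (simp add: abs_mult)
    then show ?thesis unfolding c_def by (simp; linarith)
  qed
  have "\<phi> ` space M \<subseteq> (\<lambda>(i, j). Complex (real_of_int i / n) (real_of_int j / n)) ` ({-c..c} \<times> {-c..c})"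
  proof
    fix y assume "y \<in> \<phi> ` space M"
    then obtain x where x: "y = \<phi> x" by blast
    have "\<bar>Re (w x)\<bar> \<le> b" "\<bar>Im (w x)\<bar> \<le> b"
      using bound[of x] abs_Re_le_cmod[of "w x"] abs_Im_le_cmod[of "w x"] by linarith+
    then show "y \<in> (\<lambda>(i, j). Complex (real_of_int i / n) (real_of_int j / n)) ` ({-c..c} \<times> {-c..c})"
      unfolding x \<phi>_def using in_c by (intro image_eqI[where x = "(\<lfloor>n * Re (w x)\<rfloor>, \<lfloor>n * Im (w x)\<rfloor>)"]) auto
  qed
  then have fin: "finite (\<phi> ` space M)" by (rule finite_subset) auto
  have meas: "\<phi> \<in> borel_measurable M"
    unfolding \<phi>_def by (simp add: borel_measurable_complex_iff)
  have simple: "simple_function M \<phi>"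
    using simple_function_borel_measurable[OF meas fin] .
  have "cmod (w x - \<phi> x) \<le> \<epsilon>" for x
  proof -
    have *: "\<bar>r - \<lfloor>n * r\<rfloor> / n\<bar> \<le> 1 / n" for r :: real
    proof -
      have "r - \<lfloor>n * r\<rfloor> / n = (n * r - \<lfloor>n * r\<rfloor>) / n" using n0 by (simp add: field_simps)
      moreover have "\<bar>n * r - \<lfloor>n * r\<rfloor>\<bar> \<le> 1" by linarith
      ultimately show ?thesis using n0 by (simp add: divide_right_mono)
    qed
    have "cmod (w x - \<phi> x) \<le> \<bar>Re (w x - \<phi> x)\<bar> + \<bar>Im (w x - \<phi> x)\<bar>" by (rule cmod_le)
    also have "\<dots> \<le> 1 / n + 1 / n" unfolding \<phi>_def using * by (intro add_mono) auto
    also have "\<dots> \<le> \<epsilon>" using n n0 \<open>0 < \<epsilon>\<close> by (simp add: field_simps)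
    finally show ?thesis .
  qed
  with simple show thesis by (rule that)
qed

lemma simple_function_bounded:
  assumes "simple_function borel (\<phi> :: 'a::topological_space \<Rightarrow> complex)"
  obtains b where "\<And>t. cmod (\<phi> t) \<le> b"
  using finite_imp_bounded[OF simple_functionD(1)[OF assms]] by (auto simp: bounded_iff)

locale finite_borel_measure = finite_measure m for m :: "'g::topological_space measure" +
  assumes sets_m [simp, measurable_cong]: "sets m = sets borel"
begin

lemma space_m [simp]: "space m = UNIV"
  using sets_eq_imp_space_eq[OF sets_m] by simp

lemma borel_measurable_m [simp]: "borel_measurable m = borel_measurable borel"
  by (rule measurable_cong_sets) auto

lemma has_density_integrable: "has_density m \<mu> h \<Longrightarrow> integrable m h"
  and has_density_eq: "has_density m \<mu> h \<Longrightarrow> A \<in> sets borel \<Longrightarrow> \<mu> A = (LINT t:A|m. h t)"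
  by (auto simp: has_density_def)

lemma integrable_on_borel: 
  fixes h :: "'g \<Rightarrow> 'b::{banach, second_countable_topology}"
  shows "integrable m h \<Longrightarrow> A \<in> sets borel \<Longrightarrow> integrable m (\<lambda>t. indicator A t *\<^sub>R h t)"
  by (rule integrable_mult_indicator) auto

lemma positive_part_RN:
  assumes \<rho>: "vector_measure \<rho>" and ac: "\<And>A. A \<in> sets borel \<Longrightarrow> emeasure m A = 0 \<Longrightarrow> \<rho> A = 0"
  obtains r :: "'g \<Rightarrow> real" where "integrable m r"
    "\<And>A. A \<in> sets borel \<Longrightarrow> measure (positive_part \<rho>) A = (LINT t:A|m. r t)"
proof -
  let ?N = "positive_part \<rho>"
  obtain C where C: "0 \<le> C" "\<And>A. A \<in> sets borel \<Longrightarrow> norm (\<rho> A) \<le> C"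
    using vector_measure_bounded[OF \<rho>] by blast
  have "\<rho> B \<le> C" if "B \<in> sets borel" for B using C(2)[OF that] by simp
  then have "emeasure ?N UNIV \<le> ennreal C"
    by (subst emeasure_positive_part[OF \<rho>]) (auto intro!: SUP_least ennreal_leI)
  then have "emeasure ?N UNIV < \<infinity>" using le_less_trans by fastforce
  then interpret N: finite_measure ?N by (intro finite_measureI) auto
  have "absolutely_continuous m ?N"
    unfolding absolutely_continuous_def
  proof
    fix A assume "A \<in> null_sets m"
    then have A: "A \<in> sets borel" "emeasure m A = 0" by auto
    have "\<rho> B = 0" if "B \<in> sets borel" "B \<subseteq> A" for B
      using ac[OF that(1)] emeasure_mono[of B A m] that A by simp
    then have "emeasure ?N A \<le> 0"
      unfolding emeasure_positive_part[OF \<rho> A(1)] by (intro SUP_least) auto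
    then show "A \<in> null_sets ?N" using A by auto
  qed
  then obtain f where [measurable]: "f \<in> borel_measurable borel" and f: "density m f = ?N"
    using Radon_Nikodym_finite_measure[OF N.finite_measure_axioms] by auto
  have em: "emeasure ?N A = (\<integral>\<^sup>+t. f t * indicator A t \<partial>m)" if "A \<in> sets borel" for A
    unfolding f[symmetric] using that by (subst emeasure_density) auto
  have "(\<integral>\<^sup>+t. f t \<partial>m) \<noteq> \<infinity>" using em[of UNIV] N.emeasure_finite[of UNIV] by simp
  then have fin: "AE t in m. f t \<noteq> \<infinity>" by (intro nn_integral_PInf_AE) auto
  \<comment> \<open>The density \<open>f\<close> is infinite only on a null set, where \<open>r\<close> takes the value 0.\<close>
  define r where "r = (\<lambda>t. enn2real (f t))"
  have [measurable]: "r \<in> borel_measurable borel" unfolding r_def by measurable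
  have r0: "0 \<le> r t" for t by (simp add: r_def)
  have em': "emeasure ?N A = (\<integral>\<^sup>+t. ennreal (indicator A t *\<^sub>R r t) \<partial>m)" if "A \<in> sets borel" for A
    unfolding em[OF that]
    using fin by (intro nn_integral_cong_AE) (auto simp: r_def indicator_def less_top ennreal_enn2real)
  have "(\<integral>\<^sup>+t. ennreal (r t) \<partial>m) < \<infinity>"
    using em'[of UNIV] N.emeasure_finite[of UNIV] by (simp add: less_top)
  then have "integrable m r" using r0 by (intro integrableI_nonneg) auto
  moreover have "measure ?N A = (LINT t:A|m. r t)" if A: "A \<in> sets borel" for A
    unfolding measure_def em'[OF A] set_lebesgue_integral_def
    using r0 A by (subst integral_eq_nn_integral) auto
  ultimately show thesis by (rule that)
qed

text \<open>The Radon-Nikodym theorem for signed measures, from the Jordan decomposition: the positive parts of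
  \<open>\<rho>\<close> and \<open>- \<rho>\<close> are finite measures whose difference is \<open>\<rho>\<close>.\<close>

lemma real_RN:
  assumes \<rho>: "vector_measure \<rho>" and ac: "\<And>A. A \<in> sets borel \<Longrightarrow> emeasure m A = 0 \<Longrightarrow> \<rho> A = 0"
  obtains r :: "'g \<Rightarrow> real" where "has_density m \<rho> r"
proof -
  have \<rho>': "vector_measure (\<lambda>A. - \<rho> A)"
    using vector_measure_compose[OF bounded_linear_minus[OF bounded_linear_ident] \<rho>] by simp
  obtain r where r: "integrable m r" "\<And>A. A \<in> sets borel \<Longrightarrow> measure (positive_part \<rho>) A = (LINT t:A|m. r t)"
    using positive_part_RN[OF \<rho> ac] by blast
  obtain r' where r': "integrable m r'"
    "\<And>A. A \<in> sets borel \<Longrightarrow> measure (positive_part (\<lambda>A. - \<rho> A)) A = (LINT t:A|m. r' t)"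
    using positive_part_RN[OF \<rho>'] ac by auto
  have Jordan: "measure (positive_part \<rho>) A \<le> \<rho> A + measure (positive_part (\<lambda>A. - \<rho> A)) A"
    if \<rho>: "vector_measure \<rho>" and A: "A \<in> sets borel" for \<rho> :: "'g set \<Rightarrow> real" and A
  proof -
    have \<rho>': "vector_measure (\<lambda>A. - \<rho> A)"
      using vector_measure_compose[OF bounded_linear_minus[OF bounded_linear_ident] \<rho>] by simp
    obtain C where C: "0 \<le> C" "\<And>A. A \<in> sets borel \<Longrightarrow> norm (\<rho> A) \<le> C"
      using vector_measure_bounded[OF \<rho>] by blast
    have "emeasure (positive_part (\<lambda>A. - \<rho> A)) A \<le> ennreal C"
      using C(2) by (subst emeasure_positive_part[OF \<rho>' A]) (fastforce intro!: SUP_least ennreal_leI)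
    then have fin: "emeasure (positive_part (\<lambda>A. - \<rho> A)) A < \<infinity>" using le_less_trans by fastforce
    have upper: "- \<rho> B \<le> measure (positive_part (\<lambda>A. - \<rho> A)) A" if "B \<in> sets borel" "B \<subseteq> A" for B
    proof -
      have "ennreal (- \<rho> B) \<le> emeasure (positive_part (\<lambda>A. - \<rho> A)) A"
        unfolding emeasure_positive_part[OF \<rho>' A] using that by (intro SUP_upper) auto
      then show ?thesis
        unfolding measure_def using fin
        by (metis enn2real_ennreal enn2real_mono enn2real_nonneg ennreal_neg infinity_ennreal_def linorder_linear order_trans)
    qed
    have nonneg: "0 \<le> \<rho> A + measure (positive_part (\<lambda>A. - \<rho> A)) A"
      using upper[OF A] by simp
    have "emeasure (positive_part \<rho>) A \<le> ennreal (\<rho> A + measure (positive_part (\<lambda>A. - \<rho> A)) A)"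
      unfolding emeasure_positive_part[OF \<rho> A]
    proof (intro SUP_least ennreal_leI)
      fix B assume B: "B \<in> {B \<in> sets borel. B \<subseteq> A}"
      then show "\<rho> B \<le> \<rho> A + measure (positive_part (\<lambda>A. - \<rho> A)) A"
        using upper[of "A - B"] vector_measure_Diff[OF \<rho> A, of B] A by auto
    qed
    then have "enn2real (emeasure (positive_part \<rho>) A) \<le> enn2real (ennreal (\<rho> A + measure (positive_part (\<lambda>A. - \<rho> A)) A))"
      by (intro enn2real_mono) auto
    then show ?thesis using nonneg by (simp add: measure_def)
  qed
  have "\<rho> A = (LINT t:A|m. r t - r' t)" if A: "A \<in> sets borel" for A
  proof -
    have "(LINT t:A|m. r t - r' t) = measure (positive_part \<rho>) A - measure (positive_part (\<lambda>A. - \<rho> A)) A"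
      unfolding r(2)[OF A] r'(2)[OF A] set_lebesgue_integral_def
      using integrable_on_borel[OF r(1) A] integrable_on_borel[OF r'(1) A]
      by (subst Bochner_Integration.integral_diff[symmetric]) (auto simp: algebra_simps)
    also have "\<dots> = \<rho> A"
      using Jordan[OF \<rho> A] Jordan[OF \<rho>' A] by simp
    finally show ?thesis by simp
  qed
  then show thesis
    using r(1) r'(1) by (intro that[of "\<lambda>t. r t - r' t"]) (auto simp: has_density_def)
qed

lemma complex_RN:
  assumes \<mu>: "vector_measure \<mu>" and ac: "\<And>A. A \<in> sets borel \<Longrightarrow> emeasure m A = 0 \<Longrightarrow> \<mu> A = 0"
  obtains h :: "'g \<Rightarrow> complex" where "has_density m \<mu> h"
proof -
  obtain r where r: "has_density m (\<lambda>A. Re (\<mu> A)) r"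
    using real_RN[OF vector_measure_compose[OF bounded_linear_Re \<mu>]] ac by auto
  obtain s where s: "has_density m (\<lambda>A. Im (\<mu> A)) s"
    using real_RN[OF vector_measure_compose[OF bounded_linear_Im \<mu>]] ac by auto
  define h where "h t = complex_of_real (r t) + \<i> * complex_of_real (s t)" for t
  have ir: "integrable m r" and ism: "integrable m s" using r s by (auto simp: has_density_def)
  have h: "integrable m h" unfolding h_def using ir ism by auto
  have "\<mu> A = (LINT t:A|m. h t)" if A: "A \<in> sets borel" for A
  proof (rule complex_eqI)
    have ih: "integrable m (\<lambda>t. indicator A t *\<^sub>R h t)" by (rule integrable_on_borel[OF h A])
    show "Re (\<mu> A) = Re (LINT t:A|m. h t)"
      using has_density_eq[OF r A] integral_Re[OF ih] unfolding set_lebesgue_integral_def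
      by (simp add: h_def)
    show "Im (\<mu> A) = Im (LINT t:A|m. h t)"
      using has_density_eq[OF s A] integral_Im[OF ih] unfolding set_lebesgue_integral_def
      by (simp add: h_def)
  qed
  then show thesis using h by (intro that[of h]) (auto simp: has_density_def)
qed

lemma measure_of_eq_density:
  assumes "\<And>A. A \<in> sets borel \<Longrightarrow> p A = (\<integral>\<^sup>+t. k t * indicator A t \<partial>m)"
    and [measurable]: "k \<in> borel_measurable borel"
  shows "measure_of UNIV (sets borel) p = density m k"
proof -
  have "measure_of UNIV (sets borel) p = measure_of UNIV (sets borel) (emeasure (density m k))"
    using sets.space_closed[of "borel :: 'g measure"] sets.sigma_sets_eq[of "borel :: 'g measure"] assms
    by (intro measure_of_eq) (auto simp: emeasure_density)
  also have "\<dots> = density m k" using measure_of_of_measure[of "density m k"] by simp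
  finally show ?thesis .
qed

lemma positive_part_density:
  assumes r: "has_density m \<rho> (r :: 'g \<Rightarrow> real)"
  shows "positive_part \<rho> = density m (\<lambda>t. ennreal (r t))"
  unfolding positive_part_def
proof (rule measure_of_eq_density)
  note ir = has_density_integrable[OF r]
  then show [measurable]: "(\<lambda>t. ennreal (r t)) \<in> borel_measurable borel" by auto
  have [measurable]: "r \<in> borel_measurable borel" using borel_measurable_integrable[OF ir] by simp
  fix A :: "'g set" assume A[measurable]: "A \<in> sets borel"
  show "(SUP B\<in>{B \<in> sets borel. B \<subseteq> A}. ennreal (\<rho> B)) = (\<integral>\<^sup>+t. ennreal (r t) * indicator A t \<partial>m)"
  proof (rule antisym)
    show "(SUP B\<in>{B \<in> sets borel. B \<subseteq> A}. ennreal (\<rho> B)) \<le> (\<integral>\<^sup>+t. ennreal (r t) * indicator A t \<partial>m)"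
    proof (rule SUP_least)
      fix B assume "B \<in> {B \<in> sets borel. B \<subseteq> A}"
      then have B: "B \<in> sets borel" "B \<subseteq> A" by auto
      have "ennreal (\<rho> B) \<le> (\<integral>\<^sup>+t. ennreal (indicator B t *\<^sub>R r t) \<partial>m)"
        unfolding has_density_eq[OF r B(1)] set_lebesgue_integral_def
        by (intro ennreal_integral_le integrable_on_borel ir B)
      also have "\<dots> \<le> (\<integral>\<^sup>+t. ennreal (r t) * indicator A t \<partial>m)"
        using B by (intro nn_integral_mono) (auto simp: indicator_def)
      finally show "ennreal (\<rho> B) \<le> (\<integral>\<^sup>+t. ennreal (r t) * indicator A t \<partial>m)" .
    qed
    define B where "B = A \<inter> {t. 0 < r t}"
    have B[measurable]: "B \<in> sets borel" unfolding B_def by measurable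
    have "(\<integral>\<^sup>+t. ennreal (r t) * indicator A t \<partial>m) = (\<integral>\<^sup>+t. ennreal (indicator B t *\<^sub>R r t) \<partial>m)"
      by (intro nn_integral_cong) (auto simp: B_def indicator_def ennreal_neg)
    also have "\<dots> = ennreal (\<rho> B)"
      unfolding has_density_eq[OF r B] set_lebesgue_integral_def
      by (intro nn_integral_eq_integral integrable_on_borel ir B) (auto simp: B_def indicator_def)
    also have "\<dots> \<le> (SUP B\<in>{B \<in> sets borel. B \<subseteq> A}. ennreal (\<rho> B))"
      by (intro SUP_upper) (auto simp: B_def[symmetric] B, simp add: B_def)
    finally show "(\<integral>\<^sup>+t. ennreal (r t) * indicator A t \<partial>m) \<le> (SUP B\<in>{B \<in> sets borel. B \<subseteq> A}. ennreal (\<rho> B))" .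
  qed
qed

lemma signed_integral_density:
  assumes r: "has_density m \<rho> (r :: 'g \<Rightarrow> real)"
    and [measurable]: "f \<in> borel_measurable borel" and fr: "integrable m (\<lambda>t. f t * complex_of_real (r t))"
    and A[measurable]: "A \<in> sets borel"
  shows "signed_integral \<rho> A f = (LINT t:A|m. f t * complex_of_real (r t))"
proof -
  have [measurable]: "r \<in> borel_measurable borel"
    using borel_measurable_integrable[OF has_density_integrable[OF r]] by simp
  have r': "has_density m (\<lambda>B. - \<rho> B) (\<lambda>t. - r t)"
    using r by (auto simp: has_density_def set_lebesgue_integral_def)
  have part: "(LINT t:A|density m (\<lambda>t. ennreal (k t)). f t) = (\<integral>t. max 0 (k t) *\<^sub>R indicator A t *\<^sub>R f t \<partial>m)"
    if [measurable]: "k \<in> borel_measurable borel" for k :: "'g \<Rightarrow> real"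
  proof -
    have "density m (\<lambda>t. ennreal (k t)) = density m (\<lambda>t. ennreal (max 0 (k t)))"
      by (intro density_cong) (auto simp: max_def ennreal_neg)
    then show ?thesis
      unfolding set_lebesgue_integral_def by (simp add: integral_density)
  qed
  have int: "integrable m (\<lambda>t. max 0 (k t) *\<^sub>R indicator A t *\<^sub>R f t)"
    if [measurable]: "k \<in> borel_measurable borel" and "\<And>t. \<bar>k t\<bar> \<le> \<bar>r t\<bar>" for k :: "'g \<Rightarrow> real"
    using fr
  proof (rule Bochner_Integration.integrable_bound)
    show "AE t in m. norm (max 0 (k t) *\<^sub>R indicator A t *\<^sub>R f t) \<le> norm (f t * complex_of_real (r t))"
    proof (rule AE_I2)
      fix t
      have "max 0 (k t) * (indicator A t * cmod (f t)) \<le> \<bar>r t\<bar> * cmod (f t)"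
        using that(2)[of t] by (intro mult_mono) (auto simp: indicator_def)
      then show "norm (max 0 (k t) *\<^sub>R indicator A t *\<^sub>R f t) \<le> norm (f t * complex_of_real (r t))"
        by (simp add: norm_mult mult_ac)
    qed
  qed auto
  have "signed_integral \<rho> A f = (\<integral>t. max 0 (r t) *\<^sub>R indicator A t *\<^sub>R f t \<partial>m) - (\<integral>t. max 0 (- r t) *\<^sub>R indicator A t *\<^sub>R f t \<partial>m)"
    unfolding signed_integral_def positive_part_density[OF r] positive_part_density[OF r'] by (simp add: part)
  also have "\<dots> = (\<integral>t. max 0 (r t) *\<^sub>R indicator A t *\<^sub>R f t - max 0 (- r t) *\<^sub>R indicator A t *\<^sub>R f t \<partial>m)"
    by (intro Bochner_Integration.integral_diff[symmetric] int) auto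
  also have "\<dots> = (LINT t:A|m. f t * complex_of_real (r t))"
    unfolding set_lebesgue_integral_def
    by (intro Bochner_Integration.integral_cong) (auto simp: max_def scaleR_conv_of_real indicator_def)
  finally show ?thesis .
qed

lemma complex_measure_integral_density:
  assumes q: "has_density m \<mu> q"
    and [measurable]: "f \<in> borel_measurable borel" and fq: "integrable m (\<lambda>t. f t * q t)"
    and A[measurable]: "A \<in> sets borel"
  shows "complex_measure_integral \<mu> A f = (LINT t:A|m. f t * q t)"
proof -
  note iq = has_density_integrable[OF q]
  have [measurable]: "q \<in> borel_measurable borel" using borel_measurable_integrable[OF iq] by simp
  have Re: "has_density m (\<lambda>B. Re (\<mu> B)) (\<lambda>t. Re (q t))"
    and Im: "has_density m (\<lambda>B. Im (\<mu> B)) (\<lambda>t. Im (q t))"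
    using q integral_Re[OF integrable_on_borel[OF iq]] integral_Im[OF integrable_on_borel[OF iq]]
    by (auto simp: has_density_def set_lebesgue_integral_def)
  have fRe: "integrable m (\<lambda>t. f t * complex_of_real (Re (q t)))"
    by (rule Bochner_Integration.integrable_bound[OF fq])
       (auto simp: norm_mult intro!: mult_left_mono abs_Re_le_cmod)
  have fIm: "integrable m (\<lambda>t. f t * complex_of_real (Im (q t)))"
    by (rule Bochner_Integration.integrable_bound[OF fq])
       (auto simp: norm_mult intro!: mult_left_mono abs_Im_le_cmod)
  have split: "(\<integral>t. F t + \<i> * G t \<partial>m) = integral\<^sup>L m F + \<i> * integral\<^sup>L m G"
    if "integrable m F" "integrable m G" for F G :: "'g \<Rightarrow> complex"
    using that by simp
  have "complex_measure_integral \<mu> A f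
      = (LINT t:A|m. f t * complex_of_real (Re (q t))) + \<i> * (LINT t:A|m. f t * complex_of_real (Im (q t)))"
    unfolding complex_measure_integral_def
    by (simp add: signed_integral_density[OF Re _ fRe] signed_integral_density[OF Im _ fIm])
  also have "\<dots> = (\<integral>t. indicator A t *\<^sub>R (f t * complex_of_real (Re (q t)))
      + \<i> * (indicator A t *\<^sub>R (f t * complex_of_real (Im (q t)))) \<partial>m)"
    unfolding set_lebesgue_integral_def
    by (rule split[OF integrable_on_borel[OF fRe A] integrable_on_borel[OF fIm A], symmetric])
  also have "\<dots> = (LINT t:A|m. f t * q t)"
    unfolding set_lebesgue_integral_def
    by (intro Bochner_Integration.integral_cong) (auto simp: complex_eq_iff indicator_def)
  finally show ?thesis .
qed

text \<open>The upper bound is the triangle inequality. For the lower bound, \<open>\<bar>q\<bar> = cnj (sgn q) q\<close>, and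
  \<open>cnj (sgn q)\<close> is uniformly close to a simple function \<open>\<phi>\<close>; the level sets of \<open>\<phi>\<close> then form a
  partition whose sum is nearly \<open>\<integral> \<bar>q\<bar>\<close>.\<close>

lemma variation_density:
  assumes q: "has_density m \<mu> q" and A[measurable]: "A \<in> sets borel"
  shows "variation \<mu> A = (\<integral>\<^sup>+t. ennreal (cmod (q t)) * indicator A t \<partial>m)" (is "_ = ?I A")
proof (rule antisym)
  note iq = has_density_integrable[OF q]
  have [measurable]: "q \<in> borel_measurable borel" using borel_measurable_integrable[OF iq] by simp
  have le: "ennreal (cmod (\<mu> E)) \<le> ?I E" if E[measurable]: "E \<in> sets borel" for E
  proof -
    have "ennreal (cmod (\<mu> E)) \<le> (\<integral>\<^sup>+t. ennreal (cmod (indicator E t *\<^sub>R q t)) \<partial>m)"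
      unfolding has_density_eq[OF q E] set_lebesgue_integral_def
      by (rule integral_norm_bound_ennreal[OF integrable_on_borel[OF iq E]])
    also have "\<dots> = ?I E" by (intro nn_integral_cong) (auto simp: indicator_def)
    finally show ?thesis .
  qed
  have add: "(\<Sum>E\<in>P. ?I E) = ?I (\<Union>P)" if P: "finite P" "P \<subseteq> sets borel" "disjoint P" for P
  proof -
    have "(\<Sum>E\<in>P. ?I E) = (\<Sum>E\<in>P. emeasure (density m (\<lambda>t. ennreal (cmod (q t)))) E)"
      using P by (intro sum.cong refl) (auto simp: emeasure_density)
    also have "\<dots> = emeasure (density m (\<lambda>t. ennreal (cmod (q t)))) (\<Union>P)"
      using P sum_emeasure[of "\<lambda>E. E" P "density m (\<lambda>t. ennreal (cmod (q t)))"]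
      by (auto simp: disjoint_def disjoint_family_on_def)
    also have "\<dots> = ?I (\<Union>P)" using P by (intro emeasure_density) auto
    finally show ?thesis .
  qed
  show "variation \<mu> A \<le> ?I A"
    unfolding variation_def
  proof (rule SUP_least)
    fix P assume P: "P \<in> {P. finite P \<and> P \<subseteq> sets borel \<and> disjoint P \<and> \<Union> P = A}"
    then have "(\<Sum>E\<in>P. ennreal (cmod (\<mu> E))) \<le> (\<Sum>E\<in>P. ?I E)" by (intro sum_mono le) auto
    also have "\<dots> = ?I A" using P add[of P] by auto
    finally show "(\<Sum>E\<in>P. ennreal (cmod (\<mu> E))) \<le> ?I A" .
  qed
  define J where "J = (\<integral>t. indicator A t *\<^sub>R cmod (q t) \<partial>m)"
  have J0: "0 \<le> J" unfolding J_def by (intro integral_nonneg_AE) auto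
  have inorm: "integrable m (\<lambda>t. indicator A t *\<^sub>R cmod (q t))"
    by (intro integrable_on_borel integrable_norm iq A)
  have IJ: "?I A = ennreal J"
    unfolding J_def using inorm
    by (subst nn_integral_eq_integral[symmetric]) (auto intro!: nn_integral_cong simp: indicator_def)
  \<comment> \<open>The loss \<open>\<epsilon> J\<close> comes from replacing the sign by \<open>\<phi>\<close>, the factor \<open>1 + \<epsilon>\<close> bounds the values of \<open>\<phi>\<close>.\<close>
  have approx: "ennreal (J - \<epsilon> * J) \<le> ennreal (1 + \<epsilon>) * variation \<mu> A" if \<epsilon>: "0 < \<epsilon>" for \<epsilon>
  proof -
    have [measurable]: "cnj \<in> borel_measurable borel"
      by (intro borel_measurable_continuous_onI continuous_intros)
    have "(\<lambda>t. cnj (sgn (q t))) \<in> borel_measurable m" unfolding sgn_eq by measurable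
    moreover have "cmod (cnj (sgn (q t))) \<le> 1" for t by (simp add: norm_sgn)
    ultimately obtain \<phi> where \<phi>: "simple_function m \<phi>" "\<And>t. cmod (cnj (sgn (q t)) - \<phi> t) \<le> \<epsilon>"
      using uniform_simple_approx[of "\<lambda>t. cnj (sgn (q t))" m 1 \<epsilon>] \<epsilon> by blast
    have [measurable]: "\<phi> \<in> borel_measurable borel"
      using borel_measurable_simple_function[OF \<phi>(1)] by simp
    have fin: "finite (range \<phi>)" using simple_functionD(1)[OF \<phi>(1)] by simp
    have \<phi>_bound: "cmod (\<phi> t) \<le> 1 + \<epsilon>" for t
    proof -
      have "cmod (\<phi> t) \<le> cmod (cnj (sgn (q t))) + cmod (cnj (sgn (q t)) - \<phi> t)"
        by (metis norm_minus_commute norm_triangle_sub)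
      also have "\<dots> \<le> 1 + \<epsilon>" using \<phi>(2)[of t] by (auto simp: norm_sgn)
      finally show ?thesis .
    qed
    define L where "L c = A \<inter> \<phi> -` {c}" for c
    have L[measurable]: "L c \<in> sets borel" for c
      unfolding L_def using measurable_sets[of \<phi> borel borel "{c}"] by (auto intro!: sets.Int)
    have "ennreal (J - \<epsilon> * J) \<le> ennreal (cmod (\<integral>t. indicator A t *\<^sub>R (\<phi> t * q t) \<partial>m))"
    proof (rule ennreal_leI)
      have iphi: "integrable m (\<lambda>t. indicator A t *\<^sub>R (\<phi> t * q t))"
        by (rule Bochner_Integration.integrable_bound[of m "\<lambda>t. (1 + \<epsilon>) *\<^sub>R q t"])
           (use iq \<phi>_bound \<epsilon> in \<open>auto simp: norm_mult indicator_def intro!: mult_right_mono order_trans[OF \<phi>_bound]\<close>)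
      have inc: "integrable m (\<lambda>t. complex_of_real (indicator A t *\<^sub>R cmod (q t)))"
        by (rule integrable_of_real[OF inorm])
      have "complex_of_real J - (\<integral>t. indicator A t *\<^sub>R (\<phi> t * q t) \<partial>m)
          = (\<integral>t. complex_of_real (indicator A t *\<^sub>R cmod (q t)) - indicator A t *\<^sub>R (\<phi> t * q t) \<partial>m)"
        unfolding J_def integral_complex_of_real[symmetric]
        by (rule Bochner_Integration.integral_diff[symmetric, OF inc iphi])
      also have "cmod \<dots> \<le> (\<integral>t. \<epsilon> * (indicator A t *\<^sub>R cmod (q t)) \<partial>m)"
      proof (rule norm_integral_le_integral)
        show "integrable m (\<lambda>t. complex_of_real (indicator A t *\<^sub>R cmod (q t)) - indicator A t *\<^sub>R (\<phi> t * q t))"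
          by (rule Bochner_Integration.integrable_diff[OF inc iphi])
        show "integrable m (\<lambda>t. \<epsilon> * (indicator A t *\<^sub>R cmod (q t)))" using inorm by (rule integrable_mult_right)
        fix t
        have "complex_of_real (cmod (q t)) = cnj (sgn (q t)) * q t"
          by (cases "q t = 0") (simp_all add: sgn_eq mult.commute[of "cnj (q t)"] power2_eq_square flip: complex_norm_square)
        then have "complex_of_real (cmod (q t)) - \<phi> t * q t = (cnj (sgn (q t)) - \<phi> t) * q t"
          by (simp add: algebra_simps)
        then have "cmod (complex_of_real (cmod (q t)) - \<phi> t * q t) \<le> \<epsilon> * cmod (q t)"
          using \<phi>(2)[of t] by (simp add: norm_mult mult_right_mono)
        then show "cmod (complex_of_real (indicator A t *\<^sub>R cmod (q t)) - indicator A t *\<^sub>R (\<phi> t * q t)) \<le> \<epsilon> * (indicator A t *\<^sub>R cmod (q t))"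
          by (auto simp: indicator_def)
      qed
      also have "\<dots> = \<epsilon> * J" by (simp add: J_def)
      finally have "cmod (complex_of_real J - (\<integral>t. indicator A t *\<^sub>R (\<phi> t * q t) \<partial>m)) \<le> \<epsilon> * J" .
      then show "J - \<epsilon> * J \<le> cmod (\<integral>t. indicator A t *\<^sub>R (\<phi> t * q t) \<partial>m)"
        using norm_triangle_ineq2[of "complex_of_real J" "\<integral>t. indicator A t *\<^sub>R (\<phi> t * q t) \<partial>m"] J0 by simp
    qed
    also have "(\<integral>t. indicator A t *\<^sub>R (\<phi> t * q t) \<partial>m) = (\<integral>t. (\<Sum>c\<in>range \<phi>. c * (indicator (L c) t *\<^sub>R q t)) \<partial>m)"
    proof (intro Bochner_Integration.integral_cong refl)
      fix t
      have "(\<Sum>c\<in>range \<phi>. c * (indicator (L c) t *\<^sub>R q t)) = (\<Sum>c\<in>{\<phi> t}. c * (indicator (L c) t *\<^sub>R q t))"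
        using fin by (intro sum.mono_neutral_right) (auto simp: L_def)
      then show "indicator A t *\<^sub>R (\<phi> t * q t) = (\<Sum>c\<in>range \<phi>. c * (indicator (L c) t *\<^sub>R q t))"
        by (auto simp: L_def indicator_def)
    qed
    also have "\<dots> = (\<Sum>c\<in>range \<phi>. c * \<mu> (L c))"
      unfolding has_density_eq[OF q L] set_lebesgue_integral_def
      by (subst Bochner_Integration.integral_sum)
         (intro integrable_mult_right integrable_on_borel iq L, simp only: integral_mult_right_zero)
    also have "ennreal (cmod (\<Sum>c\<in>range \<phi>. c * \<mu> (L c))) \<le> (\<Sum>c\<in>range \<phi>. ennreal (cmod (c * \<mu> (L c))))"
      by (subst sum_ennreal) (auto intro!: ennreal_leI norm_sum)
    also have "\<dots> \<le> (\<Sum>c\<in>range \<phi>. ennreal (1 + \<epsilon>) * ennreal (cmod (\<mu> (L c))))"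
    proof (rule sum_mono)
      fix c assume "c \<in> range \<phi>"
      then have "cmod c \<le> 1 + \<epsilon>" using \<phi>_bound by auto
      then show "ennreal (cmod (c * \<mu> (L c))) \<le> ennreal (1 + \<epsilon>) * ennreal (cmod (\<mu> (L c)))"
        using \<epsilon> by (subst ennreal_mult[symmetric]) (auto simp: norm_mult mult_right_mono intro!: ennreal_leI)
    qed
    also have "\<dots> = ennreal (1 + \<epsilon>) * (\<Sum>c\<in>range \<phi>. ennreal (cmod (\<mu> (L c))))"
      by (simp only: sum_distrib_left)
    also have "(\<Sum>c\<in>range \<phi>. ennreal (cmod (\<mu> (L c)))) = (\<Sum>E\<in>L ` range \<phi>. ennreal (cmod (\<mu> E)))"
    proof (rule sum.reindex_nontrivial[symmetric, unfolded comp_def])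
      show "finite (range \<phi>)" by fact
      fix c d assume "c \<in> range \<phi>" "d \<in> range \<phi>" "c \<noteq> d" "L c = L d"
      then have "L c = {}" by (auto simp: L_def)
      then show "ennreal (cmod (\<mu> (L c))) = 0" using has_density_eq[OF q L, of c] by (simp add: set_lebesgue_integral_def)
    qed
    also have "\<dots> \<le> variation \<mu> A"
      unfolding variation_def
      by (rule SUP_upper) (use fin L in \<open>auto simp: disjoint_def L_def\<close>)
    finally show ?thesis by (simp add: mult_left_mono)
  qed
  have lim1: "((\<lambda>\<epsilon>. ennreal (J - \<epsilon> * J)) \<longlongrightarrow> ennreal (J - 0 * J)) (at_right 0)"
    by (intro tendsto_ennrealI tendsto_intros)
  show "?I A \<le> variation \<mu> A"
  proof (cases "variation \<mu> A = \<infinity>")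
    case False
    then obtain V where V: "variation \<mu> A = ennreal V" "0 \<le> V" by (cases "variation \<mu> A") auto
    have "J - \<epsilon> * J \<le> (1 + \<epsilon>) * V" if "0 < \<epsilon>" for \<epsilon>
    proof -
      have nonneg: "0 \<le> (1 + \<epsilon>) * V" using that V by simp
      have "ennreal (J - \<epsilon> * J) \<le> ennreal ((1 + \<epsilon>) * V)"
        using approx[OF that] that V by (subst ennreal_mult) auto
      then show ?thesis by (simp only: ennreal_le_iff[OF nonneg])
    qed
    then have "eventually (\<lambda>\<epsilon>. J - \<epsilon> * J \<le> (1 + \<epsilon>) * V) (at_right 0)"
      by (intro eventually_at_right_less[THEN eventually_mono]) auto
    moreover have "((\<lambda>\<epsilon>. J - \<epsilon> * J) \<longlongrightarrow> J - 0 * J) (at_right 0)" by (intro tendsto_intros)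
    moreover have "((\<lambda>\<epsilon>. (1 + \<epsilon>) * V) \<longlongrightarrow> (1 + 0) * V) (at_right 0)" by (intro tendsto_intros)
    ultimately have "J - 0 * J \<le> (1 + 0) * V"
      by (intro tendsto_le[of "at_right (0::real)"]) auto
    then show ?thesis using V IJ by (simp add: ennreal_leI)
  qed simp
qed

lemma variation_measure_density:
  assumes "has_density m \<mu> q"
  shows "variation_measure \<mu> = density m (\<lambda>t. ennreal (cmod (q t)))"
  unfolding variation_measure_def
  using variation_density[OF assms] borel_measurable_integrable[OF has_density_integrable[OF assms]]
  by (intro measure_of_eq_density) auto

lemma integrable_times_density:
  assumes q: "has_density m \<mu> q" and f: "integrable (variation_measure \<mu>) f"
  shows "f \<in> borel_measurable borel" "integrable m (\<lambda>t. f t * q t)"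
proof -
  have [measurable]: "q \<in> borel_measurable borel"
    using borel_measurable_integrable[OF has_density_integrable[OF q]] by simp
  show [measurable]: "f \<in> borel_measurable borel"
    using borel_measurable_integrable[OF f] unfolding variation_measure_density[OF q] by simp
  have "integrable m (\<lambda>t. cmod (q t) *\<^sub>R f t)"
    using f unfolding variation_measure_density[OF q] by (subst (asm) integrable_density) auto
  then show "integrable m (\<lambda>t. f t * q t)"
    by (rule Bochner_Integration.integrable_bound) (auto simp: norm_mult)
qed

lemma set_integral_Re_Im:
  "integrable m q \<Longrightarrow> A \<in> sets borel \<Longrightarrow> Re (LINT t:A|m. q t) = (LINT t:A|m. Re (q t))"
  "integrable m q \<Longrightarrow> A \<in> sets borel \<Longrightarrow> Im (LINT t:A|m. q t) = (LINT t:A|m. Im (q t))"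
  using integral_Re[OF integrable_on_borel[of q A]] integral_Im[OF integrable_on_borel[of q A]]
  by (simp_all add: set_lebesgue_integral_def)

lemma integral_abs_le:
  assumes r: "integrable m (r :: 'g \<Rightarrow> real)" and C: "\<And>A. A \<in> sets borel \<Longrightarrow> \<bar>LINT t:A|m. r t\<bar> \<le> C"
  shows "(\<integral>t. \<bar>r t\<bar> \<partial>m) \<le> 2 * C"
proof -
  have [measurable]: "r \<in> borel_measurable borel" using borel_measurable_integrable[OF r] by simp
  define P where "P = {t. 0 < r t}"
  have P: "P \<in> sets borel" "- P \<in> sets borel" unfolding P_def by measurable
  have "(\<integral>t. \<bar>r t\<bar> \<partial>m) = (\<integral>t. indicator P t *\<^sub>R r t - indicator (- P) t *\<^sub>R r t \<partial>m)"
    by (intro Bochner_Integration.integral_cong) (auto simp: P_def indicator_def)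
  also have "\<dots> = (LINT t:P|m. r t) - (LINT t:- P|m. r t)"
    unfolding set_lebesgue_integral_def
    by (intro Bochner_Integration.integral_diff integrable_on_borel r P)
  also have "\<dots> \<le> 2 * C" using C[OF P(1)] C[OF P(2)] by linarith
  finally show ?thesis .
qed

text \<open>The set functions \<open>A \<mapsto> \<integral>\<^sub>A Re q\<close> and \<open>A \<mapsto> \<integral>\<^sub>A Im q\<close> attain the positive and the negative part of
  their variation on the sets where the integrand has constant sign, hence the factor 4.\<close>

lemma integral_norm_le:
  assumes q: "integrable m (q :: 'g \<Rightarrow> complex)"
    and C: "\<And>A. A \<in> sets borel \<Longrightarrow> cmod (LINT t:A|m. q t) \<le> C"
  shows "(\<integral>t. cmod (q t) \<partial>m) \<le> 4 * C"
proof -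
  have "(\<integral>t. cmod (q t) \<partial>m) \<le> (\<integral>t. \<bar>Re (q t)\<bar> + \<bar>Im (q t)\<bar> \<partial>m)"
    using q by (intro integral_mono) (auto intro: cmod_le)
  also have "\<dots> = (\<integral>t. \<bar>Re (q t)\<bar> \<partial>m) + (\<integral>t. \<bar>Im (q t)\<bar> \<partial>m)"
    using q by (intro Bochner_Integration.integral_add) auto
  also have "\<dots> \<le> 2 * C + 2 * C"
  proof (intro add_mono integral_abs_le)
    fix A :: "'g set" assume A: "A \<in> sets borel"
    show "\<bar>LINT t:A|m. Re (q t)\<bar> \<le> C"
      using abs_Re_le_cmod[of "LINT t:A|m. q t"] C[OF A] unfolding set_integral_Re_Im(1)[OF q A] by linarith
    show "\<bar>LINT t:A|m. Im (q t)\<bar> \<le> C"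
      using abs_Im_le_cmod[of "LINT t:A|m. q t"] C[OF A] unfolding set_integral_Re_Im(2)[OF q A] by linarith
  qed (use q in auto)
  finally show ?thesis by simp
qed

lemma integrable_times_bounded:
  fixes q w :: "'g \<Rightarrow> complex"
  assumes q: "integrable m q" and w: "w \<in> borel_measurable borel" "\<And>t. cmod (w t) \<le> b"
  shows "integrable m (\<lambda>t. w t * q t)"
proof -
  have [measurable]: "q \<in> borel_measurable borel" using borel_measurable_integrable[OF q] by simp
  note w(1)[measurable]
  show ?thesis
  proof (rule Bochner_Integration.integrable_bound[of m "\<lambda>t. b *\<^sub>R q t"])
    show "AE t in m. norm (w t * q t) \<le> norm (b *\<^sub>R q t)"
      using w(2) by (intro AE_I2) (auto simp: norm_mult intro!: mult_right_mono order_trans[OF w(2)])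
  qed (use q in auto)
qed

lemma set_integral_uniform:
  assumes q: "integrable m (q :: 'g \<Rightarrow> complex)"
    and u: "integrable m (\<lambda>t. u t * q t)" and v: "integrable m (\<lambda>t. v t * q t)"
    and uv: "\<And>t. cmod (u t - v t) \<le> \<epsilon>" and A: "A \<in> sets borel"
  shows "cmod ((LINT t:A|m. u t * q t) - (LINT t:A|m. v t * q t)) \<le> \<epsilon> * (\<integral>t. cmod (q t) \<partial>m)"
proof -
  note iu = integrable_on_borel[OF u A] and iv = integrable_on_borel[OF v A]
  have "(LINT t:A|m. u t * q t) - (LINT t:A|m. v t * q t)
      = (\<integral>t. indicator A t *\<^sub>R (u t * q t) - indicator A t *\<^sub>R (v t * q t) \<partial>m)"
    unfolding set_lebesgue_integral_def by (rule Bochner_Integration.integral_diff[symmetric, OF iu iv])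
  also have "cmod \<dots> \<le> (\<integral>t. \<epsilon> * cmod (q t) \<partial>m)"
  proof (rule norm_integral_le_integral[OF Bochner_Integration.integrable_diff[OF iu iv]])
    show "integrable m (\<lambda>t. \<epsilon> * cmod (q t))" using q by simp
    fix t
    have "cmod ((u t - v t) * q t) \<le> \<epsilon> * cmod (q t)" using uv[of t] by (simp add: norm_mult mult_right_mono)
    moreover have "0 \<le> \<epsilon> * cmod (q t)" using norm_ge_zero[of "(u t - v t) * q t"] calculation by linarith
    ultimately show "cmod (indicator A t *\<^sub>R (u t * q t) - indicator A t *\<^sub>R (v t * q t)) \<le> \<epsilon> * cmod (q t)"
      by (simp add: indicator_def algebra_simps)
  qed
  finally show ?thesis by simp
qed

end

section \<open>Integration with respect to an absolutely continuous vector measure\<close>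

lemma M_ac_vector_measure: "\<nu> \<in> M_ac m \<Longrightarrow> vector_measure \<nu>"
  by (simp add: M_ac_def)

lemma M_ac_null:
  assumes "\<nu> \<in> M_ac m" "A \<in> sets borel" "emeasure m A = 0"
  shows "\<nu> A = 0"
proof (rule ccontr)
  assume "\<nu> A \<noteq> 0"
  then obtain \<delta> where "\<delta> > 0" "\<forall>B\<in>sets borel. measure m B < \<delta> \<longrightarrow> norm (\<nu> B) < norm (\<nu> A)"
    using assms(1) unfolding M_ac_def by (auto dest!: spec[of _ "norm (\<nu> A)"])
  then show False using assms(2,3) by (auto simp: measure_def)
qed

lemma vector_integral_eqI:
  assumes "is_vector_integral \<nu> A f x"
  shows "vector_integral \<nu> A f = x"
  unfolding vector_integral_def
proof (rule the_equality[where P = "is_vector_integral \<nu> A f", OF assms])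
  fix y assume "is_vector_integral \<nu> A f y"
  then show "y = x" using assms unfolding is_vector_integral_def by (intro dual_separates) metis
qed

locale finite_borel_vector_measure = finite_borel_measure m
  for m :: "'g::topological_space measure" +
  fixes \<nu> :: "'g set \<Rightarrow> 'x::{complex_normed_space, complete_space}"
  assumes M_ac: "\<nu> \<in> M_ac m"
begin

abbreviation h :: "('x \<Rightarrow> complex) \<Rightarrow> 'g \<Rightarrow> complex" where
  "h x' \<equiv> rn_density m (scalar_measure \<nu> x')"

lemma has_density_h:
  assumes "x' \<in> dual"
  shows "has_density m (scalar_measure \<nu> x') (h x')"
proof -
  have "vector_measure (scalar_measure \<nu> x')"
    using vector_measure_compose[OF dual_bounded_linear[OF assms] M_ac_vector_measure[OF M_ac]]
    by (simp add: scalar_measure_def[abs_def])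
  moreover have "scalar_measure \<nu> x' A = 0" if "A \<in> sets borel" "emeasure m A = 0" for A
    using M_ac_null[OF M_ac that] dual_zero[OF assms] by (simp add: scalar_measure_def)
  ultimately obtain k where "has_density m (scalar_measure \<nu> x') k" using complex_RN by blast
  moreover have "h x' = (SOME k. has_density m (scalar_measure \<nu> x') k)"
    unfolding rn_density_def has_density_def ..
  ultimately show ?thesis using someI[of "\<lambda>k. has_density m (scalar_measure \<nu> x') k" k] by simp
qed

lemma integrable_h: "x' \<in> dual \<Longrightarrow> integrable m (h x')"
  using has_density_h by (rule has_density_integrable)

lemma measurable_h [measurable]: "x' \<in> dual \<Longrightarrow> h x' \<in> borel_measurable borel"
  using borel_measurable_integrable[OF integrable_h] by simp

lemma L1_vm_measurable:
  assumes "f \<in> L1_vm \<nu>"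
  shows "f \<in> borel_measurable borel"
proof -
  have "(\<lambda>_::'x. 0) \<in> dual" by (simp add: dual_def)
  then show ?thesis
    using assms integrable_times_density(1)[OF has_density_h] by (auto simp: L1_vm_def)
qed

lemma L1_vm_integrable: "f \<in> L1_vm \<nu> \<Longrightarrow> x' \<in> dual \<Longrightarrow> integrable m (\<lambda>t. f t * h x' t)"
  using integrable_times_density(2)[OF has_density_h] by (auto simp: L1_vm_def)

lemma dual_vector_integral:
  assumes f: "f \<in> L1_vm \<nu>" and x': "x' \<in> dual" and A: "A \<in> sets borel"
  shows "x' (vector_integral \<nu> A f) = (LINT t:A|m. f t * h x' t)"
proof -
  obtain x where "is_vector_integral \<nu> A f x" using f A by (auto simp: L1_vm_def)
  then have "is_vector_integral \<nu> A f (vector_integral \<nu> A f)" using vector_integral_eqI by metis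
  then have "x' (vector_integral \<nu> A f) = complex_measure_integral (scalar_measure \<nu> x') A f"
    using x' by (simp add: is_vector_integral_def)
  also have "\<dots> = (LINT t:A|m. f t * h x' t)"
    by (rule complex_measure_integral_density[OF has_density_h[OF x'] L1_vm_measurable[OF f]
          L1_vm_integrable[OF f x'] A])
  finally show ?thesis .
qed

lemma is_vector_integralI:
  assumes "f \<in> borel_measurable borel" "\<And>x'. x' \<in> dual \<Longrightarrow> integrable m (\<lambda>t. f t * h x' t)"
    and "A \<in> sets borel" "\<And>x'. x' \<in> dual \<Longrightarrow> x' x = (LINT t:A|m. f t * h x' t)"
  shows "is_vector_integral \<nu> A f x"
  unfolding is_vector_integral_def
  using assms complex_measure_integral_density[OF has_density_h] by simp

lemma L1_vmI:
  assumes f[measurable]: "f \<in> borel_measurable borel"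
    and int: "\<And>x'. x' \<in> dual \<Longrightarrow> integrable m (\<lambda>t. f t * h x' t)"
    and ex: "\<And>A. A \<in> sets borel \<Longrightarrow> \<exists>x. \<forall>x'\<in>dual. x' x = (LINT t:A|m. f t * h x' t)"
  shows "f \<in> L1_vm \<nu>"
  unfolding L1_vm_def
proof (intro CollectI conjI ballI)
  fix x' :: "'x \<Rightarrow> complex" assume x'[measurable]: "x' \<in> dual"
  have "integrable m (\<lambda>t. cmod (h x' t) *\<^sub>R f t)"
    by (rule Bochner_Integration.integrable_bound[OF int[OF x']]) (auto simp: norm_mult)
  then show "integrable (variation_measure (scalar_measure \<nu> x')) f"
    unfolding variation_measure_density[OF has_density_h[OF x']]
    by (subst integrable_density) auto
next
  fix A :: "'g set" assume A: "A \<in> sets borel"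
  then obtain x where "is_vector_integral \<nu> A f x"
    using ex[OF A] is_vector_integralI[OF f int A] by blast
  then show "\<exists>!x. is_vector_integral \<nu> A f x" using vector_integral_eqI by metis
qed

lemma has_density_vector_integral:
  assumes "f \<in> L1_vm \<nu>" "x' \<in> dual"
  shows "has_density m (scalar_measure (\<lambda>A. vector_integral \<nu> A f) x') (\<lambda>t. f t * h x' t)"
  using assms L1_vm_integrable dual_vector_integral by (simp add: has_density_def scalar_measure_def)

lemma one_L1_vm: "(\<lambda>_. 1) \<in> L1_vm \<nu>"
  using integrable_h has_density_eq[OF has_density_h]
  by (intro L1_vmI) (auto simp: scalar_measure_def)

lemma vector_integral_one:
  assumes "A \<in> sets borel"
  shows "vector_integral \<nu> A (\<lambda>_. 1) = \<nu> A"
  using has_density_eq[OF has_density_h assms] dual_vector_integral[OF one_L1_vm _ assms]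
  by (intro dual_separates) (simp add: scalar_measure_def)

text \<open>The uniform boundedness principle for \<open>f d\<nu>\<close>: the vectors \<open>\<integral>\<^sub>A f d\<nu>\<close> are weakly bounded, hence norm
  bounded, and norm bounds on them limit all weak integrals at once.\<close>

lemma weak_integrals_bounded:
  assumes f: "f \<in> L1_vm \<nu>"
  obtains C where "0 \<le> C" "\<And>x'. x' \<in> dual_ball \<Longrightarrow> (\<integral>t. cmod (f t * h x' t) \<partial>m) \<le> C"
proof -
  have "bounded ((\<lambda>A. vector_integral \<nu> A f) ` sets borel)"
  proof (rule weakly_bounded_imp_bounded)
    fix x' :: "'x \<Rightarrow> complex" assume x': "x' \<in> dual"
    have "cmod (x' (vector_integral \<nu> A f)) \<le> (\<integral>t. cmod (f t * h x' t) \<partial>m)"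
      if A: "A \<in> sets borel" for A
    proof -
      have "cmod (x' (vector_integral \<nu> A f)) \<le> (\<integral>t. cmod (indicator A t *\<^sub>R (f t * h x' t)) \<partial>m)"
        unfolding dual_vector_integral[OF f x' A] set_lebesgue_integral_def by (rule integral_norm_bound)
      also have "\<dots> \<le> (\<integral>t. cmod (f t * h x' t) \<partial>m)"
        using L1_vm_integrable[OF f x'] A
        by (intro integral_mono integrable_norm integrable_on_borel) (auto simp: indicator_def)
      finally show ?thesis .
    qed
    then show "bounded (x' ` (\<lambda>A. vector_integral \<nu> A f) ` sets borel)"
      by (auto simp: bounded_iff)
  qed
  then obtain C where C: "\<And>A. A \<in> sets borel \<Longrightarrow> norm (vector_integral \<nu> A f) \<le> C"
    by (auto simp: bounded_iff)
  have "(\<integral>t. cmod (f t * h x' t) \<partial>m) \<le> 4 * C" if x': "x' \<in> dual_ball" for x'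
  proof (rule integral_norm_le)
    show "integrable m (\<lambda>t. f t * h x' t)" using f x' dual_ball_dual L1_vm_integrable by blast
    fix A :: "'g set" assume A: "A \<in> sets borel"
    then show "cmod (LINT t:A|m. f t * h x' t) \<le> C"
      using dual_vector_integral[OF f dual_ball_dual[OF x'] A]
        dual_ball_bound[OF x', of "vector_integral \<nu> A f"] C[OF A] by simp
  qed
  moreover have "0 \<le> 4 * C" using order_trans[OF norm_ge_zero C[of UNIV]] by simp
  ultimately show thesis by (rule that[rotated])
qed

lemma dual_simple_sum:
  assumes f: "f \<in> L1_vm \<nu>" and \<phi>: "simple_function borel \<phi>" and x': "x' \<in> dual" and A: "A \<in> sets borel"
  shows "x' (\<Sum>c\<in>range \<phi>. c *\<^sub>C vector_integral \<nu> (A \<inter> \<phi> -` {c}) f) = (LINT t:A|m. \<phi> t * (f t * h x' t))"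
proof -
  have L: "A \<inter> \<phi> -` {c} \<in> sets borel" for c
    using A simple_functionD(2)[OF \<phi>, of "{c}"] by auto
  have fin: "finite (range \<phi>)" using simple_functionD(1)[OF \<phi>] by simp
  note int = L1_vm_integrable[OF f x']
  have "x' (\<Sum>c\<in>range \<phi>. c *\<^sub>C vector_integral \<nu> (A \<inter> \<phi> -` {c}) f)
      = (\<Sum>c\<in>range \<phi>. c * (LINT t:A \<inter> \<phi> -` {c}|m. f t * h x' t))"
    by (simp add: dual_sum dual_scaleC dual_vector_integral f x' L)
  also have "\<dots> = (\<integral>t. (\<Sum>c\<in>range \<phi>. c * (indicator (A \<inter> \<phi> -` {c}) t *\<^sub>R (f t * h x' t))) \<partial>m)"
    unfolding set_lebesgue_integral_def
    by (subst Bochner_Integration.integral_sum)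
       (intro integrable_mult_right integrable_on_borel int L, simp only: integral_mult_right_zero)
  also have "\<dots> = (LINT t:A|m. \<phi> t * (f t * h x' t))"
    unfolding set_lebesgue_integral_def
  proof (intro Bochner_Integration.integral_cong refl)
    fix t
    have "(\<Sum>c\<in>range \<phi>. c * (indicator (A \<inter> \<phi> -` {c}) t *\<^sub>R (f t * h x' t)))
        = (\<Sum>c\<in>{\<phi> t}. c * (indicator (A \<inter> \<phi> -` {c}) t *\<^sub>R (f t * h x' t)))"
      using fin by (intro sum.mono_neutral_right) auto
    then show "(\<Sum>c\<in>range \<phi>. c * (indicator (A \<inter> \<phi> -` {c}) t *\<^sub>R (f t * h x' t)))
        = indicator A t *\<^sub>R (\<phi> t * (f t * h x' t))"
      by (auto simp: indicator_def)
  qed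
  finally show ?thesis .
qed

text \<open>The integrals of \<open>f \<phi>\<^sub>n\<close> for simple \<open>\<phi>\<^sub>n \<rightarrow> w\<close> (uniformly) are explicit elements of \<open>X\<close>. A norming
  functional together with \<open>weak_integrals_bounded\<close> bounds their distances by the uniform distances of the
  \<open>\<phi>\<^sub>n\<close>, so they converge, and the limit is the integral of \<open>f w\<close>.\<close>

lemma L1_vm_times_bounded:
  assumes f: "f \<in> L1_vm \<nu>" and w: "w \<in> borel_measurable borel" "\<And>t. cmod (w t) \<le> b"
  shows "(\<lambda>t. f t * w t) \<in> L1_vm \<nu>"
proof (rule L1_vmI)
  show "(\<lambda>t. f t * w t) \<in> borel_measurable borel"
    using L1_vm_measurable[OF f] w(1) by simp
  have iw: "integrable m (\<lambda>t. w t * (f t * h x' t))" if "x' \<in> dual" for x'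
    using integrable_times_bounded[OF L1_vm_integrable[OF f that] w] .
  then show "integrable m (\<lambda>t. f t * w t * h x' t)" if "x' \<in> dual" for x'
    using that by (simp add: mult_ac)
  fix A :: "'g set" assume A: "A \<in> sets borel"
  obtain C where C: "0 \<le> C" "\<And>x'. x' \<in> dual_ball \<Longrightarrow> (\<integral>t. cmod (f t * h x' t) \<partial>m) \<le> C"
    using weak_integrals_bounded[OF f] by blast
  have "\<exists>\<phi>. simple_function borel \<phi> \<and> (\<forall>t. cmod (w t - \<phi> t) \<le> inverse (real (Suc n)))" for n
    using uniform_simple_approx[OF w, of "inverse (real (Suc n))"] by (metis inverse_positive_iff_positive of_nat_0_less_iff zero_less_Suc)
  then obtain \<phi> where \<phi>: "\<And>n. simple_function borel (\<phi> n)"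
      "\<And>n t. cmod (w t - \<phi> n t) \<le> inverse (real (Suc n))"
    by metis
  have i\<phi>: "integrable m (\<lambda>t. \<phi> n t * (f t * h x' t))" if "x' \<in> dual" for x' n
  proof -
    obtain b where "\<And>t. cmod (\<phi> n t) \<le> b" using simple_function_bounded[OF \<phi>(1)] by blast
    then show ?thesis
      by (rule integrable_times_bounded[OF L1_vm_integrable[OF f that] borel_measurable_simple_function[OF \<phi>(1)]])
  qed
  define x where "x n = (\<Sum>c\<in>range (\<phi> n). c *\<^sub>C vector_integral \<nu> (A \<inter> \<phi> n -` {c}) f)" for n
  have x: "x' (x n) = (LINT t:A|m. \<phi> n t * (f t * h x' t))" if "x' \<in> dual" for x' n
    unfolding x_def by (rule dual_simple_sum[OF f \<phi>(1) that A])
  \<comment> \<open>The bound is uniform over the dual ball, which is what makes the sequence Cauchy in norm.\<close>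
  have near: "norm (x n - x k) \<le> (inverse (real (Suc n)) + inverse (real (Suc k))) * C" for n k
  proof -
    obtain x' where x': "x' \<in> dual_ball" "norm (x n - x k) \<le> cmod (x' (x n - x k))"
      by (rule dual_ball_norming)
    note d = dual_ball_dual[OF x'(1)]
    have "cmod (\<phi> n t - \<phi> k t) \<le> inverse (real (Suc n)) + inverse (real (Suc k))" for t
      using norm_triangle_ineq4[of "w t - \<phi> k t" "w t - \<phi> n t"] \<phi>(2)[of t n] \<phi>(2)[of t k] by simp
    then have "cmod (x' (x n - x k)) \<le> (inverse (real (Suc n)) + inverse (real (Suc k))) * (\<integral>t. cmod (f t * h x' t) \<partial>m)"
      unfolding dual_diff[OF d] x[OF d]
      by (intro set_integral_uniform L1_vm_integrable[OF f d] i\<phi>[OF d] A)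
    also have "\<dots> \<le> (inverse (real (Suc n)) + inverse (real (Suc k))) * C"
      by (intro mult_left_mono C(2) x') auto
    finally show ?thesis using x'(2) by simp
  qed
  have "Cauchy x"
  proof (rule metric_CauchyI)
    fix e :: real assume "0 < e"
    then have "0 < e / (2 * (C + 1))" using C(1) by simp
    then obtain k where "inverse (real (Suc k)) < e / (2 * (C + 1))" using reals_Archimedean by blast
    then obtain N :: nat where N: "N > 0" "inverse (real N) < e / (2 * (C + 1))" by blast
    have "dist (x n) (x k) < e" if "N \<le> n" "N \<le> k" for n k
    proof -
      have inv: "inverse (real (Suc j)) \<le> inverse (real N)" if "N \<le> j" for j
        using that N by (intro le_imp_inverse_le) auto
      have "dist (x n) (x k) \<le> (inverse (real (Suc n)) + inverse (real (Suc k))) * C"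
        using near by (simp add: dist_norm)
      also have "\<dots> \<le> (2 * inverse (real N)) * (C + 1)"
        using inv[OF that(1)] inv[OF that(2)] C(1) by (intro mult_mono) auto
      also have "\<dots> < e" using N(2) C(1) by (simp add: field_simps)
      finally show ?thesis .
    qed
    then show "\<exists>N. \<forall>n\<ge>N. \<forall>k\<ge>N. dist (x n) (x k) < e" by blast
  qed
  then obtain y where y: "x \<longlonglongrightarrow> y" using Cauchy_convergent convergentD by blast
  have "x' y = (LINT t:A|m. f t * w t * h x' t)" if d: "x' \<in> dual" for x'
  proof -
    have "(\<lambda>n. x' (x n)) \<longlonglongrightarrow> x' y"
      using bounded_linear.tendsto[OF dual_bounded_linear[OF d] y] .
    moreover have "(\<lambda>n. x' (x n)) \<longlonglongrightarrow> (LINT t:A|m. w t * (f t * h x' t))"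
    proof (rule LIM_zero_cancel, rule Lim_null_comparison)
      have "cmod (x' (x n) - (LINT t:A|m. w t * (f t * h x' t))) \<le> inverse (real (Suc n)) * (\<integral>t. cmod (f t * h x' t) \<partial>m)" for n
        unfolding x[OF d] using \<phi>(2)
        by (intro set_integral_uniform L1_vm_integrable[OF f d] i\<phi>[OF d] iw[OF d] A) (simp add: norm_minus_commute)
      then show "\<forall>\<^sub>F n in sequentially. norm (x' (x n) - (LINT t:A|m. w t * (f t * h x' t))) \<le> inverse (real (Suc n)) * (\<integral>t. cmod (f t * h x' t) \<partial>m)"
        by auto
      show "(\<lambda>n. inverse (real (Suc n)) * (\<integral>t. cmod (f t * h x' t) \<partial>m)) \<longlonglongrightarrow> 0"
        using LIMSEQ_inverse_real_of_nat by (rule tendsto_mult_left_zero)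
    qed
    ultimately have "x' y = (LINT t:A|m. w t * (f t * h x' t))" by (rule LIMSEQ_unique)
    then show ?thesis by (simp add: mult_ac)
  qed
  then show "\<exists>x. \<forall>x'\<in>dual. x' x = (LINT t:A|m. f t * w t * h x' t)" by blast
qed

lemma simple_L1_vm:
  assumes "simple_function borel \<phi>"
  shows "\<phi> \<in> L1_vm \<nu>"
proof -
  obtain b where "\<And>t. cmod (\<phi> t) \<le> b" using simple_function_bounded[OF assms] by blast
  then show ?thesis
    using L1_vm_times_bounded[OF one_L1_vm borel_measurable_simple_function[OF assms], of b] by simp
qed

lemma vector_integral_simple:
  assumes \<phi>: "simple_function borel \<phi>" and A: "A \<in> sets borel"
  shows "vector_integral \<nu> A \<phi> = (\<Sum>c\<in>range \<phi>. c *\<^sub>C \<nu> (A \<inter> \<phi> -` {c}))"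
proof (rule dual_separates)
  fix x' :: "'x \<Rightarrow> complex" assume x': "x' \<in> dual"
  have L: "A \<inter> \<phi> -` {c} \<in> sets borel" for c
    using A simple_functionD(2)[OF \<phi>, of "{c}"] by auto
  show "x' (vector_integral \<nu> A \<phi>) = x' (\<Sum>c\<in>range \<phi>. c *\<^sub>C \<nu> (A \<inter> \<phi> -` {c}))"
    using dual_simple_sum[OF one_L1_vm \<phi> x' A]
    by (simp add: vector_integral_one L dual_vector_integral[OF simple_L1_vm[OF \<phi>] x' A])
qed

lemma semivariation_vector_integral:
  assumes "f \<in> L1_vm \<nu>"
  shows "semivariation (\<lambda>A. vector_integral \<nu> A f) = (SUP x'\<in>dual_ball. \<integral>\<^sup>+t. ennreal (cmod (f t * h x' t)) \<partial>m)"
  unfolding semivariation_def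
  by (intro SUP_cong refl) (simp add: variation_density[OF has_density_vector_integral[OF assms dual_ball_dual]])

end

section \<open>Baire sets and Radon measures on compact spaces\<close>

text \<open>The Baire \<open>\<sigma>\<close>-algebra, generated by the cozero sets of continuous functions (the positivity sets
  suffice, since \<open>\<phi>\<close> may be replaced by \<open>\<bar>\<phi>\<bar>\<close>).\<close>

definition baire :: "'a::topological_space measure" where
  "baire = sigma UNIV {{x. 0 < \<phi> x} |\<phi> :: 'a \<Rightarrow> real. continuous_on UNIV \<phi>}"

lemma space_baire [simp]: "space baire = UNIV"
  by (simp add: baire_def)

lemma cozero_baire:
  fixes \<phi> :: "'a::topological_space \<Rightarrow> real"
  assumes "continuous_on UNIV \<phi>"
  shows "{x. 0 < \<phi> x} \<in> sets baire"
proof -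
  have "{x. 0 < \<phi> x} \<in> sigma_sets UNIV {{x. 0 < \<phi> x} |\<phi> :: 'a \<Rightarrow> real. continuous_on UNIV \<phi>}"
    using assms by (intro sigma_sets.Basic) blast
  then show ?thesis unfolding baire_def by (subst sets_measure_of) simp_all
qed

lemma measurable_into_baire:
  assumes "space M = UNIV"
    and "\<And>\<phi> :: 'b::topological_space \<Rightarrow> real. continuous_on UNIV \<phi> \<Longrightarrow> {x. 0 < \<phi> (T x)} \<in> sets M"
  shows "T \<in> M \<rightarrow>\<^sub>M (baire :: 'b measure)"
  unfolding baire_def
proof (rule measurable_measure_of)
  fix y assume "y \<in> {{x. 0 < \<phi> x} |\<phi> :: 'b \<Rightarrow> real. continuous_on UNIV \<phi>}"
  then obtain \<phi> :: "'b \<Rightarrow> real" where "continuous_on UNIV \<phi>" "y = {x. 0 < \<phi> x}" by blast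
  moreover have "T -` {x. 0 < \<phi> x} \<inter> space M = {x. 0 < \<phi> (T x)}" using assms(1) by blast
  ultimately show "T -` y \<inter> space M \<in> sets M" using assms(2) by metis
qed simp_all

lemma borel_baire: "(\<lambda>x. x) \<in> borel \<rightarrow>\<^sub>M (baire :: 'a::topological_space measure)"
proof (rule measurable_into_baire)
  fix \<phi> :: "'a \<Rightarrow> real" assume "continuous_on UNIV \<phi>"
  then have [measurable]: "\<phi> \<in> borel_measurable borel" by (rule borel_measurable_continuous_onI)
  show "{x. 0 < \<phi> x} \<in> sets borel" by measurable
qed simp

lemma baire_imp_borel: "A \<in> sets baire \<Longrightarrow> A \<in> sets borel"
  using measurable_sets[OF borel_baire, of A] by (simp only: vimage_ident space_borel Int_UNIV_right)

text \<open>The reason for working with Baire sets. An open subset of a product is in general an uncountable union of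
  open rectangles, but the cozero set of \<open>F\<close> is the countable union of the compact sets where
  \<open>F\<close> is at least \<open>1/n\<close>, and each of these is covered by finitely many rectangles inside the cozero set.\<close>

lemma continuous_into_baire:
  fixes T :: "'a::topological_space \<times> 'b::topological_space \<Rightarrow> 'c::topological_space"
  assumes cpt: "compact (UNIV :: 'a set)" "compact (UNIV :: 'b set)" and T: "continuous_on UNIV T"
  shows "T \<in> borel \<Otimes>\<^sub>M borel \<rightarrow>\<^sub>M baire"
proof (rule measurable_into_baire)
  fix \<phi> :: "'c \<Rightarrow> real" assume \<phi>: "continuous_on UNIV \<phi>"
  define F where "F = (\<lambda>z. \<phi> (T z))"
  have F: "continuous_on UNIV F"
    unfolding F_def by (rule continuous_on_compose2[OF \<phi> T]) simp
  have cpt2: "compact (UNIV :: ('a \<times> 'b) set)"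
    using compact_Times[OF cpt] by simp
  have opn: "open {z. 0 < F z}"
    by (rule open_Collect_less[OF continuous_on_const F])
  have "\<exists>D. D \<in> sets (borel \<Otimes>\<^sub>M borel) \<and> {z. inverse (real (Suc n)) \<le> F z} \<subseteq> D \<and> D \<subseteq> {z. 0 < F z}" for n
  proof -
    have "closed {z. inverse (real (Suc n)) \<le> F z}"
      by (rule closed_Collect_le[OF continuous_on_const F])
    then have K: "compact {z. inverse (real (Suc n)) \<le> F z}"
      using compact_Int_closed[OF cpt2] by simp
    define R where "R = {U \<times> V |U V. open U \<and> open V \<and> U \<times> V \<subseteq> {z. 0 < F z}}"
    have "{z. inverse (real (Suc n)) \<le> F z} \<subseteq> \<Union>R"
    proof
      fix z assume "z \<in> {z. inverse (real (Suc n)) \<le> F z}"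
      then have "inverse (real (Suc n)) \<le> F z" by simp
      moreover have "0 < inverse (real (Suc n))" by simp
      ultimately have "0 < F z" by linarith
      then have "z \<in> {z. 0 < F z}" by simp
      then obtain U V where "open U" "open V" "z \<in> U \<times> V" "U \<times> V \<subseteq> {z. 0 < F z}"
        using open_prod_elim[OF opn] by metis
      then show "z \<in> \<Union>R" unfolding R_def by blast
    qed
    moreover have "open S" if "S \<in> R" for S using that by (auto simp: R_def intro: open_Times)
    ultimately obtain D where D: "D \<subseteq> R" "finite D" "{z. inverse (real (Suc n)) \<le> F z} \<subseteq> \<Union>D"
      using compactE[OF K, of R] by metis
    have "S \<in> sets (borel \<Otimes>\<^sub>M borel)" if "S \<in> D" for S
      using that D(1) by (auto simp: R_def intro!: pair_measureI)
    then have "\<Union>D \<in> sets (borel \<Otimes>\<^sub>M borel)" using D(2) by (intro sets.finite_Union) auto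
    then show ?thesis using D by (intro exI[of _ "\<Union>D"]) (auto simp: R_def)
  qed
  then obtain D where D: "\<And>n. D n \<in> sets (borel \<Otimes>\<^sub>M borel)"
      "\<And>n. {z. inverse (real (Suc n)) \<le> F z} \<subseteq> D n" "\<And>n. D n \<subseteq> {z. 0 < F z}"
    by metis
  have "{z. 0 < F z} = (\<Union>n. D n)"
  proof
    show "{z. 0 < F z} \<subseteq> (\<Union>n. D n)"
    proof
      fix z assume "z \<in> {z. 0 < F z}"
      then obtain n where "inverse (real (Suc n)) < F z" using reals_Archimedean[of "F z"] by auto
      then show "z \<in> (\<Union>n. D n)" using D(2)[of n] by force
    qed
  qed (use D(3) in blast)
  then show "{z. 0 < \<phi> (T z)} \<in> sets (borel \<Otimes>\<^sub>M borel)" using D(1) by (simp add: F_def)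
qed (simp add: space_pair_measure)

locale radon_probability = finite_borel_measure m for m :: "'g::t2_space measure" +
  assumes compact_UNIV: "compact (UNIV :: 'g set)"
    and emeasure_UNIV [simp]: "emeasure m UNIV = 1"
    and outer: "A \<in> sets borel \<Longrightarrow> emeasure m A = (INF U \<in> {U. open U \<and> A \<subseteq> U}. emeasure m U)"
    and inner: "open U \<Longrightarrow> emeasure m U = (SUP K \<in> {K. compact K \<and> K \<subseteq> U}. emeasure m K)"
begin

text \<open>Compact sets exhaust \<open>U\<close> in measure, and Urysohn's lemma puts a cozero set between each of them and \<open>U\<close>.\<close>

lemma baire_inside_open:
  assumes U: "open U"
  obtains A where "A \<in> sets baire" "A \<subseteq> U" "emeasure m A = emeasure m U"
proof -
  have "{K. compact K \<and> K \<subseteq> U} \<noteq> {}" by (intro exI[of _ "{}"] ex_in_conv[THEN iffD1]) auto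
  then obtain k where k: "range k \<subseteq> emeasure m ` {K. compact K \<and> K \<subseteq> U}"
      "(SUP K \<in> {K. compact K \<and> K \<subseteq> U}. emeasure m K) = (SUP i::nat. k i)"
    using ennreal_SUP_countable_SUP[of "{K. compact K \<and> K \<subseteq> U}" "emeasure m"] by metis
  then have "\<exists>K. compact K \<and> K \<subseteq> U \<and> k i = emeasure m K" for i by blast
  then obtain K where K: "\<And>i. compact (K i)" "\<And>i. K i \<subseteq> U" "\<And>i. k i = emeasure m (K i)" by metis
  have "\<exists>\<phi> :: 'g \<Rightarrow> real. continuous_on UNIV \<phi> \<and> (\<forall>x\<in>K i. \<phi> x = 1) \<and> (\<forall>x. x \<notin> U \<longrightarrow> \<phi> x = 0)" for i
  proof -
    have "compact_space (euclidean :: 'g topology)"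
      using compact_UNIV by (simp add: compact_space_def)
    then have "normal_space (euclidean :: 'g topology)"
      by (rule compact_Hausdorff_or_regular_imp_normal_space)
         (simp add: Hausdorff_space_def disjnt_def, metis hausdorff)
    moreover have "closedin euclidean (- U)" "closedin euclidean (K i)"
      using U K(1)[of i] by (auto simp: closed_Compl compact_imp_closed)
    moreover have "disjnt (- U) (K i)" using K(2)[of i] by (auto simp: disjnt_def)
    ultimately obtain \<phi> where \<phi>: "continuous_map euclidean (top_of_set {0..1::real}) \<phi>"
        "\<phi> ` (- U) \<subseteq> {0}" "\<phi> ` K i \<subseteq> {1}"
      using Urysohn_lemma[of euclidean "- U" "K i" 0 1] by auto
    have "continuous_on UNIV \<phi>" using \<phi>(1) by (auto simp: continuous_map_in_subtopology)
    then show ?thesis using \<phi> by (intro exI[of _ \<phi>]) auto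
  qed
  then obtain \<phi> :: "nat \<Rightarrow> 'g \<Rightarrow> real" where \<phi>: "\<And>i. continuous_on UNIV (\<phi> i)"
      "\<And>i x. x \<in> K i \<Longrightarrow> \<phi> i x = 1" "\<And>i x. x \<notin> U \<Longrightarrow> \<phi> i x = 0"
    by metis
  define A where "A = (\<Union>i. {x. 0 < \<phi> i x})"
  have A: "A \<in> sets baire" unfolding A_def using cozero_baire[OF \<phi>(1)] by blast
  have AU: "A \<subseteq> U" unfolding A_def using \<phi>(3) by force
  have "emeasure m U = (SUP i. emeasure m (K i))" using inner[OF U] k(2) K(3) by simp
  also have "\<dots> \<le> emeasure m A"
  proof (rule SUP_least)
    fix i show "emeasure m (K i) \<le> emeasure m A"
    proof (rule emeasure_mono)
      show "K i \<subseteq> A"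
      proof
        fix x assume "x \<in> K i"
        then have "0 < \<phi> i x" using \<phi>(2) by simp
        then show "x \<in> A" unfolding A_def by blast
      qed
      show "A \<in> sets m" using baire_imp_borel[OF A] by simp
    qed
  qed
  finally have "emeasure m U \<le> emeasure m A" .
  moreover have "emeasure m A \<le> emeasure m U" using AU U by (intro emeasure_mono) auto
  ultimately show thesis using A AU by (intro that) auto
qed

lemma baire_approx_set:
  assumes A: "A \<in> sets borel"
  obtains A' where "A' \<in> sets baire" "AE x in m. x \<in> A \<longleftrightarrow> x \<in> A'"
proof -
  have "{U. open U \<and> A \<subseteq> U} \<noteq> {}" by (intro exI[of _ UNIV] ex_in_conv[THEN iffD1]) auto
  then obtain k where k: "range k \<subseteq> emeasure m ` {U. open U \<and> A \<subseteq> U}"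
      "(INF U \<in> {U. open U \<and> A \<subseteq> U}. emeasure m U) = (INF i::nat. k i)"
    using ennreal_Inf_countable_INF[of "emeasure m ` {U. open U \<and> A \<subseteq> U}"] by auto
  then have "\<exists>U. open U \<and> A \<subseteq> U \<and> k i = emeasure m U" for i by blast
  then obtain U where U: "\<And>i. open (U i)" "\<And>i. A \<subseteq> U i" "\<And>i. k i = emeasure m (U i)" by metis
  define B where "B = (\<Inter>i. U i)"
  have Um[measurable]: "U i \<in> sets m" for i using U(1) by simp
  have B: "B \<in> sets m" unfolding B_def using Um by blast
  have "emeasure m B \<le> emeasure m (U i)" for i
    using U(1) by (intro emeasure_mono) (auto simp: B_def)
  then have "emeasure m B \<le> emeasure m A"
    unfolding outer[OF A] k(2) U(3) by (intro INF_greatest)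
  moreover have "A \<subseteq> B" using U(2) by (auto simp: B_def)
  ultimately have "emeasure m (B - A) = 0"
    using A B by (subst emeasure_Diff) (auto simp: diff_eq_0_ennreal less_top[symmetric])
  then have BA: "AE x in m. x \<notin> B - A" using A B by (intro AE_not_in) auto
  have "\<exists>A'. A' \<in> sets baire \<and> A' \<subseteq> U i \<and> emeasure m A' = emeasure m (U i)" for i
    using baire_inside_open[OF U(1)] by metis
  then obtain V where V: "\<And>i. V i \<in> sets baire" "\<And>i. V i \<subseteq> U i" "\<And>i. emeasure m (V i) = emeasure m (U i)"
    by metis
  have Vm: "V i \<in> sets m" for i using baire_imp_borel[OF V(1)] by simp
  have "emeasure m (U i - V i) = 0" for i
    using V(2,3) Vm U(1) by (subst emeasure_Diff) auto
  then have "AE x in m. x \<notin> U i - V i" for i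
    using Vm U(1) by (intro AE_not_in null_setsI) auto
  then have UV: "AE x in m. \<forall>i. x \<notin> U i - V i" by (simp add: AE_all_countable)
  show thesis
  proof (rule that)
    show "(\<Inter>i. V i) \<in> sets baire" using V(1) by blast
    show "AE x in m. x \<in> A \<longleftrightarrow> x \<in> (\<Inter>i. V i)"
      using BA UV
    proof eventually_elim
      case (elim x)
      then show ?case using U(2) V(2) unfolding B_def by blast
    qed
  qed
qed

lemma baire_approx_fun:
  fixes f :: "'g \<Rightarrow> complex"
  assumes f: "f \<in> borel_measurable borel"
  obtains f' where "f' \<in> borel_measurable baire" "AE x in m. f x = f' x"
proof -
  obtain s where s: "\<And>i::nat. simple_function borel (s i)" "\<And>x. (\<lambda>i. s i x) \<longlonglongrightarrow> f x"
    using borel_measurable_implies_sequence_metric[OF f, of 0] by auto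
  have "\<exists>u. u \<in> borel_measurable baire \<and> (AE x in m. s i x = u x)" for i
  proof -
    have fin: "finite (range (s i))" using simple_functionD(1)[OF s(1)[of i]] by simp
    have L: "s i -` {c} \<in> sets borel" for c using simple_functionD(2)[OF s(1)[of i], of "{c}"] by simp
    have "\<exists>A'. A' \<in> sets baire \<and> (AE x in m. x \<in> s i -` {c} \<longleftrightarrow> x \<in> A')" for c
      using baire_approx_set[OF L] by metis
    then obtain L' where L': "\<And>c. L' c \<in> sets baire" "\<And>c. AE x in m. x \<in> s i -` {c} \<longleftrightarrow> x \<in> L' c"
      by metis
    define u where "u x = (\<Sum>c\<in>range (s i). c * indicator (L' c) x)" for x
    have "u \<in> borel_measurable baire"
      unfolding u_def using L'(1) by (intro borel_measurable_sum borel_measurable_times) auto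
    moreover have "AE x in m. \<forall>c\<in>range (s i). x \<in> s i -` {c} \<longleftrightarrow> x \<in> L' c"
      using fin L'(2) by (intro AE_finite_allI) auto
    then have "AE x in m. s i x = u x"
    proof eventually_elim
      fix x assume x: "\<forall>c\<in>range (s i). x \<in> s i -` {c} \<longleftrightarrow> x \<in> L' c"
      have "u x = (\<Sum>c\<in>range (s i). if s i x = c then c else 0)"
        unfolding u_def
      proof (intro sum.cong refl)
        fix c assume "c \<in> range (s i)"
        then have "x \<in> L' c \<longleftrightarrow> s i x = c" using x by (metis vimage_singleton_eq)
        then show "c * indicator (L' c) x = (if s i x = c then c else 0)" by (simp add: indicator_def)
      qed
      then show "s i x = u x" using fin by (simp add: sum.delta)
    qed
    ultimately show ?thesis by blast
  qed
  then obtain u where u: "\<And>i. u i \<in> borel_measurable baire" "\<And>i. AE x in m. s i x = u i x" by metis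
  show thesis
  proof (rule that)
    show "(\<lambda>x. lim (\<lambda>i. u i x)) \<in> borel_measurable baire" using u(1) by (rule borel_measurable_lim_metric)
    have "AE x in m. \<forall>i. s i x = u i x" using u(2) by (simp add: AE_all_countable)
    then show "AE x in m. f x = lim (\<lambda>i. u i x)"
      by eventually_elim (use s(2) in \<open>metis (no_types, lifting) ext limI\<close>)
  qed
qed

end

section \<open>Haar measure and convolution on a compact group\<close>

locale compact_haar = radon_probability m for m :: "'g::{topological_group_add, t2_space} measure" +
  assumes left_invariant: "A \<in> sets borel \<Longrightarrow> emeasure m ((\<lambda>s. t + s) ` A) = emeasure m A"

lemma compact_haarI:
  fixes m :: "'g::{topological_group_add, t2_space} measure"
  assumes "compact (UNIV :: 'g set)" "normalized_haar m"
  shows "compact_haar m"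
proof -
  have sets: "sets m = sets borel" and one: "emeasure m UNIV = 1"
    using assms by (auto simp: normalized_haar_def)
  then have "space m = UNIV" using sets_eq_imp_space_eq[OF sets] by simp
  then have "finite_measure m" using one by (intro finite_measureI) simp
  then show ?thesis
    using assms unfolding normalized_haar_def
    by (intro compact_haar.intro radon_probability.intro finite_borel_measure.intro
        finite_borel_measure_axioms.intro radon_probability_axioms.intro compact_haar_axioms.intro) auto
qed

context compact_haar
begin

lemma measurable_translate [measurable]:
  "(\<lambda>s::'g. t + s) \<in> borel \<rightarrow>\<^sub>M borel" "(\<lambda>s::'g. s + t) \<in> borel \<rightarrow>\<^sub>M borel" "(\<lambda>s::'g. - s) \<in> borel \<rightarrow>\<^sub>M borel"
  by (intro borel_measurable_continuous_onI continuous_intros)+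

lemma image_translate:
  fixes A :: "'g set"
  shows "(\<lambda>s. t + s) ` A = (\<lambda>s. - t + s) -` A" "(\<lambda>s. s + t) ` A = (\<lambda>s. s + - t) -` A" "uminus ` A = uminus -` A"
proof -
  show "(\<lambda>s. t + s) ` A = (\<lambda>s. - t + s) -` A"
    by (auto simp: add.assoc[symmetric] intro!: image_eqI[where x = "- t + s" for s])
  show "(\<lambda>s. s + t) ` A = (\<lambda>s. s + - t) -` A"
    by (auto simp: add.assoc intro!: image_eqI[where x = "s + - t" for s])
  show "uminus ` A = uminus -` A"
    by (auto intro!: image_eqI[where x = "- s" for s])
qed

lemma borel_image_translate:
  fixes A :: "'g set"
  assumes "A \<in> sets borel"
  shows "(\<lambda>s. t + s) ` A \<in> sets borel" "(\<lambda>s. s + t) ` A \<in> sets borel" "uminus ` A \<in> sets borel"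
  unfolding image_translate
  using measurable_sets[OF measurable_translate(1) assms, of "- t"] measurable_sets[OF measurable_translate(2) assms, of "- t"]
    measurable_sets[OF measurable_translate(3) assms] by simp_all

text \<open>Let \<open>m'\<close> be the image of \<open>m\<close> under inversion. The measure of \<open>{(s, t). t + s \<in> A}\<close> for the product of
  \<open>m\<close> and \<open>m'\<close> is \<open>m A\<close> when integrating over \<open>s\<close> first, by left invariance of \<open>m\<close>, and \<open>m' A\<close> when
  integrating over \<open>t\<close> first, by right invariance of \<open>m'\<close>. The Baire property makes this set measurable.\<close>

lemma emeasure_uminus_baire:
  assumes A: "A \<in> sets baire"
  shows "emeasure m (uminus ` A) = emeasure m A"
proof -
  let ?m' = "distr m borel uminus"
  have um: "uminus \<in> m \<rightarrow>\<^sub>M (borel :: 'g measure)" using measurable_translate(3) by simp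
  note Ab = baire_imp_borel[OF A]
  have m': "emeasure ?m' B = emeasure m (uminus ` B)" if "B \<in> sets borel" for B
    using that um by (subst emeasure_distr) (auto simp: image_translate)
  interpret m': finite_measure ?m'
    using m'[of UNIV] by (intro finite_measureI) (simp add: image_translate)
  interpret P: pair_sigma_finite m ?m' ..
  have plus: "(\<lambda>z. fst z + snd z) \<in> borel \<Otimes>\<^sub>M borel \<rightarrow>\<^sub>M (baire :: 'g measure)"
    by (intro continuous_into_baire compact_UNIV continuous_intros)
  have "(\<lambda>(s, t). indicator A (t + s) :: ennreal) \<in> borel_measurable (borel \<Otimes>\<^sub>M borel)"
  proof -
    have swap: "(\<lambda>z. (snd z, fst z)) \<in> borel \<Otimes>\<^sub>M borel \<rightarrow>\<^sub>M (borel \<Otimes>\<^sub>M borel :: ('g \<times> 'g) measure)"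
      by measurable
    have "(\<lambda>z. indicator A (fst z + snd z) :: ennreal) \<in> borel_measurable (borel \<Otimes>\<^sub>M borel)"
      by (rule measurable_compose[OF plus borel_measurable_indicator[OF A]])
    from measurable_compose[OF swap this] show ?thesis by (simp add: case_prod_beta')
  qed
  then have meas: "(\<lambda>(s, t). indicator A (t + s) :: ennreal) \<in> borel_measurable (m \<Otimes>\<^sub>M ?m')"
    by (simp cong: measurable_cong_sets)
  have left: "(\<integral>\<^sup>+s. indicator A (t + s) \<partial>m) = emeasure m A" for t
  proof -
    have "(\<integral>\<^sup>+s. indicator A (t + s) \<partial>m) = (\<integral>\<^sup>+s. indicator ((\<lambda>s. - t + s) ` A) s \<partial>m)"
      by (intro nn_integral_cong) (simp add: image_translate indicator_def)
    also have "\<dots> = emeasure m A"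
      using borel_image_translate(1)[OF Ab] left_invariant[OF Ab] by simp
    finally show ?thesis .
  qed
  have right: "(\<integral>\<^sup>+t. indicator A (t + s) \<partial>?m') = emeasure m (uminus ` A)" for s
  proof -
    have [measurable]: "A \<in> sets borel" by (rule Ab)
    have "(\<integral>\<^sup>+t. indicator A (t + s) \<partial>?m') = (\<integral>\<^sup>+t. indicator A (- t + s) \<partial>m)"
      using um by (subst nn_integral_distr) auto
    also have "\<dots> = (\<integral>\<^sup>+t. indicator ((\<lambda>u. s + u) ` uminus ` A) t \<partial>m)"
    proof (intro nn_integral_cong)
      fix t
      have "- t + s \<in> A \<longleftrightarrow> t \<in> (\<lambda>u. s + u) ` uminus ` A"
        unfolding image_translate by (simp add: minus_add)
      then show "indicator A (- t + s) = (indicator ((\<lambda>u. s + u) ` uminus ` A) t :: ennreal)"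
        by (simp add: indicator_def)
    qed
    also have "\<dots> = emeasure m (uminus ` A)"
      using borel_image_translate(1)[OF borel_image_translate(3)[OF Ab]] left_invariant[OF borel_image_translate(3)[OF Ab]]
      by simp
    finally show ?thesis .
  qed
  have "(\<integral>\<^sup>+t. (\<integral>\<^sup>+s. indicator A (t + s) \<partial>m) \<partial>?m') = (\<integral>\<^sup>+s. (\<integral>\<^sup>+t. indicator A (t + s) \<partial>?m') \<partial>m)"
    by (rule P.Fubini'[OF meas])
  then show ?thesis
    unfolding left right using m'[of UNIV] by (simp add: image_translate)
qed

text \<open>For open sets the inequality \<open>m U \<le> m (- U)\<close> follows from the Baire sets inside \<open>U\<close>, and the opposite one
  by exchanging \<open>U\<close> and \<open>- U\<close>. Outer regularity extends it to Borel sets.\<close>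

lemma emeasure_uminus:
  assumes A: "A \<in> sets borel"
  shows "emeasure m (uminus ` A) = emeasure m A"
proof -
  have invol: "uminus ` uminus ` B = B" for B :: "'g set" by (simp add: image_image)
  have open_uminus: "open (uminus ` U)" if "open U" for U :: "'g set"
    unfolding image_translate using that by (intro open_vimage continuous_intros) auto
  have le: "emeasure m U \<le> emeasure m (uminus ` U)" if U: "open U" for U
  proof -
    obtain B where B: "B \<in> sets baire" "B \<subseteq> U" "emeasure m B = emeasure m U"
      using baire_inside_open[OF U] by blast
    have "emeasure m U = emeasure m (uminus ` B)" using emeasure_uminus_baire[OF B(1)] B(3) by simp
    also have "\<dots> \<le> emeasure m (uminus ` U)"
      using B(2) open_uminus[OF U] by (intro emeasure_mono) auto
    finally show ?thesis .
  qed
  have eq_open: "emeasure m (uminus ` U) = emeasure m U" if "open U" for U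
    using le[OF that] le[OF open_uminus[OF that]] by (simp add: invol)
  have le_borel: "emeasure m (uminus ` B) \<le> emeasure m B" if B: "B \<in> sets borel" for B
    unfolding outer[OF B]
  proof (rule INF_greatest)
    fix U assume "U \<in> {U. open U \<and> B \<subseteq> U}"
    then have U: "open U" "B \<subseteq> U" by auto
    have "emeasure m (uminus ` B) \<le> emeasure m (uminus ` U)"
      using U open_uminus by (intro emeasure_mono) auto
    then show "emeasure m (uminus ` B) \<le> emeasure m U" by (simp add: eq_open U)
  qed
  show ?thesis
    using le_borel[OF A] le_borel[OF borel_image_translate(3)[OF A]] by (simp add: invol)
qed

text \<open>A compact group is unimodular: right translation is left translation conjugated by inversion.\<close>

lemma emeasure_right_translate:
  assumes A: "A \<in> sets borel"
  shows "emeasure m ((\<lambda>s. s + t) ` A) = emeasure m A"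
proof -
  have "(\<lambda>s. s + t) ` A = uminus ` (\<lambda>s. - t + s) ` uminus ` A"
    by (simp add: image_image minus_add)
  then show ?thesis
    using A by (simp add: emeasure_uminus left_invariant borel_image_translate)
qed

definition preserves :: "('g \<Rightarrow> 'g) \<Rightarrow> bool" where
  "preserves T \<longleftrightarrow> T \<in> borel \<rightarrow>\<^sub>M borel \<and> distr m borel T = m"

lemma preservesI:
  assumes "T \<in> borel \<rightarrow>\<^sub>M borel" "\<And>A. A \<in> sets borel \<Longrightarrow> emeasure m (T -` A) = emeasure m A"
  shows "preserves T"
  unfolding preserves_def using assms by (auto intro!: measure_eqI simp: emeasure_distr)

lemma preserves_translate: "preserves (\<lambda>s. t + s)" "preserves (\<lambda>s. s + t)" "preserves uminus"
proof -
  show "preserves (\<lambda>s. t + s)"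
    using left_invariant[of _ "- t"] by (intro preservesI) (simp_all add: image_translate)
  show "preserves (\<lambda>s. s + t)"
    using emeasure_right_translate[of _ "- t"] unfolding image_translate minus_minus
    by (intro preservesI) simp_all
  show "preserves uminus"
    using emeasure_uminus by (intro preservesI) (simp_all add: image_translate)
qed

lemma preserves_comp: "preserves S \<Longrightarrow> preserves T \<Longrightarrow> preserves (\<lambda>s. S (T s))"
  unfolding preserves_def using distr_distr[of S borel borel T m] by (auto simp: comp_def)

lemma preserves_diff: "preserves (\<lambda>s. t - s)" "preserves (\<lambda>s. s - t)"
  using preserves_comp[OF preserves_translate(1) preserves_translate(3)] preserves_translate(2)[of "- t"]
  by simp_all

lemma integral_preserves:
  fixes f :: "'g \<Rightarrow> 'b::{banach, second_countable_topology}"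
  assumes "preserves T" "f \<in> borel_measurable borel"
  shows "(\<integral>s. f (T s) \<partial>m) = (\<integral>s. f s \<partial>m)"
  using integral_distr[of T m borel f] assms by (simp add: preserves_def)

lemma nn_integral_preserves:
  assumes "preserves T" "f \<in> borel_measurable borel"
  shows "(\<integral>\<^sup>+s. f (T s) \<partial>m) = (\<integral>\<^sup>+s. f s \<partial>m)"
  using nn_integral_distr[of T m borel f] assms by (simp add: preserves_def)

lemma AE_preserves:
  assumes "preserves T" "AE s in m. P s"
  shows "AE s in m. P (T s)"
proof -
  have T: "T \<in> m \<rightarrow>\<^sub>M borel" and distr: "distr m borel T = m"
    using assms(1) by (simp_all add: preserves_def)
  show ?thesis by (rule AE_distrD[OF T]) (unfold distr, rule assms(2))
qed

text \<open>The integrand is first replaced by one that is measurable on the product space: a Baire function \<open>f'\<close> with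
  \<open>f = f'\<close> almost everywhere gives the same convolution at every single point \<open>t\<close>. In particular the
  convolution is a measurable function, even where its defining integral diverges and it takes
  the default value 0.\<close>

lemma integral_convolution:
  assumes f: "integrable m f" and k: "integrable m k"
    and w[measurable]: "w \<in> borel_measurable borel" and b: "\<And>t. cmod (w t) \<le> b"
  shows "(\<integral>t. convolution m f k t * w t \<partial>m) = (\<integral>s. k s * (\<integral>u. f u * w (u + s) \<partial>m) \<partial>m)"
proof -
  have fm[measurable]: "f \<in> borel_measurable borel" and km[measurable]: "k \<in> borel_measurable borel"
    using borel_measurable_integrable[OF f] borel_measurable_integrable[OF k] by simp_all
  obtain f' where f': "f' \<in> borel_measurable baire" and ff': "AE x in m. f x = f' x"
    using baire_approx_fun[OF fm] by blast
  have f'm[measurable]: "f' \<in> borel_measurable borel" using measurable_compose[OF borel_baire f'] .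
  have conv: "convolution m f k t = (\<integral>s. f' (t - s) * k s \<partial>m)" for t
    unfolding convolution_def
  proof (rule integral_cong_AE)
    have [measurable]: "(\<lambda>s. t - s) \<in> borel \<rightarrow>\<^sub>M borel" using preserves_diff(1) by (simp add: preserves_def)
    show "(\<lambda>s. f (t - s) * k s) \<in> borel_measurable m" by simp
    show "(\<lambda>s. f' (t - s) * k s) \<in> borel_measurable m" by simp
    show "AE s in m. f (t - s) * k s = f' (t - s) * k s"
      using AE_preserves[OF preserves_diff(1) ff', of t] by eventually_elim simp
  qed
  define F where "F = (\<lambda>(s, t). f' (t - s) * k s * w t)"
  have "(\<lambda>z. snd z - fst z) \<in> borel \<Otimes>\<^sub>M borel \<rightarrow>\<^sub>M (baire :: 'g measure)"
    by (intro continuous_into_baire compact_UNIV) (simp only: diff_conv_add_uminus, intro continuous_intros)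
  from measurable_compose[OF this f']
  have [measurable]: "(\<lambda>z. f' (snd z - fst z)) \<in> borel_measurable (borel \<Otimes>\<^sub>M borel)" .
  have "F \<in> borel_measurable (borel \<Otimes>\<^sub>M borel)" unfolding F_def case_prod_beta' by measurable
  then have Fm[measurable]: "F \<in> borel_measurable (m \<Otimes>\<^sub>M m)" by (simp cong: measurable_cong_sets)
  interpret P: pair_sigma_finite m m ..
  have b0: "0 \<le> b" using b[of 0] norm_ge_zero order_trans by blast
  have "integrable m f'" using f ff' fm f'm by (subst (asm) integrable_cong_AE[of f m f']) auto
  then obtain c where c: "(\<integral>\<^sup>+t. ennreal (cmod (f' t)) \<partial>m) = ennreal c" "0 \<le> c"
    unfolding integrable_iff_bounded by (cases "\<integral>\<^sup>+t. ennreal (cmod (f' t)) \<partial>m") auto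
  have inner: "(\<integral>\<^sup>+t. ennreal (cmod (F (s, t))) \<partial>m) \<le> ennreal (b * c) * ennreal (cmod (k s))" for s
  proof -
    have [measurable]: "(\<lambda>t. t - s) \<in> borel \<rightarrow>\<^sub>M borel" using preserves_diff(2) by (simp add: preserves_def)
    have "(\<integral>\<^sup>+t. ennreal (cmod (F (s, t))) \<partial>m) \<le> (\<integral>\<^sup>+t. ennreal (b * cmod (k s)) * ennreal (cmod (f' (t - s))) \<partial>m)"
    proof (intro nn_integral_mono)
      fix t
      have "cmod (F (s, t)) \<le> cmod (f' (t - s)) * cmod (k s) * b"
        unfolding F_def by (simp add: norm_mult mult_left_mono b)
      then show "ennreal (cmod (F (s, t))) \<le> ennreal (b * cmod (k s)) * ennreal (cmod (f' (t - s)))"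
        using b0 by (subst ennreal_mult[symmetric]) (auto intro!: ennreal_leI simp: mult_ac)
    qed
    also have "\<dots> = ennreal (b * cmod (k s)) * (\<integral>\<^sup>+t. ennreal (cmod (f' (t - s))) \<partial>m)"
      by (intro nn_integral_cmult) simp
    also have "(\<integral>\<^sup>+t. ennreal (cmod (f' (t - s))) \<partial>m) = ennreal c"
      using nn_integral_preserves[OF preserves_diff(2), of "\<lambda>t. ennreal (cmod (f' t))" s] c(1) by simp
    also have "ennreal (b * cmod (k s)) * ennreal c = ennreal (b * c) * ennreal (cmod (k s))"
      using b0 c(2) by (simp add: ennreal_mult[symmetric] mult_ac)
    finally show ?thesis .
  qed
  have "integrable (m \<Otimes>\<^sub>M m) F"
  proof (rule integrableI_bounded)
    have "(\<integral>\<^sup>+z. ennreal (cmod (F z)) \<partial>(m \<Otimes>\<^sub>M m)) = (\<integral>\<^sup>+s. (\<integral>\<^sup>+t. ennreal (cmod (F (s, t))) \<partial>m) \<partial>m)"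
      by (subst nn_integral_fst[symmetric]) auto
    also have "\<dots> \<le> (\<integral>\<^sup>+s. ennreal (b * c) * ennreal (cmod (k s)) \<partial>m)"
      by (intro nn_integral_mono inner)
    also have "\<dots> = ennreal (b * c) * (\<integral>\<^sup>+s. ennreal (cmod (k s)) \<partial>m)"
      by (intro nn_integral_cmult) simp
    also have "\<dots> < \<infinity>"
      using k unfolding integrable_iff_bounded by (simp add: ennreal_mult_less_top)
    finally show "(\<integral>\<^sup>+z. ennreal (cmod (F z)) \<partial>(m \<Otimes>\<^sub>M m)) < \<infinity>" .
  qed simp
  then have "integrable (m \<Otimes>\<^sub>M m) (\<lambda>(s, t). f' (t - s) * k s * w t)" by (simp add: F_def)
  from P.Fubini_integral[OF this]
  have "(\<integral>t. (\<integral>s. f' (t - s) * k s * w t \<partial>m) \<partial>m) = (\<integral>s. (\<integral>t. f' (t - s) * k s * w t \<partial>m) \<partial>m)" .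
  moreover have "(\<integral>s. f' (t - s) * k s * w t \<partial>m) = convolution m f k t * w t" for t
    unfolding conv by simp
  moreover have "(\<integral>t. f' (t - s) * k s * w t \<partial>m) = k s * (\<integral>u. f u * w (u + s) \<partial>m)" for s
  proof -
    have [measurable]: "(\<lambda>t. t - s) \<in> borel \<rightarrow>\<^sub>M borel" using preserves_diff(2) by (simp add: preserves_def)
    have "(\<integral>t. f' (t - s) * k s * w t \<partial>m) = k s * (\<integral>t. f' (t - s) * w t \<partial>m)"
      by (subst integral_mult_right_zero[symmetric]) (simp add: mult_ac)
    also have "(\<integral>t. f' (t - s) * w t \<partial>m) = (\<integral>u. f' (u + s - s) * w (u + s) \<partial>m)"
      by (rule integral_preserves[OF preserves_translate(2), symmetric]) simp
    also have "\<dots> = (\<integral>u. f u * w (u + s) \<partial>m)"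
      using ff' by (intro integral_cong_AE) (auto elim: eventually_mono)
    finally show ?thesis .
  qed
  ultimately show ?thesis by (simp only:)
qed

end

section \<open>Integrability with respect to Haar measure\<close>

lemma semivariation_ge:
  assumes "x' \<in> dual_ball"
  shows "ennreal (cmod (x' (\<mu> UNIV))) \<le> semivariation \<mu>"
proof -
  have "ennreal (cmod (x' (\<mu> UNIV))) \<le> variation (scalar_measure \<mu> x') UNIV"
    unfolding variation_def scalar_measure_def
    by (rule SUP_upper2[of "{UNIV}"]) (auto simp: disjoint_def)
  also have "\<dots> \<le> semivariation \<mu>"
    unfolding semivariation_def using assms by (rule SUP_upper)
  finally show ?thesis .
qed

locale haar_vector_measure = compact_haar m + finite_borel_vector_measure m \<nu>
  for m :: "'g::{topological_group_add, t2_space} measure"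
    and \<nu> :: "'g set \<Rightarrow> 'x::{complex_normed_space, complete_space}"
begin

lemma M_ac_right_translate: "right_translate t \<nu> \<in> M_ac m"
proof -
  have "vector_measure (right_translate t \<nu>)"
    unfolding vector_measure_def right_translate_def
  proof (intro allI impI)
    fix A :: "nat \<Rightarrow> 'g set" assume A: "range A \<subseteq> sets borel" "disjoint_family A"
    have "disjoint_family (\<lambda>n. (\<lambda>s. s + t) ` A n)"
      unfolding disjoint_family_on_def
    proof (intro ballI impI)
      fix k n :: nat assume "k \<noteq> n"
      then have "A k \<inter> A n = {}" using disjoint_family_onD[OF A(2), of k n] by simp
      moreover have "inj (\<lambda>s. s + t)" by (rule injI) simp
      ultimately show "(\<lambda>s. s + t) ` A k \<inter> (\<lambda>s. s + t) ` A n = {}"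
        by (simp add: image_Int[symmetric])
    qed
    then have "(\<lambda>n. \<nu> ((\<lambda>s. s + t) ` A n)) sums \<nu> (\<Union>n. (\<lambda>s. s + t) ` A n)"
      using A borel_image_translate(2)
      by (intro vector_measureD[OF M_ac_vector_measure[OF M_ac]]) auto
    then show "(\<lambda>n. \<nu> ((\<lambda>s. s + t) ` A n)) sums \<nu> ((\<lambda>s. s + t) ` (\<Union>n. A n))"
      by (simp only: image_UN)
  qed
  moreover have "\<exists>\<delta>>0. \<forall>A\<in>sets borel. measure m A < \<delta> \<longrightarrow> norm (right_translate t \<nu> A) < \<epsilon>" if "0 < \<epsilon>" for \<epsilon>
  proof -
    obtain \<delta> where \<delta>: "0 < \<delta>" "\<And>A. A \<in> sets borel \<Longrightarrow> measure m A < \<delta> \<Longrightarrow> norm (\<nu> A) < \<epsilon>"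
      using M_ac \<open>0 < \<epsilon>\<close> unfolding M_ac_def by blast
    have "norm (right_translate t \<nu> A) < \<epsilon>" if "A \<in> sets borel" "measure m A < \<delta>" for A
      unfolding right_translate_def
      using that emeasure_right_translate[OF that(1), of t] borel_image_translate(2)[OF that(1)]
      by (intro \<delta>(2)) (simp_all add: measure_def)
    then show ?thesis using \<delta>(1) by blast
  qed
  ultimately show ?thesis unfolding M_ac_def by blast
qed

text \<open>Translating \<open>\<nu>\<close> amounts to translating the integrand in the opposite direction, while the density \<open>h x'\<close>
  stays that of \<open>\<nu>\<close>.\<close>

lemma dual_integral_right_translate:
  assumes \<phi>: "simple_function borel \<phi>" and x': "x' \<in> dual"
  shows "x' (vector_integral (right_translate t \<nu>) UNIV \<phi>) = (\<integral>s. \<phi> (s - t) * h x' s \<partial>m)"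
proof -
  interpret T: finite_borel_vector_measure m "right_translate t \<nu>"
    by unfold_locales (rule M_ac_right_translate)
  have L: "\<phi> -` {c} \<in> sets borel" for c using simple_functionD(2)[OF \<phi>, of "{c}"] by simp
  have fin: "finite (range \<phi>)" using simple_functionD(1)[OF \<phi>] by simp
  define N where "N c = (\<lambda>s. s + t) ` (\<phi> -` {c})" for c
  have N: "N c \<in> sets borel" for c unfolding N_def by (rule borel_image_translate(2)[OF L])
  have mem: "s \<in> N c \<longleftrightarrow> \<phi> (s - t) = c" for s c unfolding N_def image_translate by simp
  have "x' (vector_integral (right_translate t \<nu>) UNIV \<phi>) = (\<Sum>c\<in>range \<phi>. c * (LINT s:N c|m. h x' s))"
    using has_density_eq[OF has_density_h[OF x'] N]
    by (simp add: T.vector_integral_simple[OF \<phi>] dual_sum[OF x'] dual_scaleC[OF x']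
        right_translate_def scalar_measure_def N_def)
  also have "\<dots> = (\<integral>s. (\<Sum>c\<in>range \<phi>. c * (indicator (N c) s *\<^sub>R h x' s)) \<partial>m)"
    unfolding set_lebesgue_integral_def
    by (subst Bochner_Integration.integral_sum)
       (intro integrable_mult_right integrable_on_borel integrable_h x' N, simp only: integral_mult_right_zero)
  also have "\<dots> = (\<integral>s. \<phi> (s - t) * h x' s \<partial>m)"
  proof (intro Bochner_Integration.integral_cong refl)
    fix s
    have "(\<Sum>c\<in>range \<phi>. c * (indicator (N c) s *\<^sub>R h x' s))
        = (\<Sum>c\<in>range \<phi>. if \<phi> (s - t) = c then c * h x' s else 0)"
      by (intro sum.cong refl) (simp add: mem indicator_def)
    then show "(\<Sum>c\<in>range \<phi>. c * (indicator (N c) s *\<^sub>R h x' s)) = \<phi> (s - t) * h x' s"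
      using fin by simp
  qed
  finally show ?thesis .
qed

text \<open>By \<open>dual_integral_right_translate\<close> the function \<open>t \<mapsto> x' (\<integral> \<phi> d\<nu>\<^sub>t)\<close> is the convolution of the reflected
  \<open>\<phi>\<close> with \<open>h x'\<close>. Translation invariance bounds all its values by \<open>C\<close>, whereas its mean
  over the group is \<open>(\<integral> \<phi>) x' (\<nu> G)\<close>.\<close>

lemma integral_simple_le:
  assumes inv: "semivariation_translation_invariant \<nu>"
    and \<phi>: "simple_function borel (\<phi> :: 'g \<Rightarrow> complex)" and x': "x' \<in> dual_ball"
    and C: "semivariation (\<lambda>A. vector_integral \<nu> A \<phi>) \<le> ennreal C" "0 \<le> C"
  shows "cmod (\<integral>s. \<phi> s \<partial>m) * cmod (x' (\<nu> UNIV)) \<le> C"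
proof -
  note d = dual_ball_dual[OF x']
  have [measurable]: "\<phi> \<in> borel_measurable borel" by (rule borel_measurable_simple_function[OF \<phi>])
  obtain b where b: "\<And>t. cmod (\<phi> t) \<le> b" using simple_function_bounded[OF \<phi>] by blast
  have um: "(\<lambda>s::'g. - s) \<in> borel \<rightarrow>\<^sub>M borel" by (rule measurable_translate(3))
  have r: "integrable m (reflect \<phi>)"
    unfolding reflect_def
    using integrable_const_bound[of "\<lambda>t. \<phi> (- t)" b] b by simp
  \<comment> \<open>The left side is the value at \<open>x'\<close> of the integral of \<open>\<phi>\<close> against a translate of \<open>\<nu>\<close>.\<close>
  have bound: "cmod (convolution m (reflect \<phi>) (h x') t) \<le> C" for t
  proof -
    have "convolution m (reflect \<phi>) (h x') t = x' (vector_integral (right_translate t \<nu>) UNIV \<phi>)"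
      unfolding dual_integral_right_translate[OF \<phi> d] by (simp add: convolution_def reflect_def)
    then have "ennreal (cmod (convolution m (reflect \<phi>) (h x') t))
        \<le> semivariation (\<lambda>A. vector_integral (right_translate t \<nu>) A \<phi>)"
      using semivariation_ge[OF x', of "\<lambda>A. vector_integral (right_translate t \<nu>) A \<phi>"] by simp
    also have "\<dots> \<le> ennreal C"
      using inv \<phi> C(1) unfolding semivariation_translation_invariant_def by simp
    finally show ?thesis using C(2) by simp
  qed
  have "(\<integral>t. convolution m (reflect \<phi>) (h x') t * 1 \<partial>m) = (\<integral>s. h x' s * (\<integral>u. reflect \<phi> u * 1 \<partial>m) \<partial>m)"
    by (rule integral_convolution[OF r integrable_h[OF d], of "\<lambda>_. 1" 1]) auto
  also have "(\<integral>u. reflect \<phi> u * 1 \<partial>m) = (\<integral>s. \<phi> s \<partial>m)"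
    using integral_preserves[OF preserves_translate(3), of \<phi>] by (simp add: reflect_def)
  also have "(\<integral>s. h x' s * (\<integral>s. \<phi> s \<partial>m) \<partial>m) = x' (\<nu> UNIV) * (\<integral>s. \<phi> s \<partial>m)"
    using has_density_eq[OF has_density_h[OF d], of UNIV]
    by (simp add: scalar_measure_def set_lebesgue_integral_def)
  finally have eq: "(\<integral>t. convolution m (reflect \<phi>) (h x') t \<partial>m) = x' (\<nu> UNIV) * (\<integral>s. \<phi> s \<partial>m)" by simp
  have "cmod (\<integral>t. convolution m (reflect \<phi>) (h x') t \<partial>m) \<le> C"
  \<comment> \<open>If the convolution were not integrable, its integral would be 0 by convention.\<close>
  proof (cases "integrable m (convolution m (reflect \<phi>) (h x'))")
    case True
    then have "cmod (\<integral>t. convolution m (reflect \<phi>) (h x') t \<partial>m) \<le> (\<integral>t. C \<partial>m)"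
      using bound by (intro norm_integral_le_integral) auto
    then show ?thesis by (simp add: measure_def)
  qed (simp add: not_integrable_integral_eq C(2))
  then show ?thesis unfolding eq by (simp add: norm_mult mult.commute)
qed

text \<open>Simple functions below \<open>\<bar>f\<bar>\<close> have integrals at most \<open>C / \<bar>x0 (\<nu> G)\<bar>\<close>, where \<open>C\<close> bounds the weak
  integrals of \<open>f\<close> and \<open>x0\<close> is a functional in the dual ball that does not vanish at \<open>\<nu> G\<close>.\<close>

lemma L1_vm_imp_integrable:
  assumes inv: "semivariation_translation_invariant \<nu>" and nz: "\<nu> UNIV \<noteq> 0" and f: "f \<in> L1_vm \<nu>"
  shows "integrable m f"
proof (rule integrableI_bounded)
  have [measurable]: "f \<in> borel_measurable borel" by (rule L1_vm_measurable[OF f])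
  then show "f \<in> borel_measurable m" by simp
  obtain x0 where x0: "x0 \<in> dual_ball" "norm (\<nu> UNIV) \<le> cmod (x0 (\<nu> UNIV))" by (rule dual_ball_norming)
  define a where "a = cmod (x0 (\<nu> UNIV))"
  have "0 < norm (\<nu> UNIV)" using nz by simp
  then have a: "0 < a" using x0(2) unfolding a_def by linarith
  obtain C where C: "0 \<le> C" "\<And>x'. x' \<in> dual_ball \<Longrightarrow> (\<integral>t. cmod (f t * h x' t) \<partial>m) \<le> C"
    using weak_integrals_bounded[OF f] by blast
  have "(\<integral>\<^sup>+t. ennreal (cmod (f t)) \<partial>m) \<le> ennreal (C / a)"
    unfolding nn_integral_def
  proof (rule SUP_least)
    fix g assume "g \<in> {g. simple_function m g \<and> g \<le> (\<lambda>t. ennreal (cmod (f t)))}"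
    then have g: "simple_function m g" "\<And>t. g t \<le> ennreal (cmod (f t))" by (auto simp: le_fun_def)
    have g_fin: "g t < \<infinity>" for t using g(2)[of t] by (simp add: le_less_trans)
    define \<phi> where "\<phi> t = complex_of_real (enn2real (g t))" for t
    have \<phi>m: "simple_function m \<phi>" unfolding \<phi>_def using g(1) by (rule simple_function_compose1)
    then have \<phi>: "simple_function borel \<phi>" by (simp add: simple_function_def)
    have \<phi>_le: "cmod (\<phi> t) \<le> cmod (f t)" for t
      unfolding \<phi>_def using enn2real_mono[OF g(2)[of t]] by simp
    have "semivariation (\<lambda>A. vector_integral \<nu> A \<phi>) \<le> ennreal C"
      unfolding semivariation_vector_integral[OF simple_L1_vm[OF \<phi>]]
    proof (rule SUP_least)
      fix x' :: "'x \<Rightarrow> complex" assume x': "x' \<in> dual_ball"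
      have "(\<integral>\<^sup>+t. ennreal (cmod (\<phi> t * h x' t)) \<partial>m) \<le> (\<integral>\<^sup>+t. ennreal (cmod (f t * h x' t)) \<partial>m)"
        by (intro nn_integral_mono ennreal_leI) (simp add: norm_mult mult_right_mono \<phi>_le)
      also have "\<dots> = ennreal (\<integral>t. cmod (f t * h x' t) \<partial>m)"
        using L1_vm_integrable[OF f dual_ball_dual[OF x']] by (intro nn_integral_eq_integral) auto
      also have "\<dots> \<le> ennreal C" by (intro ennreal_leI C(2) x')
      finally show "(\<integral>\<^sup>+t. ennreal (cmod (\<phi> t * h x' t)) \<partial>m) \<le> ennreal C" .
    qed
    then have le: "cmod (\<integral>s. \<phi> s \<partial>m) * a \<le> C"
      unfolding a_def by (rule integral_simple_le[OF inv \<phi> x0(1) _ C(1)])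
    obtain b where "\<And>t. cmod (\<phi> t) \<le> b" using simple_function_bounded[OF \<phi>] by blast
    then have "integrable m \<phi>"
      using borel_measurable_simple_function[OF \<phi>] by (intro integrable_const_bound[of _ b]) auto
    then have ir: "integrable m (\<lambda>t. enn2real (g t))"
      unfolding \<phi>_def by (simp add: complex_of_real_integrable_eq)
    have "integral\<^sup>S m g = (\<integral>\<^sup>+t. g t \<partial>m)" by (rule nn_integral_eq_simple_integral[OF g(1), symmetric])
    also have "\<dots> = (\<integral>\<^sup>+t. ennreal (enn2real (g t)) \<partial>m)"
      using g_fin by (intro nn_integral_cong) (simp add: less_top)
    also have "\<dots> = ennreal (\<integral>t. enn2real (g t) \<partial>m)"
      using ir by (intro nn_integral_eq_integral) auto
    also have "\<dots> \<le> ennreal (C / a)"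
    proof (rule ennreal_leI)
      have "cmod (\<integral>s. \<phi> s \<partial>m) = \<bar>\<integral>t. enn2real (g t) \<partial>m\<bar>" by (simp add: \<phi>_def)
      then show "(\<integral>t. enn2real (g t) \<partial>m) \<le> C / a"
        using le a abs_ge_self[of "\<integral>t. enn2real (g t) \<partial>m"] by (simp add: pos_le_divide_eq mult_right_mono order_trans[OF mult_right_mono])
    qed
    finally show "integral\<^sup>S m g \<le> ennreal (C / a)" .
  qed
  then show "(\<integral>\<^sup>+t. ennreal (norm (f t)) \<partial>m) < \<infinity>" by (rule le_less_trans) simp
qed

end

section \<open>Matrix coefficients of unitary representations\<close>

lemma cinner_zero_left: "cinner 0 w = 0"
  using cinner_add_left[of 0 0 w] by simp

lemma cinner_sum_left: "cinner (\<Sum>i\<in>I. F i) w = (\<Sum>i\<in>I. cinner (F i) w)"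
  by (induction I rule: infinite_finite_induct) (auto simp: cinner_zero_left cinner_add_left)

text \<open>Expresses the inner product through norms, which yields its continuity without the Cauchy-Schwarz inequality.\<close>

lemma polarization:
  "cinner v w = Complex (((norm (v + w))\<^sup>2 - (norm v)\<^sup>2 - (norm w)\<^sup>2) / 2)
     (((norm (v + \<i> *\<^sub>C w))\<^sup>2 - (norm v)\<^sup>2 - (norm (\<i> *\<^sub>C w))\<^sup>2) / 2)"
proof -
  have Re: "Re (cinner x y) = ((norm (x + y))\<^sup>2 - (norm x)\<^sup>2 - (norm y)\<^sup>2) / 2" for x y :: 'a
  proof -
    have "cinner z (x + y) = cinner z x + cinner z y" for z
      using cinner_commute[of z "x + y"] cinner_commute[of z x] cinner_commute[of z y]
      by (simp add: cinner_add_left)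
    then have "cinner (x + y) (x + y) = cinner x x + cinner x y + cinner y x + cinner y y"
      by (simp add: cinner_add_left)
    then have "(norm (x + y))\<^sup>2 = (norm x)\<^sup>2 + Re (cinner x y) + Re (cinner y x) + (norm y)\<^sup>2"
      unfolding cinner_self by (metis Re_complex_of_real plus_complex.sel(1))
    moreover have "Re (cinner y x) = Re (cinner x y)"
      using cinner_commute[of y x] by simp
    ultimately show ?thesis by simp
  qed
  have "cinner v (\<i> *\<^sub>C w) = - \<i> * cinner v w"
    using cinner_commute[of v "\<i> *\<^sub>C w"] cinner_commute[of v w] by (simp add: cinner_scaleC_left)
  then have "Im (cinner v w) = Re (cinner v (\<i> *\<^sub>C w))" by simp
  then show ?thesis unfolding Re by (simp add: complex_eq_iff Re)
qed

lemma continuous_on_cinner_left: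
  assumes "continuous_on S (\<lambda>t. v t)"
  shows "continuous_on S (\<lambda>t. cinner (v t) w)"
  unfolding polarization[of "v _" w] using assms by (intro continuous_intros) auto

lemma orthonormal_expansion:
  assumes "rep_basis \<pi> e"
  shows "v = (\<Sum>k<rep_dim \<pi>. cinner v (e k) *\<^sub>C e k)"
proof -
  let ?P = "\<lambda>v. (\<Sum>k<rep_dim \<pi>. cinner v (e k) *\<^sub>C e k)"
  have "v \<in> complex_vector.span (e ` {..<rep_dim \<pi>})" using assms by (simp add: rep_basis_def)
  then have "v = ?P v"
  proof (rule complex_vector.span_induct)
    show "complex_vector.subspace {v. v = ?P v}"
      unfolding complex_vector.subspace_def
    proof (intro conjI ballI allI)
      fix x y assume "x \<in> {v. v = ?P v}" "y \<in> {v. v = ?P v}"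
      then have "x + y = ?P x + ?P y" by simp
      also have "\<dots> = ?P (x + y)" by (simp add: cinner_add_left scaleC_add_left sum.distrib)
      finally show "x + y \<in> {v. v = ?P v}" by simp
    next
      fix c x assume "x \<in> {v. v = ?P v}"
      then have "c *\<^sub>C x = c *\<^sub>C ?P x" by simp
      also have "\<dots> = ?P (c *\<^sub>C x)"
        by (simp add: complex_vector.scale_sum_right cinner_scaleC_left scaleC_scaleC)
      finally show "c *\<^sub>C x \<in> {v. v = ?P v}" by simp
    qed (simp add: cinner_zero_left)
  next
    fix x assume "x \<in> e ` {..<rep_dim \<pi>}"
    then obtain j where j: "j < rep_dim \<pi>" "x = e j" by blast
    have "?P (e j) = (\<Sum>k<rep_dim \<pi>. if j = k then e k else 0)"
      using assms j by (intro sum.cong) (auto simp: rep_basis_def scaleC_one)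
    then show "x = ?P x" using j by simp
  qed
  then show ?thesis .
qed

lemma rep_coeff_plus:
  assumes \<pi>: "unitary_rep \<pi>" and e: "rep_basis \<pi> e"
  shows "rep_coeff \<pi> e i j (s + t) = (\<Sum>k<rep_dim \<pi>. rep_coeff \<pi> e i k s * rep_coeff \<pi> e k j t)"
proof -
  interpret additive "\<pi> s"
    using \<pi> by unfold_locales (simp add: unitary_rep_def unitary_operator_def)
  have scale: "\<pi> s (c *\<^sub>C v) = c *\<^sub>C \<pi> s v" for c v
    using \<pi> by (simp add: unitary_rep_def unitary_operator_def)
  have "\<pi> (s + t) (e j) = \<pi> s (\<pi> t (e j))" using \<pi> by (simp add: unitary_rep_def)
  also have "\<pi> t (e j) = (\<Sum>k<rep_dim \<pi>. rep_coeff \<pi> e k j t *\<^sub>C e k)"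
    using orthonormal_expansion[OF e, of "\<pi> t (e j)"] by (simp add: rep_coeff_def)
  finally show ?thesis
    by (simp add: rep_coeff_def[of _ _ i] sum scale cinner_sum_left cinner_scaleC_left mult.commute)
qed

lemma continuous_rep_coeff:
  assumes "unitary_rep \<pi>"
  shows "continuous_on UNIV (rep_coeff \<pi> e i j)"
  unfolding rep_coeff_def[abs_def]
  using assms by (intro continuous_on_cinner_left) (simp add: unitary_rep_def)

lemma continuous_bounded:
  fixes w :: "'g::topological_space \<Rightarrow> complex"
  assumes "compact (UNIV :: 'g set)" "continuous_on UNIV w"
  obtains b where "\<And>t. cmod (w t) \<le> b"
  using compact_imp_bounded[OF compact_continuous_image[OF assms(2,1)]] by (auto simp: bounded_iff)

section \<open>Fourier coefficients of the convolution\<close>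

context compact_haar
begin

lemma integral_times_rep_coeff_plus:
  assumes f: "integrable m f" and \<pi>: "unitary_rep \<pi>" and e: "rep_basis \<pi> e"
  shows "(\<integral>u. f u * cnj (rep_coeff \<pi> e j i (u + s)) \<partial>m)
    = (\<Sum>k<rep_dim \<pi>. (\<integral>u. f u * cnj (rep_coeff \<pi> e j k u) \<partial>m) * cnj (rep_coeff \<pi> e k i s))"
proof -
  have int: "integrable m (\<lambda>u. f u * cnj (rep_coeff \<pi> e j k u))" for k
  proof -
    have c: "continuous_on UNIV (\<lambda>u. cnj (rep_coeff \<pi> e j k u))"
      by (intro continuous_intros continuous_rep_coeff \<pi>)
    obtain b where "\<And>u. cmod (cnj (rep_coeff \<pi> e j k u)) \<le> b"
      using continuous_bounded[OF compact_UNIV c] by blast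
    from integrable_times_bounded[OF f borel_measurable_continuous_onI[OF c] this]
    show ?thesis by (simp add: mult.commute)
  qed
  have "(\<integral>u. f u * cnj (rep_coeff \<pi> e j i (u + s)) \<partial>m)
      = (\<integral>u. (\<Sum>k<rep_dim \<pi>. f u * cnj (rep_coeff \<pi> e j k u) * cnj (rep_coeff \<pi> e k i s)) \<partial>m)"
    by (simp add: rep_coeff_plus[OF \<pi> e] sum_distrib_left mult.assoc)
  also have "\<dots> = (\<Sum>k<rep_dim \<pi>. (\<integral>u. f u * cnj (rep_coeff \<pi> e j k u) \<partial>m) * cnj (rep_coeff \<pi> e k i s))"
    by (subst Bochner_Integration.integral_sum) (intro integrable_mult_left int, simp only: integral_mult_left_zero)
  finally show ?thesis .
qed

lemma convolution_reflect_rep_coeff: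
  assumes f: "integrable m f" and \<pi>: "unitary_rep \<pi>" and e: "rep_basis \<pi> e"
  shows "convolution m (reflect f) (\<lambda>s. cnj (rep_coeff \<pi> e j i s)) t
    = (\<Sum>k<rep_dim \<pi>. (\<integral>u. f u * cnj (rep_coeff \<pi> e j k u) \<partial>m) * cnj (rep_coeff \<pi> e k i t))"
proof -
  have [measurable]: "f \<in> borel_measurable borel" using borel_measurable_integrable[OF f] by simp
  have [measurable]: "(\<lambda>s. s - t) \<in> borel \<rightarrow>\<^sub>M borel" using preserves_diff(2) by (simp add: preserves_def)
  have [measurable]: "(\<lambda>s. cnj (rep_coeff \<pi> e j i s)) \<in> borel_measurable borel"
    by (intro borel_measurable_continuous_onI continuous_intros continuous_rep_coeff \<pi>)
  have "convolution m (reflect f) (\<lambda>s. cnj (rep_coeff \<pi> e j i s)) t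
      = (\<integral>s. f (s - t) * cnj (rep_coeff \<pi> e j i s) \<partial>m)"
    by (simp add: convolution_def reflect_def)
  also have "\<dots> = (\<integral>u. f (u + t - t) * cnj (rep_coeff \<pi> e j i (u + t)) \<partial>m)"
    by (rule integral_preserves[OF preserves_translate(2), symmetric]) simp
  also have "\<dots> = (\<integral>u. f u * cnj (rep_coeff \<pi> e j i (u + t)) \<partial>m)" by simp
  finally show ?thesis by (simp add: integral_times_rep_coeff_plus[OF assms])
qed

end

context haar_vector_measure
begin

lemma L1_vm_times_continuous:
  assumes g: "g \<in> L1_vm \<nu>" and w: "continuous_on UNIV w"
  shows "(\<lambda>t. g t * w t) \<in> L1_vm \<nu>"
proof -
  obtain b where "\<And>t. cmod (w t) \<le> b" using continuous_bounded[OF compact_UNIV w] by blast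
  then show ?thesis by (rule L1_vm_times_bounded[OF g borel_measurable_continuous_onI[OF w]])
qed

lemma dual_vector_integral_times_continuous:
  assumes g: "g \<in> L1_vm \<nu>" and w: "continuous_on UNIV w" and x': "x' \<in> dual"
  shows "x' (vector_integral \<nu> UNIV (\<lambda>t. g t * w t)) = (\<integral>t. g t * h x' t * w t \<partial>m)"
  using dual_vector_integral[OF L1_vm_times_continuous[OF g w] x', of UNIV]
  by (simp add: set_lebesgue_integral_def mult_ac)

lemma dual_sum_rep_coeff:
  assumes g: "g \<in> L1_vm \<nu>" and x': "x' \<in> dual" and \<pi>: "unitary_rep \<pi>"
  shows "x' (vector_integral \<nu> UNIV (\<lambda>t. g t * (\<Sum>k<d. F k * cnj (rep_coeff \<pi> e k i t))))
    = (\<Sum>k<d. F k * x' (vector_integral \<nu> UNIV (\<lambda>t. g t * cnj (rep_coeff \<pi> e k i t))))"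
proof -
  have c: "continuous_on UNIV (\<lambda>t. cnj (rep_coeff \<pi> e k i t))" for k
    by (intro continuous_intros continuous_rep_coeff \<pi>)
  have int: "integrable m (\<lambda>t. g t * h x' t * cnj (rep_coeff \<pi> e k i t))" for k
    using L1_vm_integrable[OF L1_vm_times_continuous[OF g c] x'] by (simp add: mult_ac)
  have "x' (vector_integral \<nu> UNIV (\<lambda>t. g t * (\<Sum>k<d. F k * cnj (rep_coeff \<pi> e k i t))))
      = (\<integral>t. g t * h x' t * (\<Sum>k<d. F k * cnj (rep_coeff \<pi> e k i t)) \<partial>m)"
    by (intro dual_vector_integral_times_continuous g x' continuous_intros c)
  also have "\<dots> = (\<integral>t. (\<Sum>k<d. F k * (g t * h x' t * cnj (rep_coeff \<pi> e k i t))) \<partial>m)"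
    by (simp add: sum_distrib_left mult_ac)
  also have "\<dots> = (\<Sum>k<d. F k * (\<integral>t. g t * h x' t * cnj (rep_coeff \<pi> e k i t) \<partial>m))"
    by (subst Bochner_Integration.integral_sum) (intro integrable_mult_right int, simp only: integral_mult_right_zero)
  finally show ?thesis
    by (simp add: dual_vector_integral_times_continuous[OF g c x'])
qed

text \<open>Up to the normalizing factors, the sum over \<open>k\<close> is the \<open>i\<close>-th row of the transform of \<open>g\<close>, tested
  against \<open>x'\<close>, times the \<open>j\<close>-th column of the transform of \<open>f\<close>: each transform transposes the indices
  of the matrix coefficient.\<close>

lemma integral_vm_convolution:
  assumes f: "integrable m f" and g: "g \<in> L1_vm \<nu>" and x': "x' \<in> dual"
    and \<pi>: "unitary_rep \<pi>" and e: "rep_basis \<pi> e"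
  shows "(\<integral>t. vm_convolution m \<nu> f g x' t * cnj (rep_coeff \<pi> e j i t) \<partial>m)
    = (\<Sum>k<rep_dim \<pi>. (\<integral>u. f u * cnj (rep_coeff \<pi> e j k u) \<partial>m)
        * x' (vector_integral \<nu> UNIV (\<lambda>t. g t * cnj (rep_coeff \<pi> e k i t))))"
proof -
  have c: "continuous_on UNIV (\<lambda>t. cnj (rep_coeff \<pi> e k i t))" for k
    by (intro continuous_intros continuous_rep_coeff \<pi>)
  obtain b where b: "\<And>t. cmod (cnj (rep_coeff \<pi> e j i t)) \<le> b"
    using continuous_bounded[OF compact_UNIV c] by blast
  have "(\<integral>t. vm_convolution m \<nu> f g x' t * cnj (rep_coeff \<pi> e j i t) \<partial>m)
      = (\<integral>s. g s * h x' s * (\<integral>u. f u * cnj (rep_coeff \<pi> e j i (u + s)) \<partial>m) \<partial>m)"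
    unfolding vm_convolution_def
    by (rule integral_convolution[OF f L1_vm_integrable[OF g x'] borel_measurable_continuous_onI[OF c] b])
  also have "\<dots> = x' (vector_integral \<nu> UNIV (\<lambda>t. g t *
      (\<Sum>k<rep_dim \<pi>. (\<integral>u. f u * cnj (rep_coeff \<pi> e j k u) \<partial>m) * cnj (rep_coeff \<pi> e k i t))))"
    unfolding integral_times_rep_coeff_plus[OF f \<pi> e]
    by (intro dual_vector_integral_times_continuous[symmetric] g x' continuous_intros c)
  finally show ?thesis unfolding dual_sum_rep_coeff[OF g x' \<pi>] .
qed

end

theorem theorem6p7:
  fixes m :: "'g::{topological_group_add, t2_space} measure"
    and \<nu> :: "'g set \<Rightarrow> 'x::{complex_normed_space, complete_space}"
    and matrix_norm :: "'x mat \<Rightarrow> real"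
    and f g :: "'g \<Rightarrow> complex"
    and \<pi> :: "'g \<Rightarrow> 'h::{complex_inner, complete_space} \<Rightarrow> 'h"
    and e :: "nat \<Rightarrow> 'h"
  assumes "compact (UNIV :: 'g set)"
    and "normalized_haar m"
    and "operator_space matrix_norm"
    and "\<nu> \<in> M_ac m"
    and "semivariation_translation_invariant \<nu>"
    and "\<nu> UNIV \<noteq> 0"
    and "f \<in> L1_vm \<nu>"
    and "g \<in> L1_vm \<nu>"
    and "irreducible_unitary_rep \<pi>"
    and "rep_basis \<pi> e"
  shows "(\<forall>x'\<in>dual.
            fourier m (vm_convolution m \<nu> f g x') \<pi> e
              = of_nat (rep_dim \<pi>) \<cdot>\<^sub>m
                  map_mat x' (right_mat_mult (vm_fourier \<nu> g \<pi> e) (fourier m f \<pi> e))) \<and>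
         (\<forall>i<rep_dim \<pi>. \<forall>j<rep_dim \<pi>.
            right_mat_mult (vm_fourier \<nu> g \<pi> e) (fourier m f \<pi> e) $$ (i, j)
              = (1 / (of_nat (rep_dim \<pi>))\<^sup>2) *\<^sub>C
                  vector_integral \<nu> UNIV
                    (\<lambda>t. convolution m (reflect f) (\<lambda>s. cnj (rep_coeff \<pi> e j i s)) t * g t))"
proof -
  interpret compact_haar m by (rule compact_haarI[OF assms(1,2)])
  interpret haar_vector_measure m \<nu> by unfold_locales (rule assms(4))
  note e = assms(10) and g = assms(8)
  have \<pi>: "unitary_rep \<pi>" using assms(9) by (simp add: irreducible_unitary_rep_def)
  have f: "integrable m f" by (rule L1_vm_imp_integrable[OF assms(5,6,7)])
  define d where "d = rep_dim \<pi>"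
  define F where "F k j = (\<integral>u. f u * cnj (rep_coeff \<pi> e j k u) \<partial>m)" for k j
  define G where "G i k = vector_integral \<nu> UNIV (\<lambda>t. g t * cnj (rep_coeff \<pi> e k i t))" for i k
  let ?P = "right_mat_mult (vm_fourier \<nu> g \<pi> e) (fourier m f \<pi> e)"
  have dim: "dim_row ?P = d" "dim_col ?P = d"
    by (simp_all add: right_mat_mult_def vm_fourier_def fourier_def d_def)
  have entry: "?P $$ (i, j) = (\<Sum>k<d. (1 / of_nat d * F k j) *\<^sub>C (1 / of_nat d) *\<^sub>C G i k)"
    if "i < d" "j < d" for i j
    using that by (simp add: right_mat_mult_def vm_fourier_def fourier_def d_def F_def G_def)
  have dual_entry: "x' (?P $$ (i, j)) = 1 / (of_nat d)\<^sup>2 * (\<Sum>k<d. F k j * x' (G i k))"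
    if "i < d" "j < d" "x' \<in> dual" for i j x'
    using that(3) by (simp add: entry that(1,2) dual_sum dual_scaleC sum_distrib_left power2_eq_square)
  show ?thesis
  proof (intro conjI ballI allI impI)
    fix x' :: "'x \<Rightarrow> complex" assume x': "x' \<in> dual"
    show "fourier m (vm_convolution m \<nu> f g x') \<pi> e = of_nat (rep_dim \<pi>) \<cdot>\<^sub>m map_mat x' ?P"
    proof (rule eq_matI)
      fix i j assume "i < dim_row (of_nat (rep_dim \<pi>) \<cdot>\<^sub>m map_mat x' ?P)"
        "j < dim_col (of_nat (rep_dim \<pi>) \<cdot>\<^sub>m map_mat x' ?P)"
      then have ij: "i < d" "j < d" by (simp_all add: dim)
      have "fourier m (vm_convolution m \<nu> f g x') \<pi> e $$ (i, j) = 1 / of_nat d * (\<Sum>k<d. F k j * x' (G i k))"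
        using ij by (simp add: fourier_def integral_vm_convolution[OF f g x' \<pi> e] d_def F_def G_def)
      also have "\<dots> = of_nat d * x' (?P $$ (i, j))"
        using ij by (simp add: dual_entry[OF ij x'] power2_eq_square)
      finally show "fourier m (vm_convolution m \<nu> f g x') \<pi> e $$ (i, j)
          = (of_nat (rep_dim \<pi>) \<cdot>\<^sub>m map_mat x' ?P) $$ (i, j)"
        using ij dim by (simp add: d_def)
    qed (simp_all add: dim, simp_all add: fourier_def d_def)
  next
    fix i j assume "i < rep_dim \<pi>" "j < rep_dim \<pi>"
    then have ij: "i < d" "j < d" by (simp_all add: d_def)
    let ?w = "\<lambda>t. convolution m (reflect f) (\<lambda>s. cnj (rep_coeff \<pi> e j i s)) t * g t"
    have w: "?w = (\<lambda>t. g t * (\<Sum>k<d. F k j * cnj (rep_coeff \<pi> e k i t)))"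
      by (simp add: convolution_reflect_rep_coeff[OF f \<pi> e] F_def d_def mult.commute)
    show "?P $$ (i, j) = (1 / (of_nat (rep_dim \<pi>))\<^sup>2) *\<^sub>C vector_integral \<nu> UNIV ?w"
    proof (rule dual_separates)
      fix x' :: "'x \<Rightarrow> complex" assume x': "x' \<in> dual"
      show "x' (?P $$ (i, j)) = x' ((1 / (of_nat (rep_dim \<pi>))\<^sup>2) *\<^sub>C vector_integral \<nu> UNIV ?w)"
        unfolding w dual_entry[OF ij x'] dual_scaleC[OF x'] dual_sum_rep_coeff[OF g x' \<pi>]
        by (simp add: G_def d_def)
    qed
  qed
qed

end
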